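(* Let $k\ge3$. There exist a constant $c>0$ and sets $\nu_{\rho,\sigma}\subset\mathbb R^d$ ($\rho,\sigma\in\Lambda_*$), not depending on $u$, $x$ or $V$, satisfying $\nu_{\rho,\sigma}\subset B(0,c(|\rho|+|\sigma|))$, $-\nu_{\rho,\sigma}=\nu_{\rho,\sigma}$ and $$\operatorname{vol}(\nu_{\rho,\sigma})\lesssim|\rho\times\sigma|+|\rho|+|\sigma|,$$ such that, for every $u\in\dot W^{3,\infty}\cap K$ and every $x\in\mathbb R^d$, with $y(x):=\mathsf Ax+u(x)$, $$\big|\mathsf S^{\rm a}(u;x)-\mathsf S^{\rm c}(u;x)\big|\lesssim\sum_{\bm\rho\in\Lambda_*^2}m(\bm\rho)|\bm\rho|^2\,\|\nabla^3y\|_{L^\infty(x+\nu_{\rho_1,\rho_2})}+\sum_{\bm\rho\in\Lambda_*^3}m(\bm\rho)|\bm\rho|^2\,\|\nabla^2y\|_{L^\infty(x+\nu_{\rho_1,\rho_2})}\|\nabla^2y\|_{L^\infty(x+\nu_{\rho_1,\rho_3})}.$$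
   Context: $d\in\mathbb N$, $\Lambda=\mathbb Z^d$, $\Lambda_*=\Lambda\setminus\{0\}$; $|\cdot|$ is the Euclidean (Frobenius) norm; $|\rho\times\sigma|$ is the area of the parallelogram spanned by $\rho,\sigma$; $B(0,r)$ is the ball. $\mathsf A\in\mathbb R^{d\times d}$, $\det\mathsf A>0$, is fixed. $D_\rho v(\xi)=v(\xi+\rho)-v(\xi)$, $Dv(\xi)=(D_\rho v(\xi))_{\rho\in\Lambda_*}$. $\zeta\in W^{1,\infty}(\mathbb R^d;\mathbb R)$ is fixed, with $\zeta(0)=1$, $\zeta(\xi)=0$ for $\xi\in\Lambda_*$, $\zeta\ge0$, compact support, $\zeta(-x)=\zeta(x)$, and $\sum_{\xi\in\Lambda}(a+b\cdot\xi)\zeta(x-\xi)=a+b\cdot x$ for all $a\in\mathbb R$, $b\in\mathbb R^d$. Potential: $\mathscr D=\{g=(g_\rho)_{\rho\in\Lambda_*}: g_\rho\in\mathbb R^d,\ \|g\|_{\mathscr D}:=\sup_\rho|g_\rho|/|\rho|<\infty\}$, $\mathscr D_\kappa=\{g\in\mathscr D:\|g\|_{\mathscr D}\le\kappa\}$. $V:\mathscr D\to\mathbb R\cup\{\pm\infty\}$ satisfies $V(0)=0$; $V((-g_{-\rho})_{\rho})=V(g)$ for all $g$; $V\in C^k(\mathscr D_\kappa)$ with $\kappa>0$ a fixed sufficiently small constant. For $\bm\rho=(\rho_1,\dots,\rho_j)\in\Lambda_*^j$, $V_{\bm\rho}(g)=\partial^jV(g)/\partial g_{\rho_1}\cdots\partial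 g_{\rho_j}$ is a $j$-linear form on $(\mathbb R^d)^j$, and $\delta^jV(g)[h_1,\dots,h_j]=\sum_{\bm\rho\in\Lambda_*^j}V_{\bm\rho}(g)[(h_1)_{\rho_1},\dots,(h_j)_{\rho_j}]$. $m(\bm\rho)=\prod_{i=1}^j|\rho_i|\,\sup_{g\in\mathscr D_\kappa}\|V_{\bm\rho}(g)\|$, where $\|\ell\|=\sup_{|h_1|=\dots=|h_j|=1}\ell[h_1,\dots,h_j]$; $|\bm\rho|=\sum_i|\rho_i|$. It is assumed that $M^{(j)}:=\sum_{\bm\rho\in\Lambda_*^j}m(\bm\rho)<\infty$ for $1\le j\le k$. Function sets: $\dot W^{3,\infty}=\{u\in W^{3,\infty}_{\rm loc}(\mathbb R^d;\mathbb R^d):\nabla u\in W^{2,\infty}\}$ (modulo constants), $K=\{u\in W^{1,\infty}_{\rm loc}:\|\nabla u\|_{L^\infty}\le\kappa\}$. Stresses: the atomistic stress of (the restriction to $\Lambda$ of) $u$ is $\mathsf S^{\rm a}(u;x)=\sum_{\xi\in\Lambda}\sum_{\rho\in\Lambda_*}[V_\rho(Du(\xi))\otimes\rho]\,\chi_{\xi,\rho}(x)$, $\chi_{\xi,\rho}(x)=\int_0^1\zeta(\xi+t\rho-x)\,dt$. The Cauchy--Born stress is $\mathsf S^{\rm c}_{i\alpha}(u;x)=\partial W(\mathsf F)/\partial\mathsf F_{i\alpha}|_{\mathsf F=\nabla u(x)}$, where $W(\mathsf F)=V((\mathsf F\rho)_{\rho\in\Lambda_*})$. $a\lesssim b$ means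 $a\le Cb$ with a generic constant $C$ independent of the interaction potential, of any data in the model, and of any functions or points involved (it depends only on fixed quantities such as $d$ and $\zeta$). *)

theory Defs
  imports "HOL-Probability.Essential_Supremum" "HOL-Analysis.Analysis"
begin

definition lattice :: "(real ^ 'n) set" where
  "lattice = {\<xi>. \<forall>i. \<xi> $ i \<in> \<int>}"

definition lattice_nz :: "(real ^ 'n) set" where
  "lattice_nz = lattice - {0}"

definition lattice_tuples :: "nat \<Rightarrow> (real ^ 'n) list set" where
  "lattice_tuples j = {\<rho>s. length \<rho>s = j \<and> set \<rho>s \<subseteq> lattice_nz}"

text \<open>The area of the parallelogram, as the square root of the Gram determinant.\<close>
definition parallelogram_area :: "real ^ 'n \<Rightarrow> real ^ 'n \<Rightarrow> real" where
  "parallelogram_area \<rho> \<sigma> = sqrt ((norm \<rho>)\<^sup>2 * (norm \<sigma>)\<^sup>2 - (\<rho> \<bullet> \<sigma>)\<^sup>2)"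

text \<open>A family indexed by the nonzero lattice vectors is stored as a total function
  vanishing off the index set.\<close>
definition dfam_carrier :: "(real ^ 'n \<Rightarrow> real ^ 'n) set" where
  "dfam_carrier = {g. (\<forall>\<rho>. \<rho> \<notin> lattice_nz \<longrightarrow> g \<rho> = 0) \<and>
     bdd_above ((\<lambda>\<rho>. norm (g \<rho>) / norm \<rho>) ` lattice_nz)}"

lemma dfam_carrierI:
  assumes "\<And>\<rho>. \<rho> \<notin> lattice_nz \<Longrightarrow> g \<rho> = 0"
    and "\<And>\<rho>. \<rho> \<in> lattice_nz \<Longrightarrow> norm (g \<rho>) / norm \<rho> \<le> C"
  shows "g \<in> dfam_carrier"
  using assms unfolding dfam_carrier_def by (auto intro!: bdd_aboveI2)

typedef (overloaded) ('n::finite) dfam = "dfam_carrier :: (real ^ 'n \<Rightarrow> real ^ 'n) set"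
  morphisms fam Fam
  by (rule exI[of _ "\<lambda>_. 0"], rule dfam_carrierI[where C = 0]) auto

lemma lattice_nz_nonempty: "(lattice_nz :: (real ^ 'n) set) \<noteq> {}"
proof -
  have "(axis undefined 1 :: real ^ 'n) \<in> lattice_nz"
    by (auto simp: lattice_nz_def lattice_def axis_def vec_eq_iff)
  then show ?thesis by blast
qed

lemma fam_off: "\<rho> \<notin> lattice_nz \<Longrightarrow> fam g \<rho> = 0"
  using fam[of g] by (auto simp: dfam_carrier_def)

lemma fam_bdd: "bdd_above ((\<lambda>\<rho>. norm (fam g \<rho>) / norm \<rho>) ` lattice_nz)"
  using fam[of g] by (auto simp: dfam_carrier_def)

lemma fam_le: 
  "\<rho> \<in> lattice_nz \<Longrightarrow> norm (fam g \<rho>) / norm \<rho> \<le> (SUP \<rho>\<in>lattice_nz. norm (fam g \<rho>) / norm \<rho>)"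
  by (rule cSUP_upper[OF _ fam_bdd])

lemma lattice_nz_pos: "\<rho> \<in> lattice_nz \<Longrightarrow> norm \<rho> > 0"
  by (auto simp: lattice_nz_def)

lemma add_in_dfam:
  fixes g h :: "'n::finite dfam"
  shows "(\<lambda>\<rho>. fam g \<rho> + fam h \<rho>) \<in> dfam_carrier"
proof (rule dfam_carrierI)
  fix \<rho> :: "real ^ 'n" assume r: "\<rho> \<in> lattice_nz"
  have "norm (fam g \<rho> + fam h \<rho>) / norm \<rho> \<le> norm (fam g \<rho>) / norm \<rho> + norm (fam h \<rho>) / norm \<rho>"
    by (simp add: norm_triangle_ineq divide_right_mono flip: add_divide_distrib)
  also have "\<dots> \<le> (SUP \<rho>\<in>lattice_nz. norm (fam g \<rho>) / norm \<rho>) + (SUP \<rho>\<in>lattice_nz. norm (fam h \<rho>) / norm \<rho>)"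
    using fam_le[OF r] by (intro add_mono)
  finally show "norm (fam g \<rho> + fam h \<rho>) / norm \<rho> \<le> \<dots>" .
qed (simp add: fam_off)

lemma scale_in_dfam:
  fixes g :: "'n::finite dfam"
  shows "(\<lambda>\<rho>. c *\<^sub>R fam g \<rho>) \<in> dfam_carrier"
proof (rule dfam_carrierI)
  fix \<rho> :: "real ^ 'n" assume r: "\<rho> \<in> lattice_nz"
  show "norm (c *\<^sub>R fam g \<rho>) / norm \<rho> \<le> \<bar>c\<bar> * (SUP \<rho>\<in>lattice_nz. norm (fam g \<rho>) / norm \<rho>)"
    using mult_left_mono[OF fam_le[OF r, of g], of "\<bar>c\<bar>"] by simp
qed (simp add: fam_off)

instantiation dfam :: (finite) real_vector
begin

definition zero_dfam :: "'a dfam" where "0 = Fam (\<lambda>_. 0)"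
definition plus_dfam :: "'a dfam \<Rightarrow> 'a dfam \<Rightarrow> 'a dfam" where
  "g + h = Fam (\<lambda>\<rho>. fam g \<rho> + fam h \<rho>)"
definition scaleR_dfam :: "real \<Rightarrow> 'a dfam \<Rightarrow> 'a dfam" where
  "c *\<^sub>R g = Fam (\<lambda>\<rho>. c *\<^sub>R fam g \<rho>)"
definition uminus_dfam :: "'a dfam \<Rightarrow> 'a dfam" where "- g = Fam (\<lambda>\<rho>. - fam g \<rho>)"
definition minus_dfam :: "'a dfam \<Rightarrow> 'a dfam \<Rightarrow> 'a dfam" where "g - h = Fam (\<lambda>\<rho>. fam g \<rho> - fam h \<rho>)"
lemma fam_zero: "fam (0 :: 'a dfam) = (\<lambda>_. 0)"
  unfolding zero_dfam_def by (rule Fam_inverse, rule dfam_carrierI[where C = 0]) auto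
lemma fam_plus: "fam (g + h :: 'a dfam) = (\<lambda>\<rho>. fam g \<rho> + fam h \<rho>)"
  unfolding plus_dfam_def by (rule Fam_inverse, rule add_in_dfam)
lemma fam_scaleR: "fam (c *\<^sub>R g :: 'a dfam) = (\<lambda>\<rho>. c *\<^sub>R fam g \<rho>)"
  unfolding scaleR_dfam_def by (rule Fam_inverse, rule scale_in_dfam)
lemma fam_uminus: "fam (- g :: 'a dfam) = (\<lambda>\<rho>. - fam g \<rho>)"
  unfolding uminus_dfam_def using scale_in_dfam[of "-1" g] by (intro Fam_inverse) simp
lemma fam_minus: "fam (g - h :: 'a dfam) = (\<lambda>\<rho>. fam g \<rho> - fam h \<rho>)"
  unfolding minus_dfam_def using add_in_dfam[of g "- h"] by (intro Fam_inverse) (simp add: fam_uminus)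

instance
  by standard (simp_all add: fam_zero fam_plus fam_scaleR fam_uminus fam_minus algebra_simps flip: fam_inject)

end

instantiation dfam :: (finite) real_normed_vector
begin

definition norm_dfam :: "'a dfam \<Rightarrow> real" where
  "norm_dfam g = (SUP \<rho>\<in>lattice_nz. norm (fam g \<rho>) / norm \<rho>)"
definition dist_dfam :: "'a dfam \<Rightarrow> 'a dfam \<Rightarrow> real" where "dist_dfam g h = norm (g - h)"
definition sgn_dfam :: "'a dfam \<Rightarrow> 'a dfam" where "sgn_dfam g = g /\<^sub>R norm g"
definition uniformity_dfam :: "('a dfam \<times> 'a dfam) filter" where
  "uniformity_dfam = (INF e\<in>{0<..}. principal {(x, y). dist x y < e})"
definition open_dfam :: "'a dfam set \<Rightarrow> bool" where
  "open_dfam U \<longleftrightarrow> (\<forall>x\<in>U. eventually (\<lambda>(x', y). x' = x \<longrightarrow> y \<in> U) uniformity)"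

instance
proof
  fix g h :: "'a dfam" and a :: real
  note F = fam_zero fam_plus fam_scaleR fam_uminus fam_minus
  show "dist g h = norm (g - h)" "sgn g = inverse (norm g) *\<^sub>R g"
    "uniformity = (INF e\<in>{0<..}. principal {(x, y). dist (x :: 'a dfam) y < e})"
    by (simp_all add: dist_dfam_def sgn_dfam_def uniformity_dfam_def)
  show "open U = (\<forall>x\<in>U. \<forall>\<^sub>F (x', y) in uniformity. x' = x \<longrightarrow> y \<in> U)" for U :: "'a dfam set"
    by (simp add: open_dfam_def)
  have le: "norm (fam x \<rho>) / norm \<rho> \<le> norm x" if "\<rho> \<in> lattice_nz" for x :: "'a dfam" and \<rho>
    using fam_le[OF that] by (simp add: norm_dfam_def)
  have lub: "norm x \<le> C" if "\<And>\<rho>. \<rho> \<in> lattice_nz \<Longrightarrow> norm (fam x \<rho>) / norm \<rho> \<le> C" 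
    for x :: "'a dfam" and C
    unfolding norm_dfam_def by (rule cSUP_least[OF lattice_nz_nonempty that])
  show "norm g = 0 \<longleftrightarrow> g = 0"
  proof
    assume n: "norm g = 0"
    have "fam g \<rho> = 0" for \<rho>
    proof (cases "\<rho> \<in> lattice_nz")
      case True
      then show ?thesis using le[OF True, of g] lattice_nz_pos[OF True] n
        by (simp add: divide_le_0_iff)
    qed (simp add: fam_off)
    then show "g = 0" by (simp add: F fun_eq_iff flip: fam_inject)
  next
    assume "g = 0"
    then show "norm g = 0"
      using lattice_nz_nonempty[where 'n = 'a] by (simp add: norm_dfam_def F)
  qed
  show "norm (g + h) \<le> norm g + norm h"
  proof (rule lub)
    fix \<rho> :: "real ^ 'a" assume r: "\<rho> \<in> lattice_nz"
    have "norm (fam (g + h) \<rho>) / norm \<rho> \<le> norm (fam g \<rho>) / norm \<rho> + norm (fam h \<rho>) / norm \<rho>"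
      by (simp add: F norm_triangle_ineq divide_right_mono flip: add_divide_distrib)
    then show "norm (fam (g + h) \<rho>) / norm \<rho> \<le> norm g + norm h"
      using le[OF r, of g] le[OF r, of h] by linarith
  qed
  have sc: "norm (c *\<^sub>R x) \<le> \<bar>c\<bar> * norm x" for c and x :: "'a dfam"
  proof (rule lub)
    fix \<rho> :: "real ^ 'a" assume r: "\<rho> \<in> lattice_nz"
    show "norm (fam (c *\<^sub>R x) \<rho>) / norm \<rho> \<le> \<bar>c\<bar> * norm x"
      using mult_left_mono[OF le[OF r, of x], of "\<bar>c\<bar>"] by (simp add: F)
  qed
  show "norm (a *\<^sub>R g) = \<bar>a\<bar> * norm g"
  proof (cases "a = 0")
    case True
    then show ?thesis
      using sc[of 0 g] lattice_nz_nonempty[where 'n = 'a] by (simp add: norm_dfam_def F)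
  next
    case False
    have "g = inverse a *\<^sub>R (a *\<^sub>R g)"
      using False by (simp add: F flip: fam_inject)
    then have "norm g \<le> \<bar>inverse a\<bar> * norm (a *\<^sub>R g)" by (metis sc)
    then have "\<bar>a\<bar> * norm g \<le> norm (a *\<^sub>R g)"
      using False by (simp add: field_simps)
    then show ?thesis using sc[of a g] by simp
  qed
qed

end

text \<open>Only meaningful when \<open>v \<rho> / norm \<rho>\<close> is bounded over the nonzero lattice vectors; this is
  automatic for the families built below, given a bounded gradient in the case of
  \<open>diff_family\<close>.\<close>
definition dfam_of :: "(real ^ 'n \<Rightarrow> real ^ 'n) \<Rightarrow> 'n dfam" where
  "dfam_of v = Fam (\<lambda>\<rho>. if \<rho> \<in> lattice_nz then v \<rho> else 0)"

definition diff_family :: "(real ^ 'n \<Rightarrow> real ^ 'n) \<Rightarrow> real ^ 'n \<Rightarrow> 'n dfam" where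
  "diff_family u \<xi> = dfam_of (\<lambda>\<rho>. u (\<xi> + \<rho>) - u \<xi>)"

definition linear_family :: "real ^ 'n ^ 'n \<Rightarrow> 'n dfam" where
  "linear_family F = dfam_of (\<lambda>\<rho>. F *v \<rho>)"

definition single_family :: "real ^ 'n \<Rightarrow> real ^ 'n \<Rightarrow> 'n dfam" where
  "single_family \<rho> v = dfam_of (\<lambda>\<sigma>. if \<sigma> = \<rho> then v else 0)"

definition reflect_family :: "'n::finite dfam \<Rightarrow> 'n dfam" where
  "reflect_family g = dfam_of (\<lambda>\<rho>. - fam g (- \<rho>))"

text \<open>For \<open>hs = [h\<^sub>1, \<dots>, h\<^sub>j]\<close> this is the \<open>j\<close>-th derivative of \<open>f\<close> at \<open>g\<close>, evaluated at
  \<open>h\<^sub>1, \<dots>, h\<^sub>j\<close>. Derivatives are taken within \<open>S\<close>; they are unique, also at boundary points, when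
  \<open>S\<close> is a closed ball of positive radius.\<close>
primrec iter_deriv ::
    "'a::real_normed_vector set \<Rightarrow> ('a \<Rightarrow> real) \<Rightarrow> 'a list \<Rightarrow> 'a \<Rightarrow> real" where
  "iter_deriv S f [] g = f g"
| "iter_deriv S f (h # hs) g = frechet_derivative (iter_deriv S f hs) (at g within S) h"

definition unit_bounded :: "'a::real_normed_vector list \<Rightarrow> bool" where
  "unit_bounded hs \<longleftrightarrow> (\<forall>h\<in>set hs. norm h \<le> 1)"

text \<open>\<open>k\<close>-fold continuous Frechet differentiability within \<open>S\<close>. For \<open>j < k\<close> the \<open>j\<close>-th derivative, as
  a map into the \<open>j\<close>-linear forms with the operator norm, is Frechet differentiable (the
  remainder is uniform in the arguments \<open>hs\<close> from the unit ball), and the \<open>k\<close>-th derivative is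
  continuous in the operator norm.\<close>
definition Ck_on :: "nat \<Rightarrow> 'a::real_normed_vector set \<Rightarrow> ('a \<Rightarrow> real) \<Rightarrow> bool" where
  "Ck_on k S f \<longleftrightarrow>
     (\<forall>j<k. \<forall>g\<in>S.
        (\<forall>hs. length hs = j \<longrightarrow> iter_deriv S f hs differentiable (at g within S)) \<and>
        (\<forall>\<epsilon>>0. \<exists>\<delta>>0. \<forall>g'\<in>S. dist g' g < \<delta> \<longrightarrow>
           (\<forall>hs. length hs = j \<and> unit_bounded hs \<longrightarrow>
              \<bar>iter_deriv S f hs g' - iter_deriv S f hs g - iter_deriv S f ((g' - g) # hs) g\<bar>
                \<le> \<epsilon> * norm (g' - g)))) \<and>
     (\<forall>g\<in>S. \<forall>\<epsilon>>0. \<exists>\<delta>>0. \<forall>g'\<in>S. dist g' g < \<delta> \<longrightarrow>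
        (\<forall>hs. length hs = k \<and> unit_bounded hs \<longrightarrow>
           \<bar>iter_deriv S f hs g' - iter_deriv S f hs g\<bar> \<le> \<epsilon>))"

text \<open>\<open>iter_partial \<phi> [i\<^sub>1, \<dots>, i\<^sub>j]\<close> is the classical iterated partial derivative.\<close>
definition iter_partial :: "(real ^ 'n \<Rightarrow> real) \<Rightarrow> 'n list \<Rightarrow> real ^ 'n \<Rightarrow> real" where
  "iter_partial \<phi> is = iter_deriv UNIV \<phi> (map (\<lambda>i. axis i 1) is)"

definition test_function :: "(real ^ 'n \<Rightarrow> real) \<Rightarrow> bool" where
  "test_function \<phi> \<longleftrightarrow> (\<forall>is. iter_partial \<phi> is differentiable_on UNIV) \<and>
     compact (closure {x. \<phi> x \<noteq> 0})"

definition locally_integrable :: "(real ^ 'n \<Rightarrow> real) \<Rightarrow> bool" where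
  "locally_integrable f \<longleftrightarrow> (\<forall>K. compact K \<longrightarrow> set_integrable lborel K f)"

definition has_weak_deriv ::
    "(real ^ 'n \<Rightarrow> real) \<Rightarrow> 'n list \<Rightarrow> (real ^ 'n \<Rightarrow> real) \<Rightarrow> bool" where
  "has_weak_deriv f is g \<longleftrightarrow> locally_integrable f \<and> locally_integrable g \<and>
     (\<forall>\<phi>. test_function \<phi> \<longrightarrow>
        (LINT x|lborel. f x * iter_partial \<phi> is x) = (- 1) ^ length is * (LINT x|lborel. g x * \<phi> x))"

text \<open>Some version of the weak derivative (versions agree almost everywhere).\<close>
definition weak_deriv :: "(real ^ 'n \<Rightarrow> real) \<Rightarrow> 'n list \<Rightarrow> real ^ 'n \<Rightarrow> real" where
  "weak_deriv f is = (SOME g. has_weak_deriv f is g)"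

definition Linf_norm :: "(real ^ 'n) set \<Rightarrow> (real ^ 'n \<Rightarrow> 'b::real_normed_vector) \<Rightarrow> ennreal" where
  "Linf_norm S f = esssup (restrict_space lborel S) (\<lambda>x. ennreal (norm (f x)))"

definition W_inf :: "nat \<Rightarrow> (real ^ 'n \<Rightarrow> real) set" where
  "W_inf m = {f. \<forall>is. length is \<le> m \<longrightarrow>
     (\<exists>g\<in>borel_measurable lborel. has_weak_deriv f is g \<and> Linf_norm UNIV g < \<infinity>)}"

definition W_inf_loc :: "nat \<Rightarrow> (real ^ 'n \<Rightarrow> real) set" where
  "W_inf_loc m = {f. \<forall>is. length is \<le> m \<longrightarrow>
     (\<exists>g\<in>borel_measurable lborel. has_weak_deriv f is g \<and>
        (\<forall>K. compact K \<longrightarrow> Linf_norm K g < \<infinity>))}"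

definition weak_grad :: "(real ^ 'n \<Rightarrow> real ^ 'n) \<Rightarrow> real ^ 'n \<Rightarrow> real ^ 'n ^ 'n" where
  "weak_grad y x = (\<chi> i \<alpha>. weak_deriv (\<lambda>z. y z $ i) [\<alpha>] x)"

definition weak_grad2 :: "(real ^ 'n \<Rightarrow> real ^ 'n) \<Rightarrow> real ^ 'n \<Rightarrow> real ^ 'n ^ 'n ^ 'n" where
  "weak_grad2 y x = (\<chi> i \<alpha> \<beta>. weak_deriv (\<lambda>z. y z $ i) [\<alpha>, \<beta>] x)"

definition weak_grad3 :: "(real ^ 'n \<Rightarrow> real ^ 'n) \<Rightarrow> real ^ 'n \<Rightarrow> real ^ 'n ^ 'n ^ 'n ^ 'n" where
  "weak_grad3 y x = (\<chi> i \<alpha> \<beta> \<gamma>. weak_deriv (\<lambda>z. y z $ i) [\<alpha>, \<beta>, \<gamma>] x)"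

definition W3_inf_dot :: "(real ^ 'n \<Rightarrow> real ^ 'n) set" where
  "W3_inf_dot = {u. \<forall>i. (\<lambda>x. u x $ i) \<in> W_inf_loc 3 \<and>
     (\<forall>\<alpha>. (\<lambda>x. weak_grad u x $ i $ \<alpha>) \<in> W_inf 2)}"

definition K_set :: "real \<Rightarrow> (real ^ 'n \<Rightarrow> real ^ 'n) set" where
  "K_set \<kappa> = {u. (\<forall>i. (\<lambda>x. u x $ i) \<in> W_inf_loc 1) \<and> Linf_norm UNIV (weak_grad u) \<le> ennreal \<kappa>}"

definition V_deriv :: "real \<Rightarrow> ('n::finite dfam \<Rightarrow> ereal) \<Rightarrow> 'n dfam list \<Rightarrow> 'n dfam \<Rightarrow> real" where
  "V_deriv \<kappa> V hs g = iter_deriv (cball 0 \<kappa>) (\<lambda>g. real_of_ereal (V g)) hs g"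

text \<open>The partial derivative with respect to the components \<open>\<rho>s\<close>, as a multilinear form in the list
  \<open>vs\<close>.\<close>
definition V_partial ::
    "real \<Rightarrow> ('n::finite dfam \<Rightarrow> ereal) \<Rightarrow> (real ^ 'n) list \<Rightarrow> 'n dfam \<Rightarrow> (real ^ 'n) list \<Rightarrow> real" where
  "V_partial \<kappa> V \<rho>s g vs = V_deriv \<kappa> V (map2 single_family \<rho>s vs) g"

text \<open>Replacing one argument by its negative shows that the supremum of a multilinear form is
  nonnegative, so the truncation of negative values by \<open>ennreal\<close> is harmless (\<open>j \<ge> 1\<close>).\<close>
definition form_norm :: "nat \<Rightarrow> ((real ^ 'n) list \<Rightarrow> real) \<Rightarrow> ennreal" where
  "form_norm j l = (SUP vs\<in>{vs. length vs = j \<and> (\<forall>v\<in>set vs. norm v = 1)}. ennreal (l vs))"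

definition m_weight :: "real \<Rightarrow> ('n::finite dfam \<Rightarrow> ereal) \<Rightarrow> (real ^ 'n) list \<Rightarrow> ennreal" where
  "m_weight \<kappa> V \<rho>s = ennreal (\<Prod>\<rho>\<leftarrow>\<rho>s. norm \<rho>) *
     (SUP g\<in>cball 0 \<kappa>. form_norm (length \<rho>s) (V_partial \<kappa> V \<rho>s g))"

definition tuple_length :: "(real ^ 'n) list \<Rightarrow> real" where
  "tuple_length \<rho>s = (\<Sum>\<rho>\<leftarrow>\<rho>s. norm \<rho>)"

text \<open>The representation of the derivatives by sums over lattice tuples is a genuine
  requirement: on this space of bounded families, derivatives
  need not be determined by their values on finitely supported families.\<close>
definition admissible_potential :: "nat \<Rightarrow> real \<Rightarrow> ('n::finite dfam \<Rightarrow> ereal) \<Rightarrow> bool" where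
  "admissible_potential k \<kappa> V \<longleftrightarrow>
     V 0 = 0 \<and>
     (\<forall>g. V (reflect_family g) = V g) \<and>
     (\<forall>g\<in>cball 0 \<kappa>. \<bar>V g\<bar> \<noteq> \<infinity>) \<and>
     Ck_on k (cball 0 \<kappa>) (\<lambda>g. real_of_ereal (V g)) \<and>
     (\<forall>j\<in>{1..k}. \<forall>g\<in>cball 0 \<kappa>. \<forall>hs. length hs = j \<longrightarrow>
        ((\<lambda>\<rho>s. V_partial \<kappa> V \<rho>s g (map2 fam hs \<rho>s)) has_sum V_deriv \<kappa> V hs g) (lattice_tuples j)) \<and>
     (\<forall>j\<in>{1..k}. (\<Sum>\<^sub>\<infinity>\<rho>s\<in>lattice_tuples j. m_weight \<kappa> V \<rho>s) < \<infinity>)"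

definition bond_weight :: "(real ^ 'n \<Rightarrow> real) \<Rightarrow> real ^ 'n \<Rightarrow> real ^ 'n \<Rightarrow> real ^ 'n \<Rightarrow> real" where
  "bond_weight \<zeta> \<xi> \<rho> x = integral {0..1} (\<lambda>t. \<zeta> (\<xi> + t *\<^sub>R \<rho> - x))"

definition outer :: "real ^ 'n \<Rightarrow> real ^ 'n \<Rightarrow> real ^ 'n ^ 'n" where
  "outer v w = (\<chi> i \<alpha>. v $ i * w $ \<alpha>)"

definition V_force :: "real \<Rightarrow> ('n::finite dfam \<Rightarrow> ereal) \<Rightarrow> real ^ 'n \<Rightarrow> 'n dfam \<Rightarrow> real ^ 'n" where
  "V_force \<kappa> V \<rho> g = (\<chi> i. V_partial \<kappa> V [\<rho>] g [axis i 1])"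

text \<open>Both sums converge absolutely for admissible potentials and \<open>u\<close> in \<open>K_set \<kappa>\<close>, so the default
  value of \<open>infsum\<close> plays no role. The norm of a matrix (and of the iterated vectors used for
  \<open>weak_grad2\<close>, \<open>weak_grad3\<close>) is the Frobenius norm.\<close>
definition atomistic_stress ::
    "real \<Rightarrow> ('n::finite dfam \<Rightarrow> ereal) \<Rightarrow> (real ^ 'n \<Rightarrow> real) \<Rightarrow> (real ^ 'n \<Rightarrow> real ^ 'n) \<Rightarrow> real ^ 'n
      \<Rightarrow> real ^ 'n ^ 'n" where
  "atomistic_stress \<kappa> V \<zeta> u x =
     (\<Sum>\<^sub>\<infinity>\<xi>\<in>lattice. \<Sum>\<^sub>\<infinity>\<rho>\<in>lattice_nz.
        bond_weight \<zeta> \<xi> \<rho> x *\<^sub>R outer (V_force \<kappa> V \<rho> (diff_family u \<xi>)) \<rho>)"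

definition CB_energy :: "('n::finite dfam \<Rightarrow> ereal) \<Rightarrow> real ^ 'n ^ 'n \<Rightarrow> ereal" where
  "CB_energy V F = V (linear_family F)"

text \<open>The derivative is taken within the matrices whose linear family lies in the ball on which
  \<open>V\<close> is smooth. The function \<open>u\<close> is the continuous representative; for the functions considered it
  is continuously differentiable, and its Jacobian is the continuous representative of the weak
  gradient.\<close>
definition CB_stress ::
    "real \<Rightarrow> ('n::finite dfam \<Rightarrow> ereal) \<Rightarrow> (real ^ 'n \<Rightarrow> real ^ 'n) \<Rightarrow> real ^ 'n \<Rightarrow> real ^ 'n ^ 'n" where
  "CB_stress \<kappa> V u x = (\<chi> i \<alpha>.
     frechet_derivative (\<lambda>F. real_of_ereal (CB_energy V F))
       (at (jacobian u (at x)) within {F. linear_family F \<in> cball 0 \<kappa>}) (axis i (axis \<alpha> 1)))"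

end

theory Submission
  imports Defs
begin

text \<open>
  Both stresses are sums over bonds \<open>\<rho>\<close>. Because the weights \<open>\<chi>\<^sub>\<xi>\<^sub>,\<^sub>\<rho>(x)\<close> of a bond sum to one over the
  sites \<open>\<xi>\<close>, their difference is the weighted mean over \<open>\<xi>\<close> of \<open>V\<^sub>\<rho>(Du(\<xi>)) - V\<^sub>\<rho>(F \<cdot>)\<close> with
  \<open>F = \<nabla>u(x)\<close>, tensored with \<open>\<rho>\<close>. Let \<open>w\<^sub>\<xi> = Du(\<xi>) - F \<cdot>\<close> and expand in \<open>w\<^sub>\<xi>\<close> (\<open>force_taylor\<close>).

  The quadratic remainder pairs the third derivative of \<open>V\<close> at bonds \<open>\<rho>, \<sigma>, \<tau>\<close> with two increments, and
  each is at most a constant times \<open>|\<sigma>| (|\<rho>| + |\<sigma>|)\<close> times a bound for the second derivatives of \<open>y\<close>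
  near the triangle with vertices \<open>x\<close>, \<open>\<xi>\<close>, \<open>\<xi> + \<sigma>\<close>. The weight vanishes unless \<open>x\<close> is within the
  support radius of the segment from \<open>\<xi>\<close> to \<open>\<xi> + \<rho>\<close>, so this triangle lies in \<open>x\<close> plus a
  parallelogram spanned by \<open>\<rho>\<close> and \<open>\<sigma>\<close> and thickened by a fixed radius (\<open>triangle_in_region\<close>). That
  thickened parallelogram is \<open>\<nu>\<^sub>\<rho>\<^sub>,\<^sub>\<sigma>\<close>; \<open>region_volume\<close> bounds its volume.

  In the linear term the mean of \<open>w\<^sub>\<xi>\<close> in the bond \<open>\<sigma>\<close> is expanded once more, to second order. Since
  \<open>\<zeta>\<close> reproduces affine functions, the mean of \<open>\<xi> - x\<close> is \<open>- \<rho>/2\<close>, and the mean equals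
  \<open>\<nabla>\<^sup>2u(x)[\<sigma>, (\<sigma> - \<rho>)/2]\<close> up to an error controlled by the third derivatives (\<open>wbar_taylor\<close>). This
  Hessian term is even under \<open>(\<rho>, \<sigma>) \<mapsto> (- \<rho>, - \<sigma>)\<close>, the second derivative of \<open>V\<close> at a homogeneous
  deformation is invariant by point symmetry (\<open>V_partial_reflect\<close>), and the factor \<open>\<rho>\<close> is odd, so the
  Hessian terms cancel in pairs (\<open>linear_part\<close>).

  Two technical points carry most of the text. First, the bounds use essential suprema of weak
  derivatives over the local sets. The Taylor estimates are therefore proved for mollifications of
  \<open>u\<close>, whose derivatives at a point are averages of the weak derivatives over a small ball, and then
  passed to the limit (\<open>taylor_expansion\<close>); the unit collar in \<open>\<nu>\<^sub>\<rho>\<^sub>,\<^sub>\<sigma>\<close> makes room for that ball.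
  Secondly, the derivatives of \<open>V\<close> live on a closed ball of the space of families, and the gradient of
  \<open>u\<close> may lie on its boundary; uniqueness and symmetry of the derivatives are extended to the boundary
  by convexity and continuity (\<open>has_derivative_unique_convex\<close>, \<open>deriv_swap\<close>).
\<close>

section \<open>The interaction regions and their volume\<close>

text \<open>The region is the parallelogram spanned by \<open>\<rho>\<close> and \<open>\<sigma>\<close>, reflected and thickened by a fixed
  radius: it contains every segment joining \<open>x\<close> to a point of a bond \<open>(\<xi>, \<xi> + \<sigma>)\<close> whose site \<open>\<xi>\<close>
  interacts with \<open>x\<close> through the weight of the bond \<open>\<rho>\<close>. The two vectors enter symmetrically.\<close>
definition region :: "real \<Rightarrow> 'a::euclidean_space \<Rightarrow> 'a \<Rightarrow> 'a set" where
  "region r \<rho> \<sigma> = {a *\<^sub>R \<rho> + b *\<^sub>R \<sigma> + z | a b z. \<bar>a\<bar> \<le> 1 \<and> \<bar>b\<bar> \<le> 1 \<and> norm z \<le> r}"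

lemma regionI: "\<bar>a\<bar> \<le> 1 \<Longrightarrow> \<bar>b\<bar> \<le> 1 \<Longrightarrow> norm z \<le> r \<Longrightarrow> a *\<^sub>R \<rho> + b *\<^sub>R \<sigma> + z \<in> region r \<rho> \<sigma>"
  unfolding region_def by blast

lemma region_commute: "region r \<rho> \<sigma> = region r \<sigma> \<rho>"
proof -
  have "region r \<rho> \<sigma> \<subseteq> region r \<sigma> \<rho>" for \<rho> \<sigma> :: 'a
  proof
    fix p assume "p \<in> region r \<rho> \<sigma>"
    then obtain a b z where p: "p = a *\<^sub>R \<rho> + b *\<^sub>R \<sigma> + z" "\<bar>a\<bar> \<le> 1" "\<bar>b\<bar> \<le> 1" "norm z \<le> r"
      unfolding region_def by blast
    then have "p = b *\<^sub>R \<sigma> + a *\<^sub>R \<rho> + z" by simp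
    then show "p \<in> region r \<sigma> \<rho>" using p regionI by metis
  qed
  then show ?thesis by blast
qed

lemma region_uminus_left: "region r (- \<rho>) \<sigma> = region r \<rho> \<sigma>"
proof -
  have "region r (- \<rho>) \<sigma> \<subseteq> region r \<rho> \<sigma>" for \<rho> :: 'a
  proof
    fix p assume "p \<in> region r (- \<rho>) \<sigma>"
    then obtain a b z where p: "p = a *\<^sub>R (- \<rho>) + b *\<^sub>R \<sigma> + z" "\<bar>a\<bar> \<le> 1" "\<bar>b\<bar> \<le> 1" "norm z \<le> r"
      unfolding region_def by blast
    then have "p = (- a) *\<^sub>R \<rho> + b *\<^sub>R \<sigma> + z" by simp
    then show "p \<in> region r \<rho> \<sigma>" using p regionI[of "- a"] by simp
  qed
  from this[of \<rho>] this[of "- \<rho>"] show ?thesis by simp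
qed

lemma region_uminus_right: "region r \<rho> (- \<sigma>) = region r \<rho> \<sigma>"
  by (metis region_commute region_uminus_left)

lemma uminus_region: "uminus ` region r \<rho> \<sigma> = region r \<rho> \<sigma>"
proof -
  have *: "- p \<in> region r \<rho> \<sigma>" if "p \<in> region r \<rho> \<sigma>" for p
  proof -
    obtain a b z where p: "p = a *\<^sub>R \<rho> + b *\<^sub>R \<sigma> + z" "\<bar>a\<bar> \<le> 1" "\<bar>b\<bar> \<le> 1" "norm z \<le> r"
      using \<open>p \<in> region r \<rho> \<sigma>\<close> unfolding region_def by blast
    then have "- p = (- a) *\<^sub>R \<rho> + (- b) *\<^sub>R \<sigma> + (- z)" by simp
    then show ?thesis using p regionI[of "- a" "- b" "- z"] by simp
  qed
  then show ?thesis by (auto intro: image_eqI[where x = "- p" for p])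
qed

lemma compact_region: "compact (region r \<rho> \<sigma>)"
proof -
  have eq: "region r \<rho> \<sigma> = (\<lambda>(a, b, z). a *\<^sub>R \<rho> + b *\<^sub>R \<sigma> + z) ` (cball 0 1 \<times> cball 0 1 \<times> cball 0 r)"
    unfolding region_def by (force simp: image_iff)
  show ?thesis unfolding eq
    by (intro compact_continuous_image compact_Times compact_cball)
      (auto simp: case_prod_unfold intro!: continuous_intros)
qed

lemma region_norm_le: "p \<in> region r \<rho> \<sigma> \<Longrightarrow> norm p \<le> norm \<rho> + norm \<sigma> + r"
proof -
  assume "p \<in> region r \<rho> \<sigma>"
  then obtain a b z where p: "p = a *\<^sub>R \<rho> + b *\<^sub>R \<sigma> + z" "\<bar>a\<bar> \<le> 1" "\<bar>b\<bar> \<le> 1" "norm z \<le> r"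
    unfolding region_def by blast
  have "norm p \<le> \<bar>a\<bar> * norm \<rho> + \<bar>b\<bar> * norm \<sigma> + norm z"
    unfolding p(1) by (metis norm_triangle_mono norm_scaleR norm_triangle_ineq order_refl)
  also have "\<dots> \<le> 1 * norm \<rho> + 1 * norm \<sigma> + r"
    using p by (intro add_mono mult_right_mono) auto
  finally show ?thesis by simp
qed

lemma grid_point:
  fixes s :: real and m N :: nat
  assumes "N > 0" "\<bar>s\<bar> \<le> real m"
  obtains i :: int where "\<bar>i\<bar> \<le> int (m * N)" "\<bar>s - i / N\<bar> \<le> 1 / N"
proof
  let ?i = "\<lfloor>s * N\<rfloor>"
  have b: "\<bar>s * N\<bar> \<le> real (m * N)"
    using mult_right_mono[OF assms(2), of "real N"] by (simp add: abs_mult)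
  have "- int (m * N) \<le> ?i" using b by (subst le_floor_iff) (simp add: abs_le_iff)
  moreover have "real_of_int ?i \<le> real_of_int (int (m * N))" using b by (simp add: abs_le_iff) linarith
  then have "?i \<le> int (m * N)" by (simp only: of_int_le_iff)
  ultimately show "\<bar>?i\<bar> \<le> int (m * N)" by (simp add: abs_le_iff)
  have "\<bar>s * N - ?i\<bar> \<le> 1" by linarith
  then have "\<bar>(s * N - ?i) / N\<bar> \<le> 1 / N" using assms(1) by (simp add: divide_right_mono)
  then show "\<bar>s - ?i / N\<bar> \<le> 1 / N" using assms(1) by (simp add: diff_divide_distrib)
qed

text \<open>Splitting \<open>\<sigma>\<close> into its component along the longer vector \<open>\<rho>\<close> and an orthogonal remainder
  \<open>\<tau>\<close>, the region lies in a thickened rectangle with sides \<open>4 |\<rho>|\<close> and \<open>2 |\<tau>|\<close>, and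
  \<open>|\<rho>| |\<tau>|\<close> is the area of the parallelogram. Balls of fixed radius centred on a unit grid of
  that rectangle cover the region; their number is at most a multiple of \<open>|\<rho>| (|\<tau>| + 1)\<close>.\<close>
lemma region_volume_ordered:
  fixes \<rho> \<sigma> :: "real ^ 'n"
  assumes \<rho>: "norm \<rho> \<ge> 1" and le: "norm \<sigma> \<le> norm \<rho>" and r: "r \<ge> 0"
  shows "measure lborel (region r \<rho> \<sigma>)
    \<le> 45 * measure lborel (cball (0 :: real ^ 'n) (r + 2)) * (parallelogram_area \<rho> \<sigma> + norm \<rho>)"
proof -
  define \<mu> where "\<mu> = (\<sigma> \<bullet> \<rho>) / (norm \<rho>)\<^sup>2"
  define \<tau> where "\<tau> = \<sigma> - \<mu> *\<^sub>R \<rho>"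
  have \<rho>0: "norm \<rho> > 0" using \<rho> by linarith
  have \<mu>: "\<bar>\<mu>\<bar> \<le> 1"
  proof -
    have "\<bar>\<sigma> \<bullet> \<rho>\<bar> \<le> norm \<sigma> * norm \<rho>" by (rule Cauchy_Schwarz_ineq2)
    also have "\<dots> \<le> (norm \<rho>)\<^sup>2" using le by (simp add: power2_eq_square mult_right_mono)
    finally show ?thesis using \<rho>0 by (simp add: \<mu>_def abs_divide)
  qed
  have "(norm \<tau>)\<^sup>2 = (norm \<sigma>)\<^sup>2 - (\<sigma> \<bullet> \<rho>)\<^sup>2 / (norm \<rho>)\<^sup>2"
    unfolding \<tau>_def power2_norm_eq_inner \<mu>_def using \<rho>0
    by (simp add: inner_diff_left inner_diff_right power2_norm_eq_inner inner_commute field_simps power2_eq_square)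
  then have "(norm \<rho> * norm \<tau>)\<^sup>2 = (norm \<rho>)\<^sup>2 * (norm \<sigma>)\<^sup>2 - (\<rho> \<bullet> \<sigma>)\<^sup>2"
    using \<rho>0 by (simp add: power_mult_distrib field_simps inner_commute)
  then have area: "parallelogram_area \<rho> \<sigma> = norm \<rho> * norm \<tau>"
    unfolding parallelogram_area_def by (metis norm_ge_zero real_sqrt_unique mult_nonneg_nonneg)
  define N where "N = nat \<lceil>norm \<rho>\<rceil>"
  define M where "M = nat \<lceil>norm \<tau>\<rceil> + 1"
  have N: "N > 0" "norm \<rho> \<le> N" "real N \<le> 2 * norm \<rho>" using \<rho> unfolding N_def by linarith+
  have M: "M > 0" "norm \<tau> \<le> M" "real M \<le> norm \<tau> + 2" unfolding M_def using norm_ge_zero[of \<tau>] by linarith+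
  define J :: "(int \<times> int) set" where "J = {- int (2 * N)..int (2 * N)} \<times> {- int (1 * M)..int (1 * M)}"
  define c where "c = (\<lambda>(i :: int, j :: int). (i / N) *\<^sub>R \<rho> + (j / M) *\<^sub>R \<tau>)"
  have cover: "region r \<rho> \<sigma> \<subseteq> (\<Union>p\<in>J. cball (c p) (r + 2))"
  proof
    fix p assume "p \<in> region r \<rho> \<sigma>"
    then obtain a b z where p: "p = a *\<^sub>R \<rho> + b *\<^sub>R \<sigma> + z" "\<bar>a\<bar> \<le> 1" "\<bar>b\<bar> \<le> 1" "norm z \<le> r"
      unfolding region_def by blast
    have "\<bar>b * \<mu>\<bar> \<le> 1 * 1" unfolding abs_mult using p \<mu> by (intro mult_mono) auto
    then have s: "\<bar>a + b * \<mu>\<bar> \<le> real 2" using p(2) by linarith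
    obtain i where i: "\<bar>i\<bar> \<le> int (2 * N)" "\<bar>(a + b * \<mu>) - i / N\<bar> \<le> 1 / N" using grid_point[OF N(1) s] .
    have t: "\<bar>b\<bar> \<le> real 1" using p by simp
    obtain j where j: "\<bar>j\<bar> \<le> int (1 * M)" "\<bar>b - j / M\<bar> \<le> 1 / M" using grid_point[OF M(1) t] .
    have eq: "p - c (i, j) = ((a + b * \<mu>) - i / N) *\<^sub>R \<rho> + (b - j / M) *\<^sub>R \<tau> + z"
      unfolding p(1) c_def \<tau>_def by (simp add: algebra_simps)
    have n1: "norm (((a + b * \<mu>) - i / N) *\<^sub>R \<rho>) \<le> 1"
      using mult_mono[OF i(2) N(2)] N(1) by simp
    have n2: "norm ((b - j / M) *\<^sub>R \<tau>) \<le> 1"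
      using mult_mono[OF j(2) M(2)] M(1) by simp
    have "norm (p - c (i, j)) \<le> r + 2"
      unfolding eq using n1 n2 p(4) norm_triangle_ineq[of "((a + b * \<mu>) - i / N) *\<^sub>R \<rho> + (b - j / M) *\<^sub>R \<tau>" z]
        norm_triangle_ineq[of "((a + b * \<mu>) - i / N) *\<^sub>R \<rho>" "(b - j / M) *\<^sub>R \<tau>"] by linarith
    moreover have "(i, j) \<in> J" using i(1) j(1) unfolding J_def by auto
    ultimately show "p \<in> (\<Union>p\<in>J. cball (c p) (r + 2))"
      by (intro UN_I[of "(i, j)"]) (auto simp: dist_norm norm_minus_commute)
  qed
  let ?v = "measure lborel (cball (0 :: real ^ 'n) (r + 2))"
  have finJ: "finite J" unfolding J_def by simp
  have cb: "measure lborel (cball (c p) (r + 2)) = ?v" for p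
    using r by (simp add: content_cball)
  have "measure lborel (region r \<rho> \<sigma>) \<le> measure lborel (\<Union>p\<in>J. cball (c p) (r + 2))"
    using cover finJ
    by (intro measure_mono_fmeasurable fmeasurable.finite_UN fmeasurable_compact)
      (auto intro!: borel_compact compact_region fmeasurable_compact)
  also have "\<dots> \<le> (\<Sum>p\<in>J. measure lborel (cball (c p) (r + 2)))"
    using finJ by (intro measure_UNION_le) auto
  also have "\<dots> = real (card J) * ?v" by (simp add: cb)
  also have "card J = (4 * N + 1) * (2 * M + 1)" unfolding J_def by (simp add: card_cartesian_product nat_add_distrib nat_mult_distrib)
  also have "real ((4 * N + 1) * (2 * M + 1)) \<le> (9 * norm \<rho>) * (5 * (norm \<tau> + 1))"
    unfolding of_nat_mult
  proof (intro mult_mono)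
    show "real (4 * N + 1) \<le> 9 * norm \<rho>" using N(3) \<rho> by simp
    show "real (2 * M + 1) \<le> 5 * (norm \<tau> + 1)" using M(3) norm_ge_zero[of \<tau>] by (simp del: norm_ge_zero)
  qed (use \<rho>0 in auto)
  finally have "measure lborel (region r \<rho> \<sigma>) \<le> (9 * norm \<rho>) * (5 * (norm \<tau> + 1)) * ?v"
    by (simp add: mult_right_mono)
  also have "\<dots> = 45 * ?v * (parallelogram_area \<rho> \<sigma> + norm \<rho>)" unfolding area by (simp add: algebra_simps)
  finally show ?thesis .
qed

lemma region_volume:
  fixes \<rho> \<sigma> :: "real ^ 'n"
  assumes \<rho>: "norm \<rho> \<ge> 1" and \<sigma>: "norm \<sigma> \<ge> 1" and r: "r \<ge> 0"
  shows "emeasure lborel (region r \<rho> \<sigma>) \<le> ennreal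
    (45 * measure lborel (cball (0 :: real ^ 'n) (r + 2)) * (parallelogram_area \<rho> \<sigma> + norm \<rho> + norm \<sigma>))"
proof -
  have fin: "emeasure lborel (region r \<rho> \<sigma>) = ennreal (measure lborel (region r \<rho> \<sigma>))"
    using emeasure_compact_finite[OF compact_region[of r \<rho> \<sigma>]] by (intro emeasure_eq_ennreal_measure) auto
  let ?c = "45 * measure lborel (cball (0 :: real ^ 'n) (r + 2))"
  have c: "?c \<ge> 0" by simp
  have "measure lborel (region r \<rho> \<sigma>) \<le> ?c * (parallelogram_area \<rho> \<sigma> + norm \<rho> + norm \<sigma>)"
  proof (cases "norm \<sigma> \<le> norm \<rho>")
    case True
    have "?c * (parallelogram_area \<rho> \<sigma> + norm \<rho>) \<le> ?c * (parallelogram_area \<rho> \<sigma> + norm \<rho> + norm \<sigma>)"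
      using c by (intro mult_left_mono) auto
    then show ?thesis using region_volume_ordered[OF \<rho> True r] by linarith
  next
    case False
    then have "norm \<rho> \<le> norm \<sigma>" by simp
    note b = region_volume_ordered[OF \<sigma> this r]
    have sym: "parallelogram_area \<sigma> \<rho> = parallelogram_area \<rho> \<sigma>"
      unfolding parallelogram_area_def by (simp add: inner_commute mult.commute)
    have "?c * (parallelogram_area \<rho> \<sigma> + norm \<sigma>) \<le> ?c * (parallelogram_area \<rho> \<sigma> + norm \<rho> + norm \<sigma>)"
      using c by (intro mult_left_mono) auto
    then show ?thesis using b unfolding sym region_commute[of r \<sigma> \<rho>] by linarith
  qed
  then show ?thesis unfolding fin by (rule ennreal_leI)
qed

section \<open>Iterated derivatives on a closed ball\<close>

lemma has_vector_derivative_along_segment: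
  fixes f :: "'a::real_normed_vector \<Rightarrow> 'b::real_normed_vector"
  assumes f: "(f has_derivative D) (at (x + t *\<^sub>R v) within S)"
    and S: "\<And>s. s \<in> {0..1} \<Longrightarrow> x + s *\<^sub>R v \<in> S"
  shows "((\<lambda>s. f (x + s *\<^sub>R v)) has_vector_derivative D v) (at t within {0..1})"
proof -
  have 1: "((\<lambda>s. x + s *\<^sub>R v) has_derivative (\<lambda>h. h *\<^sub>R v)) (at t within {0..1})"
    by (auto intro!: derivative_eq_intros)
  have "(f has_derivative D) (at (x + t *\<^sub>R v) within (\<lambda>s. x + s *\<^sub>R v) ` {0..1})"
    using f by (rule has_derivative_subset) (use S in auto)
  from diff_chain_within[OF 1 this]
  have 2: "((\<lambda>s. f (x + s *\<^sub>R v)) has_derivative (\<lambda>h. D (h *\<^sub>R v))) (at t within {0..1})"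
    by (simp add: o_def)
  have "D (h *\<^sub>R v) = h *\<^sub>R D v" for h
    using f by (meson has_derivative_linear linear_cmul)
  then show ?thesis using 2 by (simp add: has_vector_derivative_def)
qed

text \<open>At a boundary point of a convex body the derivative is determined along the segments into the
  body, and the directions of these segments span the space because the body has an interior point.\<close>
lemma has_derivative_unique_convex:
  fixes f :: "'a::real_normed_vector \<Rightarrow> 'b::real_normed_vector"
  assumes S: "convex S" "interior S \<noteq> {}" "x \<in> S"
    and D: "(f has_derivative D) (at x within S)" and D': "(f has_derivative D') (at x within S)"
  shows "D = D'"
proof
  fix v :: 'a
  have seg: "D (y - x) = D' (y - x)" if "y \<in> S" for y
  proof -
    have in_S: "x + s *\<^sub>R (y - x) \<in> S" if "s \<in> {0..1}" for s
      using convexD_alt[OF S(1) \<open>x \<in> S\<close> \<open>y \<in> S\<close>, of s] that by (simp add: algebra_simps)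
    have "((\<lambda>s. f (x + s *\<^sub>R (y - x))) has_vector_derivative D (y - x)) (at 0 within {0..1})"
      "((\<lambda>s. f (x + s *\<^sub>R (y - x))) has_vector_derivative D' (y - x)) (at 0 within {0..1})"
      using D D' in_S by (auto intro!: has_vector_derivative_along_segment)
    then show ?thesis
      by (rule vector_derivative_unique_within[rotated]) (simp add: at_within_Icc_at_right)
  qed
  obtain y e where e: "e > 0" "ball y e \<subseteq> S"
    using S(2) by (meson ex_in_conv mem_interior)
  define c where "c = e / (2 * (norm v + 1))"
  have c: "c > 0" "norm (c *\<^sub>R v) < e"
  proof -
    show "c > 0" using e unfolding c_def by (auto intro!: divide_pos_pos add_nonneg_pos)
    have "norm v / (2 * (norm v + 1)) < 1" by (simp add: divide_less_eq add_nonneg_pos)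
    then have "e * (norm v / (2 * (norm v + 1))) < e * 1" using e(1) by (intro mult_strict_left_mono)
    then show "norm (c *\<^sub>R v) < e" using \<open>c > 0\<close> e(1) by (simp add: c_def)
  qed
  have lin: "linear D" "linear D'" using D D' has_derivative_linear by blast+
  have "y + c *\<^sub>R v \<in> S" "y \<in> S" using e c by (auto simp: subset_iff dist_norm)
  then have "D (y + c *\<^sub>R v - x) - D (y - x) = D' (y + c *\<^sub>R v - x) - D' (y - x)"
    using seg by simp
  then have "D (c *\<^sub>R v) = D' (c *\<^sub>R v)" using lin by (simp flip: linear_diff)
  then show "D v = D' v" using lin c(1) by (simp add: linear_cmul)
qed

lemma frechet_derivative_eqI:
  assumes "convex S" "interior S \<noteq> {}" "x \<in> S" "(f has_derivative D) (at x within S)"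
  shows "frechet_derivative f (at x within S) = D"
  using assms by (metis has_derivative_unique_convex differentiableI frechet_derivative_works)

declare iter_deriv.simps(2) [simp del]

locale smooth_on_ball =
  fixes k :: nat and r :: real and f :: "'a::real_normed_vector \<Rightarrow> real"
  assumes r_pos: "r > 0" and smooth: "Ck_on k (cball 0 r) f"
begin

abbreviation "S \<equiv> cball (0 :: 'a) r"
abbreviation "D \<equiv> iter_deriv S f"

lemma ball_body: "convex S" "interior S \<noteq> {}"
proof -
  have "ball 0 r \<subseteq> interior S" by (rule interior_maximal) auto
  then show "interior S \<noteq> {}" using r_pos by fastforce
qed simp

lemma segment_in_ball:
  assumes "g \<in> S" "g + w \<in> S" "t \<in> {0..1}"
  shows "g + t *\<^sub>R w \<in> S"
  using convexD_alt[OF ball_body(1) assms(1,2), of t] assms(3) by (simp add: algebra_simps)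

lemma has_deriv:
  assumes "length hs < k" "g \<in> S"
  shows "(D hs has_derivative (\<lambda>h. D (h # hs) g)) (at g within S)"
proof -
  have "D hs differentiable (at g within S)" using smooth assms unfolding Ck_on_def by blast
  then show ?thesis by (simp add: frechet_derivative_works iter_deriv.simps(2) cong: if_cong)
qed

lemma linear_deriv: "length hs < k \<Longrightarrow> g \<in> S \<Longrightarrow> linear (\<lambda>h. D (h # hs) g)"
  using has_deriv has_derivative_linear by blast

lemma deriv_scale:
  assumes "length cs = length hs" "length hs \<le> k" "g \<in> S"
  shows "D (map2 (*\<^sub>R) cs hs) g = prod_list cs * D hs g"
  using assms
proof (induction cs hs arbitrary: g rule: list_induct2)
  case (Cons c cs h hs)
  let ?hs = "map2 (*\<^sub>R) cs hs"
  have len: "length ?hs < k" "length hs < k" using Cons.hyps Cons.prems by simp_all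
  have IH: "D ?hs g = prod_list cs * D hs g" if "g \<in> S" for g using Cons.IH that len by simp
  have "((\<lambda>g. prod_list cs * D hs g) has_derivative (\<lambda>h. prod_list cs * D (h # hs) g)) (at g within S)"
    using has_deriv[OF len(2) Cons.prems(2)] by (rule has_derivative_mult_right)
  then have "(D ?hs has_derivative (\<lambda>h. prod_list cs * D (h # hs) g)) (at g within S)"
    by (rule has_derivative_transform[rotated 2]) (use Cons.prems IH in auto)
  then have "(\<lambda>h. D (h # ?hs) g) = (\<lambda>h. prod_list cs * D (h # hs) g)"
    by (rule has_derivative_unique_convex[OF ball_body Cons.prems(2) has_deriv[OF len(1) Cons.prems(2)]])
  then have "D ((c *\<^sub>R h) # ?hs) g = prod_list cs * D ((c *\<^sub>R h) # hs) g" by metis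
  also have "D ((c *\<^sub>R h) # hs) g = c * D (h # hs) g"
    using linear_cmul[OF linear_deriv[OF len(2) Cons.prems(2)]] by simp
  finally show ?case by simp
qed simp

lemma deriv_symmetry:
  assumes L: "bounded_linear L" "L ` S \<subseteq> S" and inv: "\<And>g. g \<in> S \<Longrightarrow> f (L g) = f g"
    and "length hs \<le> k" "g \<in> S"
  shows "D (map L hs) (L g) = D hs g"
  using assms(4,5)
proof (induction hs arbitrary: g)
  case Nil
  then show ?case using inv by simp
next
  case (Cons h hs)
  let ?hs = "map L hs"
  have len: "length ?hs < k" "length hs < k" using Cons.prems by simp_all
  have Lg: "L g \<in> S" using L(2) Cons.prems(2) by blast
  have IH: "D ?hs (L g) = D hs g" if "g \<in> S" for g using Cons.IH that len by simp
  have 1: "(L has_derivative L) (at g within S)" using L(1) by (rule bounded_linear_imp_has_derivative)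
  have "(D ?hs has_derivative (\<lambda>h. D (h # ?hs) (L g))) (at (L g) within L ` S)"
    using has_deriv[OF len(1) Lg] by (rule has_derivative_subset) (rule L(2))
  from diff_chain_within[OF 1 this]
  have "((\<lambda>g. D ?hs (L g)) has_derivative (\<lambda>h. D (L h # ?hs) (L g))) (at g within S)"
    by (simp only: o_def)
  then have "(D hs has_derivative (\<lambda>h. D (L h # ?hs) (L g))) (at g within S)"
    by (rule has_derivative_transform[rotated 2]) (use Cons.prems IH in auto)
  then have "(\<lambda>h. D (h # hs) g) = (\<lambda>h. D (L h # ?hs) (L g))"
    by (rule has_derivative_unique_convex[OF ball_body Cons.prems(2) has_deriv[OF len(2) Cons.prems(2)]])
  then show ?case by (metis list.simps(9))
qed

lemma continuous_deriv:
  assumes "length hs \<le> k"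
  shows "continuous_on S (D hs)"
proof (cases "length hs < k")
  case True
  then show ?thesis using has_deriv by (intro has_derivative_continuous_on) blast
next
  case False
  then have k: "length hs = k" using assms by simp
  \<comment> \<open>Continuity of the top derivative is required only on the unit ball of directions.\<close>
  define c where "c = 1 + (\<Sum>h\<leftarrow>hs. norm h)"
  have "(\<Sum>h\<leftarrow>hs. norm h) \<ge> 0" by (rule sum_list_nonneg) auto
  then have c0: "c > 0" by (simp add: c_def)
  have c: "norm h \<le> c" if "h \<in> set hs" for h
  proof -
    have "norm h \<le> (\<Sum>h\<leftarrow>hs. norm h)" using that by (intro member_le_sum_list) auto
    then show ?thesis by (simp add: c_def)
  qed
  define us where "us = map (\<lambda>h. h /\<^sub>R c) hs"
  have us: "length us = k" "unit_bounded us"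
    using k c c0 by (auto simp: us_def unit_bounded_def field_simps)
  have "map2 (*\<^sub>R) (replicate (length us) c) us = hs"
    by (rule nth_equalityI) (use c0 in \<open>auto simp: us_def\<close>)
  then have eq: "D hs g = prod_list (replicate (length us) c) * D us g" if "g \<in> S" for g
    using deriv_scale[of "replicate (length us) c" us g] us that by simp
  have "continuous_on S (D us)"
    unfolding continuous_on_iff
  proof (intro ballI allI impI)
    fix g and e :: real assume "g \<in> S" "e > 0"
    have "\<forall>g\<in>S. \<forall>e>0. \<exists>d>0. \<forall>g'\<in>S. dist g' g < d \<longrightarrow>
        (\<forall>hs. length hs = k \<and> unit_bounded hs \<longrightarrow> \<bar>D hs g' - D hs g\<bar> \<le> e)"
      using smooth unfolding Ck_on_def by (rule conjunct2)
    from this[THEN bspec, OF \<open>g \<in> S\<close>, THEN spec, THEN mp, OF half_gt_zero[OF \<open>e > 0\<close>]]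
    obtain d where "d > 0" and d: "\<forall>g'\<in>S. dist g' g < d \<longrightarrow>
        (\<forall>hs. length hs = k \<and> unit_bounded hs \<longrightarrow> \<bar>D hs g' - D hs g\<bar> \<le> e / 2)"
      by blast
    show "\<exists>d>0. \<forall>g'\<in>S. dist g' g < d \<longrightarrow> dist (D us g') (D us g) < e"
    proof (intro exI[of _ d] conjI ballI impI \<open>d > 0\<close>)
      fix g' assume "g' \<in> S" "dist g' g < d"
      then have "\<bar>D us g' - D us g\<bar> \<le> e / 2" using d us by blast
      then show "dist (D us g') (D us g) < e" using \<open>e > 0\<close> by (simp add: dist_real_def)
    qed
  qed
  then have "continuous_on S (\<lambda>g. prod_list (replicate (length us) c) * D us g)"
    by (rule continuous_on_mult_left)
  then show ?thesis by (rule continuous_on_eq) (metis eq)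
qed

lemma deriv_mvt:
  assumes "length hs < k" "g \<in> S" "g + w \<in> S"
  obtains t where "t \<in> {0..1}" "g + t *\<^sub>R w \<in> S" "D hs (g + w) - D hs g = D (w # hs) (g + t *\<^sub>R w)"
proof -
  have "\<exists>t\<in>{0..1}. D hs (g + 1 *\<^sub>R w) - D hs (g + 0 *\<^sub>R w) = (1 - 0) *\<^sub>R D (w # hs) (g + t *\<^sub>R w)"
  proof (rule mvt_very_simple[where f' = "\<lambda>t h. h *\<^sub>R D (w # hs) (g + t *\<^sub>R w)"])
    fix t :: real assume "0 \<le> t" "t \<le> 1"
    then show "((\<lambda>t. D hs (g + t *\<^sub>R w)) has_derivative (\<lambda>h. h *\<^sub>R D (w # hs) (g + t *\<^sub>R w))) (at t within {0..1})"
      unfolding has_vector_derivative_def[symmetric]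
      using assms segment_in_ball[OF assms(2,3)]
      by (intro has_vector_derivative_along_segment[where D = "\<lambda>h. D (h # hs) (g + t *\<^sub>R w)" and S = S] has_deriv) auto
  qed simp
  then show thesis using that segment_in_ball[OF assms(2,3)] by auto
qed

lemma double_difference:
  assumes len: "length hs + 2 \<le> k"
    and in_S: "\<And>s t. s \<in> {0..1} \<Longrightarrow> t \<in> {0..1} \<Longrightarrow> g + s *\<^sub>R a + t *\<^sub>R b \<in> S"
  obtains s t where "s \<in> {0..1}" "t \<in> {0..1}"
    "D hs (g + a + b) - D hs (g + a) - D hs (g + b) + D hs g = D (b # a # hs) (g + s *\<^sub>R a + t *\<^sub>R b)"
proof -
  have len': "length hs < k" "length (a # hs) < k" using len by auto
  have 1: "g + s *\<^sub>R a \<in> S" "g + b + s *\<^sub>R a \<in> S" if "s \<in> {0..1}" for s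
    using in_S[of s 0] in_S[of s 1] that by (auto simp: algebra_simps)
  have "\<exists>s\<in>{0..1}. (D hs (g + b + 1 *\<^sub>R a) - D hs (g + 1 *\<^sub>R a)) - (D hs (g + b + 0 *\<^sub>R a) - D hs (g + 0 *\<^sub>R a))
     = (1 - 0) *\<^sub>R (D (a # hs) (g + b + s *\<^sub>R a) - D (a # hs) (g + s *\<^sub>R a))"
  proof (rule mvt_very_simple[where f' = "\<lambda>s h. h *\<^sub>R (D (a # hs) (g + b + s *\<^sub>R a) - D (a # hs) (g + s *\<^sub>R a))"])
    fix s :: real assume "0 \<le> s" "s \<le> 1"
    then show "((\<lambda>s. D hs (g + b + s *\<^sub>R a) - D hs (g + s *\<^sub>R a)) has_derivative
        (\<lambda>h. h *\<^sub>R (D (a # hs) (g + b + s *\<^sub>R a) - D (a # hs) (g + s *\<^sub>R a)))) (at s within {0..1})"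
      unfolding has_vector_derivative_def[symmetric] using len' 1
      by (intro has_vector_derivative_diff
          has_vector_derivative_along_segment[where D = "\<lambda>h. D (h # hs) (g + b + s *\<^sub>R a)" and S = S]
          has_vector_derivative_along_segment[where D = "\<lambda>h. D (h # hs) (g + s *\<^sub>R a)" and S = S] has_deriv) auto
  qed simp
  then obtain s where s: "s \<in> {0..1}"
    "D hs (g + b + a) - D hs (g + a) - (D hs (g + b) - D hs g)
      = D (a # hs) (g + s *\<^sub>R a + b) - D (a # hs) (g + s *\<^sub>R a)"
    by (auto simp: algebra_simps)
  have "g + s *\<^sub>R a \<in> S" "g + s *\<^sub>R a + b \<in> S" using in_S[of s 0] in_S[of s 1] s by auto
  then obtain t where "t \<in> {0..1}"
    "D (a # hs) (g + s *\<^sub>R a + b) - D (a # hs) (g + s *\<^sub>R a) = D (b # a # hs) (g + s *\<^sub>R a + t *\<^sub>R b)"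
    using deriv_mvt[OF len'(2)] by blast
  then show thesis using s that by (simp add: algebra_simps)
qed

text \<open>The double difference over a small parallelogram does not depend on the order of the two sides,
  so the mixed derivatives agree at an interior point; by continuity they agree up to the boundary.\<close>
lemma deriv_swap:
  assumes len: "length hs + 2 \<le> k" and "g \<in> S"
  shows "D (a # b # hs) g = D (b # a # hs) g"
proof -
  have cont: "continuous_on S (D (a # b # hs))" "continuous_on S (D (b # a # hs))"
    using len by (auto intro!: continuous_deriv)
  have interior: "D (a # b # hs) g - D (b # a # hs) g = 0" if "g \<in> ball 0 r" for g
  proof (rule ccontr)
    assume "D (a # b # hs) g - D (b # a # hs) g \<noteq> 0"
    then have pos: "\<bar>D (a # b # hs) g - D (b # a # hs) g\<bar> / 2 > 0" (is "?e > 0") by simp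
    have gS: "g \<in> S" using that by auto
    obtain d1 where d1: "d1 > 0" "\<And>p. p \<in> S \<Longrightarrow> dist p g < d1 \<Longrightarrow> \<bar>D (a # b # hs) p - D (a # b # hs) g\<bar> < ?e"
      using cont(1)[unfolded continuous_on_iff dist_real_def, THEN bspec, OF gS, THEN spec, THEN mp, OF pos]
      by blast
    obtain d2 where d2: "d2 > 0" "\<And>p. p \<in> S \<Longrightarrow> dist p g < d2 \<Longrightarrow> \<bar>D (b # a # hs) p - D (b # a # hs) g\<bar> < ?e"
      using cont(2)[unfolded continuous_on_iff dist_real_def, THEN bspec, OF gS, THEN spec, THEN mp, OF pos]
      by blast
    define d where "d = min (min d1 d2) (r - norm g)"
    have d: "d > 0" "d \<le> d1" "d \<le> d2" "d \<le> r - norm g" using d1 d2 that unfolding d_def by auto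
    define c where "c = d / (norm a + norm b + 1)"
    have nn: "norm a + norm b + 1 > 0" by (simp add: add_nonneg_pos)
    have c: "c > 0" using d nn unfolding c_def by simp
    have small: "norm (s *\<^sub>R (c *\<^sub>R a) + t *\<^sub>R (c *\<^sub>R b)) < d" if "s \<in> {0..1}" "t \<in> {0..1}" for s t
    proof -
      have "norm (s *\<^sub>R (c *\<^sub>R a) + t *\<^sub>R (c *\<^sub>R b)) \<le> s * (c * norm a) + t * (c * norm b)"
        using that c norm_triangle_ineq[of "s *\<^sub>R (c *\<^sub>R a)" "t *\<^sub>R (c *\<^sub>R b)"] by simp
      also have "\<dots> \<le> 1 * (c * norm a) + 1 * (c * norm b)"
        using that c by (intro add_mono mult_right_mono) auto
      also have "\<dots> = c * (norm a + norm b)" by (simp add: algebra_simps)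
      also have "\<dots> < c * (norm a + norm b + 1)" using c by simp
      also have "\<dots> = d" using nn unfolding c_def by simp
      finally show ?thesis .
    qed
    have near: "g + s *\<^sub>R (c *\<^sub>R a) + t *\<^sub>R (c *\<^sub>R b) \<in> S" "dist (g + s *\<^sub>R (c *\<^sub>R a) + t *\<^sub>R (c *\<^sub>R b)) g < d"
      if "s \<in> {0..1}" "t \<in> {0..1}" for s t
      using small[OF that] d(4) norm_triangle_ineq[of g "s *\<^sub>R (c *\<^sub>R a) + t *\<^sub>R (c *\<^sub>R b)"]
      by (simp_all add: add.assoc) (simp add: dist_norm)
    have near': "g + s *\<^sub>R (c *\<^sub>R b) + t *\<^sub>R (c *\<^sub>R a) \<in> S" if "s \<in> {0..1}" "t \<in> {0..1}" for s t
      using near(1)[of t s] that by (simp add: algebra_simps)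
    obtain s t where st: "s \<in> {0..1}" "t \<in> {0..1}"
      "D hs (g + c *\<^sub>R a + c *\<^sub>R b) - D hs (g + c *\<^sub>R a) - D hs (g + c *\<^sub>R b) + D hs g
        = D (c *\<^sub>R b # c *\<^sub>R a # hs) (g + s *\<^sub>R (c *\<^sub>R a) + t *\<^sub>R (c *\<^sub>R b))" (is "_ = D _ ?p")
      using double_difference[OF len near(1)] by blast
    obtain s' t' where st': "s' \<in> {0..1}" "t' \<in> {0..1}"
      "D hs (g + c *\<^sub>R b + c *\<^sub>R a) - D hs (g + c *\<^sub>R b) - D hs (g + c *\<^sub>R a) + D hs g
        = D (c *\<^sub>R a # c *\<^sub>R b # hs) (g + s' *\<^sub>R (c *\<^sub>R b) + t' *\<^sub>R (c *\<^sub>R a))" (is "_ = D _ ?q")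
      using double_difference[OF len near'] by blast
    have p: "?p \<in> S" "dist ?p g < d" using near st by auto
    have q: "?q \<in> S" "dist ?q g < d" using near(1)[of t' s'] near(2)[of t' s'] st' by (auto simp: algebra_simps)
    have sc: "D (c *\<^sub>R u # c *\<^sub>R v # hs) p = c * c * D (u # v # hs) p" if "p \<in> S" for u v p
    proof -
      have "map2 (*\<^sub>R) (c # c # replicate (length hs) 1) (u # v # hs) = c *\<^sub>R u # c *\<^sub>R v # hs"
        by (simp, rule nth_equalityI) auto
      then show ?thesis
        using deriv_scale[of "c # c # replicate (length hs) 1" "u # v # hs" p] len that
        by simp
    qed
    have "D (c *\<^sub>R b # c *\<^sub>R a # hs) ?p = D (c *\<^sub>R a # c *\<^sub>R b # hs) ?q"
      using st(3) st'(3) by (simp add: algebra_simps)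
    then have "D (b # a # hs) ?p = D (a # b # hs) ?q" using sc p q c by simp
    moreover have "\<bar>D (a # b # hs) ?q - D (a # b # hs) g\<bar> < ?e" using d1 d q by force
    moreover have "\<bar>D (b # a # hs) ?p - D (b # a # hs) g\<bar> < ?e" using d2 d p by force
    ultimately show False by (simp add: abs_if split: if_splits)
  qed
  have "closure (ball 0 r) = S" using r_pos by (simp add: closure_ball)
  then have "continuous_on (closure (ball 0 r)) (\<lambda>g. D (a # b # hs) g - D (b # a # hs) g)"
    using cont by (auto intro!: continuous_intros)
  then have "D (a # b # hs) g - D (b # a # hs) g = 0"
    by (rule continuous_constant_on_closure) (use interior \<open>closure _ = S\<close> \<open>g \<in> S\<close> in auto)
  then show ?thesis by simp
qed

text \<open>The direction first differentiated can be moved to the outside, also at third order. This makes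
  the first vector of a tuple the one that belongs to the force.\<close>
lemma deriv_rotate:
  assumes "3 \<le> k" "g \<in> S"
  shows "D [a, b, s] g = D [s, a, b] g"
proof -
  have "(D [a, s] has_derivative (\<lambda>h. D [h, a, s] g)) (at g within S)" for a s
    using assms by (intro has_deriv) auto
  from this[of b s] this[of s b]
  have 1: "(D [b, s] has_derivative (\<lambda>h. D [h, b, s] g)) (at g within S)"
    "(D [s, b] has_derivative (\<lambda>h. D [h, s, b] g)) (at g within S)" by auto
  have "(D [b, s] has_derivative (\<lambda>h. D [h, s, b] g)) (at g within S)"
    using 1(2) by (rule has_derivative_transform[rotated 2]) (use assms deriv_swap[of "[]"] in auto)
  then have "(\<lambda>h. D [h, b, s] g) = (\<lambda>h. D [h, s, b] g)"
    by (rule has_derivative_unique_convex[OF ball_body assms(2) 1(1)])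
  then have "D [a, b, s] g = D [a, s, b] g" by metis
  also have "\<dots> = D [s, a, b] g" using deriv_swap[of "[b]"] assms by simp
  finally show ?thesis .
qed

lemma deriv_taylor2:
  assumes len: "length hs + 2 \<le> k" and g: "g \<in> S" "g + w \<in> S"
  obtains p where "p \<in> S" "\<bar>D hs (g + w) - D hs g - D (w # hs) g\<bar> \<le> \<bar>D (w # w # hs) p\<bar>"
proof -
  have len': "length hs < k" "length (w # hs) < k" using len by auto
  obtain t where t: "t \<in> {0..1}" "g + t *\<^sub>R w \<in> S" "D hs (g + w) - D hs g = D (w # hs) (g + t *\<^sub>R w)"
    using deriv_mvt[OF len'(1) g] by blast
  obtain t' where t': "g + t' *\<^sub>R (t *\<^sub>R w) \<in> S"
    "D (w # hs) (g + t *\<^sub>R w) - D (w # hs) g = D (t *\<^sub>R w # w # hs) (g + t' *\<^sub>R (t *\<^sub>R w))"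
    using deriv_mvt[OF len'(2) g(1) t(2)] by blast
  have "D (t *\<^sub>R w # w # hs) (g + t' *\<^sub>R (t *\<^sub>R w)) = t * D (w # w # hs) (g + t' *\<^sub>R (t *\<^sub>R w))"
    using linear_cmul[OF linear_deriv[OF len'(2) t'(1)], of t w] by simp
  then have "\<bar>D hs (g + w) - D hs g - D (w # hs) g\<bar> = t * \<bar>D (w # w # hs) (g + t' *\<^sub>R (t *\<^sub>R w))\<bar>"
    using t t'(2) by (simp add: abs_mult)
  also have "\<dots> \<le> 1 * \<bar>D (w # w # hs) (g + t' *\<^sub>R (t *\<^sub>R w))\<bar>"
    using t by (intro mult_right_mono) auto
  finally show thesis using that[OF t'(1)] by simp
qed

end

section \<open>Mollification and weak derivatives\<close>

lemma iter_partial_Cons: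
  "iter_partial \<phi> (i # is) x = frechet_derivative (iter_partial \<phi> is) (at x) (axis i 1)"
  by (simp add: iter_partial_def iter_deriv.simps(2))

lemma has_derivative_shift:
  "((\<lambda>z. f (z - p)) has_derivative D) (at x) \<longleftrightarrow> (f has_derivative D) (at (x - p))"
proof -
  have shift: "((\<lambda>z. f (z - p)) has_derivative D) (at x)" if "(f has_derivative D) (at (x - p))" for f p x
  proof -
    have "((\<lambda>z. z - p) has_derivative (\<lambda>h. h)) (at x)" by (auto intro!: derivative_eq_intros)
    from diff_chain_at[OF this that] show ?thesis by (simp add: o_def)
  qed
  from shift[of f x p] shift[of "\<lambda>z. f (z - p)" "x - p" "- p"] show ?thesis by auto
qed

lemma iter_partial_shift: "iter_partial (\<lambda>z. \<phi> (z - p)) is = (\<lambda>z. iter_partial \<phi> is (z - p))"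
proof (induction "is")
  case Nil
  then show ?case by (simp add: iter_partial_def)
next
  case (Cons i "is")
  have "frechet_derivative (\<lambda>z. f (z - p)) (at x) = frechet_derivative f (at (x - p))"
    for f :: "real ^ 'a \<Rightarrow> real" and x
    unfolding frechet_derivative_def by (simp add: has_derivative_shift)
  then show ?case by (simp add: fun_eq_iff iter_partial_Cons Cons)
qed

lemma iter_partial_has_derivative:
  assumes "test_function \<phi>"
  shows "(iter_partial \<phi> is has_derivative (\<lambda>v. \<Sum>i\<in>UNIV. v $ i * iter_partial \<phi> (i # is) x)) (at x)"
proof -
  have D: "(iter_partial \<phi> is has_derivative frechet_derivative (iter_partial \<phi> is) (at x)) (at x)"
    using assms unfolding test_function_def differentiable_on_def by (simp add: frechet_derivative_works)
  let ?D = "frechet_derivative (iter_partial \<phi> is) (at x)"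
  have lin: "linear ?D" using D by (rule has_derivative_linear)
  have "?D v = (\<Sum>i\<in>UNIV. v $ i * iter_partial \<phi> (i # is) x)" for v
  proof -
    have "?D v = ?D (\<Sum>i\<in>UNIV. v $ i *\<^sub>R axis i 1)"
      using basis_expansion[of v] by (simp add: scalar_mult_eq_scaleR)
    also have "\<dots> = (\<Sum>i\<in>UNIV. v $ i * iter_partial \<phi> (i # is) x)"
      using lin by (simp add: linear_sum linear_cmul iter_partial_Cons)
    finally show ?thesis .
  qed
  then show ?thesis using D by presburger
qed

lemma continuous_iter_partial: "test_function \<phi> \<Longrightarrow> continuous_on UNIV (iter_partial \<phi> is)"
  unfolding test_function_def using differentiable_imp_continuous_on by blast

lemma iter_partial_outside_support:
  assumes "x \<notin> closure {x. \<phi> x \<noteq> 0}"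
  shows "iter_partial \<phi> is x = 0"
  using assms
proof (induction "is" arbitrary: x)
  case Nil
  then show ?case using closure_subset[of "{x. \<phi> x \<noteq> 0}"] by (auto simp: iter_partial_def)
next
  case (Cons i "is")
  let ?U = "- closure {x. \<phi> x \<noteq> 0}"
  have "((\<lambda>_. 0) has_derivative (\<lambda>_. 0)) (at x)" by simp
  then have "(iter_partial \<phi> is has_derivative (\<lambda>_. 0)) (at x)"
    by (rule has_derivative_transform_within_open[where s = ?U]) (use Cons in auto)
  then show ?case by (simp add: iter_partial_Cons frechet_derivative_at[symmetric])
qed

lemma test_function_support:
  assumes "test_function \<phi>"
  obtains r where "r > 0" "\<And>is x. norm x > r \<Longrightarrow> iter_partial \<phi> is x = 0"
proof -
  have "bounded (closure {x. \<phi> x \<noteq> 0})" using assms by (simp add: test_function_def compact_imp_bounded)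
  then obtain r where r: "r > 0" "\<forall>x\<in>closure {x. \<phi> x \<noteq> 0}. norm x \<le> r" by (auto simp: bounded_pos)
  show thesis
    by (rule that[OF r(1)]) (use r(2) iter_partial_outside_support in \<open>metis not_le\<close>)
qed

lemma test_function_iter_partial: "test_function \<phi> \<Longrightarrow> test_function (iter_partial \<phi> js)"
proof -
  assume t: "test_function \<phi>"
  obtain r where r: "r > 0" "\<And>is x. norm x > r \<Longrightarrow> iter_partial \<phi> is x = 0"
    using test_function_support[OF t] by blast
  have eq: "iter_partial (iter_partial \<phi> js) is = iter_partial \<phi> (is @ js)" for "is"
  proof (induction "is")
    case Nil
    then show ?case by (simp add: iter_partial_def)
  next
    case (Cons i "is")
    have "iter_partial (iter_partial \<phi> js) is = iter_partial \<phi> (is @ js)" by (rule Cons)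
    then show ?case by (intro ext) (simp only: iter_partial_Cons append_Cons)
  qed
  have "{x. iter_partial \<phi> js x \<noteq> 0} \<subseteq> cball 0 r" using r(2)[of _ js] by (auto simp: not_less[symmetric])
  then have "compact (closure {x. iter_partial \<phi> js x \<noteq> 0})"
    using bounded_subset[OF bounded_cball] by (simp add: compact_closure)
  then show ?thesis using t by (simp add: test_function_def eq)
qed

lemma test_function_shift: "test_function \<phi> \<Longrightarrow> test_function (\<lambda>z. \<phi> (z - p))"
proof -
  assume t: "test_function \<phi>"
  obtain r where r: "r > 0" "\<And>is x. norm x > r \<Longrightarrow> iter_partial \<phi> is x = 0"
    using test_function_support[OF t] by blast
  have "{x. \<phi> (x - p) \<noteq> 0} \<subseteq> cball p r"
    using r(2)[of _ "[]"] by (auto simp: iter_partial_def dist_norm norm_minus_commute not_less[symmetric])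
  then have "compact (closure {x. \<phi> (x - p) \<noteq> 0})"
    using bounded_subset[OF bounded_cball] by (simp add: compact_closure)
  moreover have "iter_partial (\<lambda>z. \<phi> (z - p)) is differentiable_on UNIV" for "is"
    using iter_partial_has_derivative[OF t, of "is"]
    unfolding iter_partial_shift differentiable_on_def differentiable_def
    by (auto simp: has_derivative_shift)
  ultimately show ?thesis by (simp add: test_function_def)
qed

text \<open>Correlation instead of convolution: the second factor is translated but not reflected, so the
  definition of a weak derivative applies to it as it stands.\<close>
definition correlate :: "(real ^ 'n \<Rightarrow> real) \<Rightarrow> (real ^ 'n \<Rightarrow> real) \<Rightarrow> real ^ 'n \<Rightarrow> real" where
  "correlate f \<psi> p = (LINT z|lborel. f z * \<psi> (z - p))"

lemma lborel_integral_shift: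
  fixes g :: "real ^ 'n \<Rightarrow> real"
  shows "g \<in> borel_measurable borel \<Longrightarrow> (LINT z|lborel. g (z - p)) = (LINT z|lborel. g z)"
proof -
  assume g: "g \<in> borel_measurable borel"
  have "(LINT z|lborel. g z) = (LINT z|distr lborel borel ((+) (- p)). g z)" by (simp only: lborel_distr_plus)
  also have "\<dots> = (LINT z|lborel. g (- p + z))" using g by (intro integral_distr) auto
  finally show ?thesis by simp
qed

lemma LINT_compact_support:
  fixes g :: "real ^ 'n \<Rightarrow> real"
  assumes "continuous_on UNIV g" "\<And>z. z \<notin> cbox a b \<Longrightarrow> g z = 0"
  shows "integrable lborel g" "(LINT z|lborel. g z) = integral (cbox a b) g"
proof -
  have eq: "(\<lambda>z. indicator (cbox a b) z *\<^sub>R g z) = g" using assms(2) by (auto simp: indicator_def fun_eq_iff)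
  have 1: "set_integrable lborel (cbox a b) g"
    unfolding set_integrable_def
    by (rule borel_integrable_compact) (use assms in \<open>auto intro: continuous_on_subset\<close>)
  then show "integrable lborel g" unfolding set_integrable_def eq .
  show "(LINT z|lborel. g z) = integral (cbox a b) g"
    using set_borel_integral_eq_integral(2)[OF 1] unfolding set_lebesgue_integral_def eq .
qed

lemma integrable_locally_integrable_mult:
  fixes g \<psi> :: "real ^ 'n \<Rightarrow> real"
  assumes g: "locally_integrable g" and \<psi>: "continuous_on UNIV \<psi>" "\<And>z. norm z > r \<Longrightarrow> \<psi> z = 0"
  shows "integrable lborel (\<lambda>z. g z * \<psi> z)"
proof -
  let ?K = "cball (0 :: real ^ 'n) r"
  have gi: "integrable lborel (\<lambda>z. indicator ?K z *\<^sub>R g z)"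
    using g unfolding locally_integrable_def set_integrable_def by simp
  have "compact (\<psi> ` ?K)" using \<psi>(1) by (intro compact_continuous_image) (auto intro: continuous_on_subset)
  then obtain B where B: "\<And>z. z \<in> ?K \<Longrightarrow> \<bar>\<psi> z\<bar> \<le> B"
    using that by (force dest!: compact_imp_bounded simp: bounded_iff)
  have eq: "(\<lambda>z. g z * \<psi> z) = (\<lambda>z. (indicator ?K z *\<^sub>R g z) * \<psi> z)"
    using \<psi>(2) by (auto simp: fun_eq_iff indicator_def)
  have \<psi>m: "\<psi> \<in> borel_measurable lborel" using \<psi>(1) by (simp add: borel_measurable_continuous_onI)
  show ?thesis unfolding eq
  proof (rule Bochner_Integration.integrable_bound[OF integrable_mult_right[OF gi, of B]])
    show "(\<lambda>z. indicator ?K z *\<^sub>R g z * \<psi> z) \<in> borel_measurable lborel"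
      using borel_measurable_integrable[OF gi] \<psi>m by (intro borel_measurable_times)
    show "AE z in lborel. norm (indicator ?K z *\<^sub>R g z * \<psi> z) \<le> norm (B * (indicator ?K z *\<^sub>R g z))"
    proof (rule AE_I2)
      fix z
      show "norm (indicator ?K z *\<^sub>R g z * \<psi> z) \<le> norm (B * (indicator ?K z *\<^sub>R g z))"
      proof (cases "z \<in> ?K")
        case True
        then have "\<bar>g z\<bar> * \<bar>\<psi> z\<bar> \<le> \<bar>g z\<bar> * \<bar>B\<bar>" using B[OF True] by (intro mult_left_mono) auto
        then show ?thesis using True by (simp add: abs_mult mult.commute)
      qed simp
    qed
  qed
qed

lemma continuous_imp_locally_integrable: "continuous_on UNIV f \<Longrightarrow> locally_integrable f"
  unfolding locally_integrable_def set_integrable_def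
  by (intro allI impI borel_integrable_compact) (auto intro: continuous_on_subset)

lemma integrable_correlate:
  assumes "locally_integrable g" "test_function \<phi>"
  shows "integrable lborel (\<lambda>z. g z * iter_partial \<phi> is (z - p))"
proof -
  obtain r where r: "r > 0" "\<And>is x. norm x > r \<Longrightarrow> iter_partial (\<lambda>z. \<phi> (z - p)) is x = 0"
    using test_function_support[OF test_function_shift[OF assms(2)]] by metis
  show ?thesis
    using integrable_locally_integrable_mult[OF assms(1) continuous_iter_partial[OF test_function_shift[OF assms(2)]] r(2)]
    by (simp add: iter_partial_shift)
qed

text \<open>Continuity of \<open>f\<close> suffices because the derivative falls on the test function; a correlation with
  a weak derivative is never differentiated, but rewritten as a correlation with \<open>f\<close>.\<close>
lemma correlate_along_line:
  fixes f \<phi> :: "real ^ 'n \<Rightarrow> real"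
  assumes f: "continuous_on UNIV f" and \<phi>: "test_function \<phi>"
  shows "((\<lambda>t. correlate f (iter_partial \<phi> is) (p + t *\<^sub>R v)) has_real_derivative
    - (\<Sum>i\<in>UNIV. v $ i * correlate f (iter_partial \<phi> (i # is)) (p + t *\<^sub>R v))) (at t)"
proof -
  let ?U = "ball t 1"
  obtain r where r: "r > 0" "\<And>is x. norm x > r \<Longrightarrow> iter_partial \<phi> is x = 0"
    using test_function_support[OF \<phi>] by blast
  let ?R = "r + norm p + (\<bar>t\<bar> + 1) * norm v"
  obtain a :: "real ^ 'n" where a: "cball 0 ?R \<subseteq> cbox (- a) a" using bounded_subset_cbox_symmetric[OF bounded_cball] by blast
  have outside: "iter_partial \<phi> is (z - (p + s *\<^sub>R v)) = 0" if "s \<in> ?U" "z \<notin> cbox (- a) a" for s and z :: "real ^ 'n" and "is"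
  proof (rule r(2))
    have "\<bar>s\<bar> \<le> \<bar>t\<bar> + 1" using that(1) by (auto simp: dist_real_def)
    then have "norm (p + s *\<^sub>R v) \<le> norm p + (\<bar>t\<bar> + 1) * norm v"
      using norm_triangle_ineq[of p "s *\<^sub>R v"] mult_right_mono[of "\<bar>s\<bar>" "\<bar>t\<bar> + 1" "norm v"] by simp
    moreover have "norm z > ?R" using a that(2) by (auto simp: subset_iff not_less[symmetric])
    ultimately show "r < norm (z - (p + s *\<^sub>R v))" using norm_triangle_ineq2[of z "p + s *\<^sub>R v"] by linarith
  qed
  note [continuous_intros] = continuous_on_compose2[OF f _ subset_UNIV]
    continuous_on_compose2[OF continuous_iter_partial[OF \<phi>] _ subset_UNIV]
  let ?f' = "\<lambda>s z. - (\<Sum>i\<in>UNIV. v $ i * (f z * iter_partial \<phi> (i # is) (z - (p + s *\<^sub>R v))))"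
  have leibniz: "((\<lambda>s. integral (cbox (- a) a) (\<lambda>z. f z * iter_partial \<phi> is (z - (p + s *\<^sub>R v))))
      has_vector_derivative integral (cbox (- a) a) (?f' t)) (at t within ?U)"
  proof (rule leibniz_rule_vector_derivative)
    fix s z
    have "((\<lambda>s. z - (p + s *\<^sub>R v)) has_derivative (\<lambda>h. - (h *\<^sub>R v))) (at s within ?U)"
      by (auto intro!: derivative_eq_intros)
    from has_derivative_compose[OF this iter_partial_has_derivative[OF \<phi>]]
    have "((\<lambda>s. f z * iter_partial \<phi> is (z - (p + s *\<^sub>R v))) has_derivative
        (\<lambda>h. f z * (\<Sum>i\<in>UNIV. (- (h *\<^sub>R v)) $ i * iter_partial \<phi> (i # is) (z - (p + s *\<^sub>R v))))) (at s within ?U)"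
      by (rule has_derivative_mult_right)
    moreover have "f z * (\<Sum>i\<in>UNIV. (- (h *\<^sub>R v)) $ i * iter_partial \<phi> (i # is) (z - (p + s *\<^sub>R v))) = h *\<^sub>R ?f' s z" for h
      by (simp add: sum_distrib_left sum_negf mult.assoc mult.left_commute)
    ultimately show "((\<lambda>s. f z * iter_partial \<phi> is (z - (p + s *\<^sub>R v))) has_vector_derivative ?f' s z) (at s within ?U)"
      by (simp only: has_vector_derivative_def)
  next
    fix s
    show "(\<lambda>z. f z * iter_partial \<phi> is (z - (p + s *\<^sub>R v))) integrable_on cbox (- a) a"
      by (intro integrable_continuous continuous_intros)
  next
    show "continuous_on (?U \<times> cbox (- a) a) (\<lambda>(s, z). ?f' s z)"
      unfolding case_prod_unfold by (intro continuous_intros)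
  qed auto
  have corr: "correlate f (iter_partial \<phi> js) (p + s *\<^sub>R v)
      = integral (cbox (- a) a) (\<lambda>z. f z * iter_partial \<phi> js (z - (p + s *\<^sub>R v)))" if "s \<in> ?U" for s js
    unfolding correlate_def
    by (rule LINT_compact_support(2)) (use outside[OF that] in \<open>auto intro!: continuous_intros\<close>)
  have "((\<lambda>s. correlate f (iter_partial \<phi> is) (p + s *\<^sub>R v)) has_vector_derivative
      integral (cbox (- a) a) (?f' t)) (at t within ?U)"
    by (rule has_vector_derivative_transform[rotated 2, OF leibniz]) (use corr in auto)
  moreover have "integral (cbox (- a) a) (?f' t)
      = - (\<Sum>i\<in>UNIV. v $ i * correlate f (iter_partial \<phi> (i # is)) (p + t *\<^sub>R v))"
  proof -
    have "(\<lambda>z. f z * iter_partial \<phi> (i # is) (z - (p + t *\<^sub>R v))) integrable_on cbox (- a) a" for i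
      by (intro integrable_continuous continuous_intros)
    then show ?thesis
      by (subst integral_neg, subst integral_sum) (auto simp: corr intro!: integrable_on_mult_right)
  qed
  ultimately show ?thesis
    by (simp add: has_real_derivative_iff_has_vector_derivative at_within_open[of t ?U])
qed

text \<open>The classical partial derivative of the mollified function; the sign compensates for the
  derivatives falling on the mollifier.\<close>
definition moll :: "(real ^ 'n \<Rightarrow> real) \<Rightarrow> (real ^ 'n \<Rightarrow> real) \<Rightarrow> 'n list \<Rightarrow> real ^ 'n \<Rightarrow> real" where
  "moll f \<phi> is p = (- 1) ^ length is * correlate f (iter_partial \<phi> is) p"

lemma moll_along_line:
  assumes "continuous_on UNIV f" "test_function \<phi>"
  shows "((\<lambda>t. moll f \<phi> is (p + t *\<^sub>R v)) has_real_derivative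
    (\<Sum>i\<in>UNIV. v $ i * moll f \<phi> (i # is) (p + t *\<^sub>R v))) (at t)"
  unfolding moll_def
  by (rule DERIV_cong[OF DERIV_cmult[OF correlate_along_line[OF assms]]])
    (simp add: sum_distrib_left sum_negf mult.assoc mult.left_commute)

lemma moll_weak_deriv:
  assumes w: "has_weak_deriv f is g" and \<phi>: "test_function \<phi>"
  shows "moll f \<phi> is p = correlate g \<phi> p"
proof -
  have "(LINT z|lborel. f z * iter_partial (\<lambda>z. \<phi> (z - p)) is z) = (- 1) ^ length is * (LINT z|lborel. g z * \<phi> (z - p))"
    using w test_function_shift[OF \<phi>] unfolding has_weak_deriv_def by blast
  then have "moll f \<phi> is p = ((- 1) ^ length is * (- 1) ^ length is) * correlate g \<phi> p"
    unfolding moll_def correlate_def iter_partial_shift by simp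
  also have "(- 1) ^ length is * (- 1) ^ length is = (1 :: real)" by (simp flip: power_mult_distrib)
  finally show ?thesis by simp
qed

definition mollifier :: "real \<Rightarrow> (real ^ 'n \<Rightarrow> real) \<Rightarrow> bool" where
  "mollifier \<delta> \<phi> \<longleftrightarrow> test_function \<phi> \<and> (\<forall>z. \<phi> z \<ge> 0) \<and> (\<forall>z. norm z > \<delta> \<longrightarrow> \<phi> z = 0) \<and> (LINT z|lborel. \<phi> z) = 1"

lemma test_function_borel: "test_function \<phi> \<Longrightarrow> \<phi> \<in> borel_measurable borel"
  using continuous_iter_partial[of \<phi> "[]"] by (simp add: borel_measurable_continuous_onI iter_partial_def)

lemma test_function_shift_integrable: "test_function \<phi> \<Longrightarrow> integrable lborel (\<lambda>z. \<phi> (z - p))"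
  using integrable_correlate[of "\<lambda>_. 1" \<phi> "[]" p]
  by (simp add: continuous_imp_locally_integrable iter_partial_def)

lemma correlate_bound:
  assumes m: "mollifier \<delta> \<phi>" and sub: "cball p \<delta> \<subseteq> S"
    and bd: "AE z in lborel. z \<in> S \<longrightarrow> \<bar>g z\<bar> \<le> M" and M: "M \<ge> 0"
  shows "\<bar>correlate g \<phi> p\<bar> \<le> M"
proof -
  have t: "test_function \<phi>" using m by (simp add: mollifier_def)
  have i: "integrable lborel (\<lambda>z. M * \<phi> (z - p))" using test_function_shift_integrable[OF t] by simp
  have "\<bar>correlate g \<phi> p\<bar> \<le> (LINT z|lborel. \<bar>g z * \<phi> (z - p)\<bar>)"
    unfolding correlate_def using integral_norm_bound[of lborel "\<lambda>z. g z * \<phi> (z - p)"] by simp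
  also have "\<dots> \<le> (LINT z|lborel. M * \<phi> (z - p))"
  proof (rule integral_mono_AE'[OF i])
    show "AE z in lborel. \<bar>g z * \<phi> (z - p)\<bar> \<le> M * \<phi> (z - p)"
      using bd
    proof eventually_elim
      case (elim z)
      show ?case
      proof (cases "z \<in> cball p \<delta>")
        case True
        then have "\<bar>g z\<bar> \<le> M" using elim sub by blast
        then show ?thesis using m by (simp add: abs_mult mollifier_def mult_right_mono)
      next
        case False
        then have "\<phi> (z - p) = 0" using m by (simp add: mollifier_def dist_norm norm_minus_commute)
        then show ?thesis by simp
      qed
    qed
    show "AE z in lborel. 0 \<le> M * \<phi> (z - p)" using m M by (simp add: mollifier_def)
  qed
  also have "\<dots> = M" using m lborel_integral_shift[OF test_function_borel[OF t], of p]
    by (simp add: mollifier_def)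
  finally show ?thesis .
qed

lemma moll_converges:
  assumes f: "continuous_on UNIV f" and m: "\<And>n. mollifier (\<delta> n) (\<phi> n)" and \<delta>: "\<delta> \<longlonglongrightarrow> 0"
  shows "(\<lambda>n. moll f (\<phi> n) [] p) \<longlonglongrightarrow> f p"
proof (rule LIMSEQ_I)
  fix e :: real assume "e > 0"
  then have e: "e / 2 > 0" by simp
  have fp: "isCont f p" using f by (simp add: continuous_on_eq_continuous_at)
  then obtain d where d: "d > 0" "\<And>z. dist z p < d \<Longrightarrow> \<bar>f z - f p\<bar> < e / 2"
    using e unfolding continuous_at_eps_delta dist_real_def by metis
  have "eventually (\<lambda>n. \<delta> n < d) sequentially" using \<delta> d(1) by (rule order_tendstoD)
  then obtain N where N: "\<And>n. n \<ge> N \<Longrightarrow> \<delta> n < d" by (auto simp: eventually_sequentially)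
  show "\<exists>no. \<forall>n\<ge>no. norm (moll f (\<phi> n) [] p - f p) < e"
  proof (intro exI[of _ N] allI impI)
    fix n assume "n \<ge> N"
    have t: "test_function (\<phi> n)" using m[of n] by (simp add: mollifier_def)
    have "\<bar>correlate (\<lambda>z. f z - f p) (\<phi> n) p\<bar> \<le> e / 2"
    proof (rule correlate_bound[OF m subset_refl])
      show "AE z in lborel. z \<in> cball p (\<delta> n) \<longrightarrow> \<bar>f z - f p\<bar> \<le> e / 2"
        using d(2) N[OF \<open>n \<ge> N\<close>] by (intro AE_I2) (auto simp: dist_commute intro!: less_imp_le)
    qed (use e in simp)
    moreover have "correlate (\<lambda>z. f z - f p) (\<phi> n) p = moll f (\<phi> n) [] p - f p"
    proof -
      have i: "integrable lborel (\<lambda>z. f z * \<phi> n (z - p))"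
        using integrable_correlate[OF continuous_imp_locally_integrable[OF f] t, of "[]" p] by (simp add: iter_partial_def)
      have "correlate (\<lambda>z. f z - f p) (\<phi> n) p = (LINT z|lborel. f z * \<phi> n (z - p)) - (LINT z|lborel. f p * \<phi> n (z - p))"
        unfolding correlate_def left_diff_distrib
        using i test_function_shift_integrable[OF t] by (intro Bochner_Integration.integral_diff) auto
      also have "(LINT z|lborel. f p * \<phi> n (z - p)) = f p"
        using m[of n] lborel_integral_shift[OF test_function_borel[OF t], of p] by (simp add: mollifier_def)
      finally show ?thesis by (simp add: moll_def correlate_def iter_partial_def)
    qed
    ultimately show "norm (moll f (\<phi> n) [] p - f p) < e" using \<open>e > 0\<close> by simp
  qed
qed

text \<open>Shifting the test function and differentiating in the shift integrates by parts against an
  affine function; a second derivative therefore annihilates it.\<close>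
lemma LINT_affine_partial:
  fixes \<phi> :: "real ^ 'n \<Rightarrow> real"
  assumes \<phi>: "test_function \<phi>"
  shows "(LINT z|lborel. (a \<bullet> z + c) * iter_partial \<phi> (i # is) z) = - a $ i * (LINT z|lborel. iter_partial \<phi> is z)"
proof -
  let ?l = "\<lambda>z. a \<bullet> z + c"
  let ?\<psi> = "iter_partial \<phi> is"
  let ?v = "axis i 1 :: real ^ 'n"
  have l: "continuous_on UNIV ?l" by (intro continuous_intros)
  have \<psi>: "test_function ?\<psi>" by (rule test_function_iter_partial[OF \<phi>])
  have il: "integrable lborel (\<lambda>z. ?l z * ?\<psi> z)"
    using integrable_correlate[OF continuous_imp_locally_integrable[OF l] \<phi>, of "is" 0] by simp
  have i1: "integrable lborel ?\<psi>" using test_function_shift_integrable[OF \<psi>, of 0] by simp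
  have shift: "correlate ?l ?\<psi> (0 + t *\<^sub>R ?v) = (LINT z|lborel. ?l z * ?\<psi> z) + t * (a $ i * (LINT z|lborel. ?\<psi> z))" for t
  proof -
    have "correlate ?l ?\<psi> (0 + t *\<^sub>R ?v) = (LINT z|lborel. (\<lambda>z. ?l (z + t *\<^sub>R ?v) * ?\<psi> z) (z - t *\<^sub>R ?v))"
      unfolding correlate_def by (simp add: algebra_simps)
    also have "\<dots> = (LINT z|lborel. ?l (z + t *\<^sub>R ?v) * ?\<psi> z)"
      by (rule lborel_integral_shift) (use test_function_borel[OF \<psi>] in measurable)
    also have "\<dots> = (LINT z|lborel. ?l z * ?\<psi> z + t * a $ i * ?\<psi> z)"
      by (intro Bochner_Integration.integral_cong) (simp_all add: inner_axis algebra_simps)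
    also have "\<dots> = (LINT z|lborel. ?l z * ?\<psi> z) + (LINT z|lborel. t * a $ i * ?\<psi> z)"
      using il i1 by (intro Bochner_Integration.integral_add) auto
    finally show ?thesis by simp
  qed
  have "((\<lambda>t. correlate ?l ?\<psi> (0 + t *\<^sub>R ?v)) has_real_derivative
      - (\<Sum>j\<in>UNIV. ?v $ j * correlate ?l (iter_partial \<phi> (j # is)) (0 + 0 *\<^sub>R ?v))) (at 0)"
    by (rule correlate_along_line[OF l \<phi>])
  moreover have "((\<lambda>t. correlate ?l ?\<psi> (0 + t *\<^sub>R ?v)) has_real_derivative a $ i * (LINT z|lborel. ?\<psi> z)) (at 0)"
    unfolding shift by (auto intro!: derivative_eq_intros)
  ultimately have "a $ i * (LINT z|lborel. ?\<psi> z)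
      = - (\<Sum>j\<in>UNIV. ?v $ j * correlate ?l (iter_partial \<phi> (j # is)) 0)"
    using DERIV_unique by fastforce
  also have "(\<Sum>j\<in>UNIV. ?v $ j * correlate ?l (iter_partial \<phi> (j # is)) 0) = correlate ?l (iter_partial \<phi> (i # is)) 0"
    by (subst sum.remove[of _ i]) (auto simp: axis_def intro!: sum.neutral)
  finally show ?thesis by (simp add: correlate_def)
qed

lemma has_weak_deriv_add_linear:
  fixes f g :: "real ^ 'n \<Rightarrow> real"
  assumes w: "has_weak_deriv f is g" and len: "length is \<ge> 2"
  shows "has_weak_deriv (\<lambda>z. a \<bullet> z + f z) is g"
proof -
  have f: "locally_integrable f" and g: "locally_integrable g" using w by (auto simp: has_weak_deriv_def)
  have lin: "locally_integrable (\<lambda>z. a \<bullet> z)"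
    by (intro continuous_imp_locally_integrable continuous_intros)
  have "locally_integrable (\<lambda>z. a \<bullet> z + f z)"
    using lin f unfolding locally_integrable_def by (auto intro: set_integral_add)
  moreover have "(LINT x|lborel. (a \<bullet> x + f x) * iter_partial \<phi> is x) = (LINT x|lborel. f x * iter_partial \<phi> is x)"
    if \<phi>: "test_function \<phi>" for \<phi>
  proof -
    obtain i j js where "is": "is = i # j # js" using len by (metis One_nat_def Suc_1 Suc_le_length_iff)
    have "(LINT x|lborel. (a \<bullet> x) * iter_partial \<phi> is x) = 0"
      using LINT_affine_partial[OF \<phi>, of a 0 i "j # js"] LINT_affine_partial[OF \<phi>, of 0 1 j js] by (simp add: "is")
    then show ?thesis
      using integrable_correlate[OF lin \<phi>, of "is" 0] integrable_correlate[OF f \<phi>, of "is" 0]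
      by (simp add: distrib_right)
  qed
  ultimately show ?thesis using w by (simp add: has_weak_deriv_def)
qed

section \<open>Existence of mollifiers\<close>

text \<open>The functions \<open>p (1/t) exp (- 1/t)\<close>, extended by zero to \<open>t \<le> 0\<close>, are closed under
  differentiation when \<open>p\<close> ranges over all polynomials.\<close>
definition flat :: "real poly \<Rightarrow> real \<Rightarrow> real" where
  "flat p t = (if t \<le> 0 then 0 else poly p (1 / t) * exp (- (1 / t)))"

lemma flat_tendsto_0: "(flat p \<longlongrightarrow> 0) (at 0)"
proof -
  have "((\<lambda>s. \<Sum>i\<le>degree p. coeff p i * (s ^ i / exp s)) \<longlongrightarrow> (\<Sum>i\<le>degree p. coeff p i * 0)) at_top"
    by (intro tendsto_sum tendsto_mult_left tendsto_power_div_exp_0)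
  then have "((\<lambda>s. poly p s * exp (- s)) \<longlongrightarrow> 0) at_top"
    by (simp add: poly_altdef sum_distrib_right exp_minus divide_inverse mult.assoc)
  then have "((\<lambda>t. poly p (1 / t) * exp (- (1 / t))) \<longlongrightarrow> 0) (at_right (0 :: real))"
    by (rule filterlim_compose) (simp add: filterlim_inverse_at_top_right flip: inverse_eq_divide)
  then have "(flat p \<longlongrightarrow> 0) (at_right 0)"
    by (rule Lim_transform_eventually) (auto simp: flat_def eventually_at_filter intro!: always_eventually)
  moreover have "(flat p \<longlongrightarrow> 0) (at_left 0)"
    by (rule Lim_transform_eventually[OF tendsto_const])
      (auto simp: flat_def eventually_at_filter intro!: always_eventually)
  ultimately show ?thesis by (simp add: filterlim_split_at)
qed

definition flat_deriv :: "real poly \<Rightarrow> real poly" where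
  "flat_deriv p = monom 1 2 * (p - pderiv p)"

lemma flat_has_derivative: "(flat p has_real_derivative flat (flat_deriv p) t) (at t)"
proof -
  consider "t < 0" | "t = 0" | "t > 0" by linarith
  then show ?thesis
  proof cases
    case 1
    have "((\<lambda>_. 0) has_real_derivative 0) (at t)" by simp
    then have "(flat p has_real_derivative 0) (at t)"
      by (rule has_field_derivative_transform_within_open[where S = "{..<0}"]) (use 1 in \<open>auto simp: flat_def\<close>)
    then show ?thesis using 1 by (simp add: flat_def)
  next
    case 2
    have "((\<lambda>h. (flat p (0 + h) - flat p 0) / h) \<longlongrightarrow> 0) (at 0)"
      by (rule Lim_transform_eventually[OF flat_tendsto_0[of "pCons 0 p"]])
        (auto simp: flat_def eventually_at_filter field_simps intro!: always_eventually)
    then show ?thesis using 2 by (simp add: DERIV_def flat_def)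
  next
    case 3
    have "((\<lambda>t. poly p (1 / t) * exp (- (1 / t))) has_real_derivative flat (flat_deriv p) t) (at t)"
      using 3 by (auto intro!: derivative_eq_intros DERIV_chain2[OF poly_DERIV]
          simp: flat_def flat_deriv_def poly_monom field_simps power2_eq_square)
    then show ?thesis
      by (rule has_field_derivative_transform_within_open[where S = "{0<..}"]) (use 3 in \<open>auto simp: flat_def\<close>)
  qed
qed

inductive flat_algebra :: "(real ^ 'n \<Rightarrow> real) \<Rightarrow> bool" where
  const: "flat_algebra (\<lambda>_. c)"
| flat: "flat_algebra (\<lambda>x. flat p (a * x $ i + b))"
| add: "flat_algebra f \<Longrightarrow> flat_algebra g \<Longrightarrow> flat_algebra (\<lambda>x. f x + g x)"
| mult: "flat_algebra f \<Longrightarrow> flat_algebra g \<Longrightarrow> flat_algebra (\<lambda>x. f x * g x)"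

lemma flat_algebra_derivative:
  "flat_algebra f \<Longrightarrow> \<exists>D. (\<forall>x. (f has_derivative D x) (at x)) \<and> (\<forall>v. flat_algebra (\<lambda>x. D x v))"
proof (induction rule: flat_algebra.induct)
  case (const c)
  show ?case by (rule exI[of _ "\<lambda>_ _. 0"]) (auto intro: flat_algebra.const)
next
  case (flat p a i b)
  have "((\<lambda>x. flat p (a * x $ i + b)) has_derivative (\<lambda>v. flat (flat_deriv p) (a * x $ i + b) * (a * v $ i))) (at x)" for x
  proof -
    have "((\<lambda>x. a * x $ i + b) has_derivative (\<lambda>v. a * v $ i)) (at x)"
      by (auto intro!: derivative_eq_intros bounded_linear_imp_has_derivative bounded_linear_vec_nth)
    from has_derivative_compose[OF this flat_has_derivative[unfolded has_field_derivative_def]]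
    show ?thesis by simp
  qed
  moreover have "flat_algebra (\<lambda>x. flat (flat_deriv p) (a * x $ i + b) * (a * v $ i))" for v
    by (intro flat_algebra.mult flat_algebra.flat flat_algebra.const)
  ultimately show ?case by (intro exI[of _ "\<lambda>x v. flat (flat_deriv p) (a * x $ i + b) * (a * v $ i)"]) blast
next
  case (add f g)
  then obtain D E where "\<And>x. (f has_derivative D x) (at x)" "\<And>v. flat_algebra (\<lambda>x. D x v)"
    "\<And>x. (g has_derivative E x) (at x)" "\<And>v. flat_algebra (\<lambda>x. E x v)" by blast
  then show ?case
    by (intro exI[of _ "\<lambda>x v. D x v + E x v"]) (auto intro: has_derivative_add flat_algebra.add)
next
  case (mult f g)
  then obtain D E where "\<And>x. (f has_derivative D x) (at x)" "\<And>v. flat_algebra (\<lambda>x. D x v)"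
    "\<And>x. (g has_derivative E x) (at x)" "\<And>v. flat_algebra (\<lambda>x. E x v)" by blast
  then have "\<And>x. ((\<lambda>x. f x * g x) has_derivative (\<lambda>v. f x * E x v + D x v * g x)) (at x)"
    "\<And>v. flat_algebra (\<lambda>x. f x * E x v + D x v * g x)"
    using mult.hyps by (blast intro: has_derivative_mult) (intro flat_algebra.add flat_algebra.mult; fact)
  then show ?case by (intro exI[of _ "\<lambda>x v. f x * E x v + D x v * g x"]) blast
qed

lemma flat_algebra_iter_partial: "flat_algebra f \<Longrightarrow> flat_algebra (iter_partial f is)"
proof (induction "is")
  case Nil
  then show ?case by (simp add: iter_partial_def)
next
  case (Cons i "is")
  then obtain D where D: "\<And>x. (iter_partial f is has_derivative D x) (at x)" "\<And>v. flat_algebra (\<lambda>x. D x v)"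
    using flat_algebra_derivative by blast
  have "iter_partial f (i # is) = (\<lambda>x. D x (axis i 1))"
    by (intro ext) (simp only: iter_partial_Cons frechet_derivative_at[OF D(1), symmetric])
  then show ?case using D(2) by simp
qed

lemma flat_algebra_test_function:
  assumes "flat_algebra f" "\<And>z. norm z > r \<Longrightarrow> f z = 0"
  shows "test_function f"
proof -
  have "iter_partial f is differentiable_on UNIV" for "is"
    using flat_algebra_derivative[OF flat_algebra_iter_partial[OF assms(1)]]
    unfolding differentiable_on_def differentiable_def by metis
  moreover have "{z. f z \<noteq> 0} \<subseteq> cball 0 r" using assms(2) by (auto simp: not_less[symmetric])
  then have "compact (closure {z. f z \<noteq> 0})"
    using bounded_subset[OF bounded_cball] by (simp add: compact_closure)
  ultimately show ?thesis by (simp add: test_function_def)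
qed

lemma mollifier_exists:
  assumes "\<delta> > 0"
  shows "\<exists>\<phi> :: real ^ 'n \<Rightarrow> real. mollifier \<delta> \<phi>"
proof -
  define c where "c = real CARD('n) / \<delta>"
  have c: "c > 0" using assms by (simp add: c_def)
  define \<beta> where "\<beta> = (\<lambda>s. flat 1 (c * s + 1) * flat 1 (- c * s + 1))"
  define bump where "bump = (\<lambda>z :: real ^ 'n. \<Prod>i\<in>UNIV. \<beta> (z $ i))"
  have \<beta>0: "\<beta> s \<ge> 0" "\<beta> 0 > 0" for s by (auto simp: \<beta>_def flat_def)
  have \<beta>: "c * \<bar>s\<bar> < 1" if "\<beta> s \<noteq> 0" for s
    using that c by (auto simp: \<beta>_def flat_def abs_if split: if_splits)
  have prod: "flat_algebra (\<lambda>z :: real ^ 'n. \<Prod>i\<in>I. \<beta> (z $ i))" if "finite I" for I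
    using that
  proof induction
    case (insert i I)
    have "flat_algebra (\<lambda>z :: real ^ 'n. \<beta> (z $ i))"
      unfolding \<beta>_def by (intro flat_algebra.mult flat_algebra.flat)
    then show ?case using insert by (simp add: flat_algebra.mult)
  qed (simp add: flat_algebra.const)
  have alg: "flat_algebra bump" unfolding bump_def by (rule prod) simp
  have supp: "bump z = 0" if "norm z > \<delta>" for z
  proof (rule ccontr)
    assume "bump z \<noteq> 0"
    then have "\<beta> (z $ i) \<noteq> 0" for i by (auto simp: bump_def)
    then have "\<bar>z $ i\<bar> \<le> 1 / c" for i using \<beta>[of "z $ i"] c by (simp add: field_simps less_imp_le)
    then have "(\<Sum>i\<in>UNIV. \<bar>z $ i\<bar>) \<le> (\<Sum>i\<in>(UNIV :: 'n set). 1 / c)" by (intro sum_mono)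
    also have "\<dots> = \<delta>" using assms by (simp add: c_def)
    finally show False using norm_le_l1_cart[of z] that by linarith
  qed
  have t: "test_function bump" by (rule flat_algebra_test_function[OF alg supp])
  have cont: "continuous_on UNIV bump" using continuous_iter_partial[OF t, of "[]"] by (simp add: iter_partial_def)
  have nonneg: "bump z \<ge> 0" for z unfolding bump_def by (intro prod_nonneg) (simp add: \<beta>0)
  obtain a :: "real ^ 'n" where a: "cball 0 (\<delta> + 1) \<subseteq> cbox (- a) a"
    using bounded_subset_cbox_symmetric[OF bounded_cball] by blast
  have out: "bump z = 0" if "z \<notin> cbox (- a) a" for z
  proof -
    have "z \<notin> cball 0 (\<delta> + 1)" using a that by blast
    then show ?thesis by (intro supp) simp
  qed
  define J where "J = (LINT z|lborel. bump z)"
  have J: "J = integral (cbox (- a) a) bump" unfolding J_def by (rule LINT_compact_support(2)[OF cont out])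
  have "J > 0"
  proof -
    have "0 \<in> interior (cbox (- a) a)"
      using a assms by (intro interiorI[of "ball 0 \<delta>"]) (auto simp: subset_iff)
    then have ne: "box (- a) a \<noteq> {}" by auto
    have "0 \<in> cbox (- a) a" using a assms by auto
    moreover have "bump 0 > 0" unfolding bump_def by (intro prod_pos) (simp add: \<beta>0)
    ultimately have "J \<noteq> 0"
      unfolding J
      using integral_cbox_eq_0_iff[OF continuous_on_subset[OF cont subset_UNIV] ne nonneg] by auto
    moreover have "J \<ge> 0" unfolding J_def using nonneg by (intro integral_nonneg_AE) auto
    ultimately show ?thesis by simp
  qed
  define \<phi> where "\<phi> = (\<lambda>z. 1 / J * bump z)"
  have "flat_algebra \<phi>" unfolding \<phi>_def by (intro flat_algebra.mult flat_algebra.const alg)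
  then have "test_function \<phi>" by (rule flat_algebra_test_function[of _ \<delta>]) (simp add: \<phi>_def supp)
  moreover have "(LINT z|lborel. \<phi> z) = 1" using \<open>J > 0\<close> unfolding \<phi>_def by (simp add: J_def[symmetric])
  ultimately have "mollifier \<delta> \<phi>"
    using nonneg supp \<open>J > 0\<close> by (auto simp: mollifier_def \<phi>_def)
  then show ?thesis by blast
qed

section \<open>Taylor estimates from local bounds on weak derivatives\<close>

text \<open>The triangle with vertices \<open>x\<close>, \<open>\<xi>\<close> and \<open>\<xi> + s\<close>, swept out by segments from \<open>x\<close>.\<close>
definition bond_triangle :: "'a::real_vector \<Rightarrow> 'a \<Rightarrow> 'a \<Rightarrow> 'a set" where
  "bond_triangle x \<xi> s = {x + \<tau> *\<^sub>R (\<xi> + t *\<^sub>R s - x) | \<tau> t. 0 \<le> \<tau> \<and> \<tau> \<le> 1 \<and> 0 \<le> t \<and> t \<le> 1}"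

lemma bond_triangleI: "0 \<le> \<tau> \<Longrightarrow> \<tau> \<le> 1 \<Longrightarrow> 0 \<le> t \<Longrightarrow> t \<le> 1 \<Longrightarrow> x + \<tau> *\<^sub>R (\<xi> + t *\<^sub>R s - x) \<in> bond_triangle x \<xi> s"
  unfolding bond_triangle_def by blast

lemma sum_abs_bound:
  fixes a :: "'n::finite \<Rightarrow> real" and A :: real
  assumes "\<And>i. \<bar>a i\<bar> \<le> A"
  shows "\<bar>\<Sum>i\<in>UNIV. a i\<bar> \<le> CARD('n) * A"
proof -
  have "\<bar>\<Sum>i\<in>UNIV. a i\<bar> \<le> (\<Sum>i\<in>UNIV. \<bar>a i\<bar>)" by (rule sum_abs)
  also have "\<dots> \<le> (\<Sum>i\<in>(UNIV :: 'n set). A)" using assms by (intro sum_mono) auto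
  finally show ?thesis by simp
qed

lemma abs_mult_le: "\<bar>a\<bar> \<le> A \<Longrightarrow> \<bar>b\<bar> \<le> B \<Longrightarrow> \<bar>a * b\<bar> \<le> A * (B :: real)"
  unfolding abs_mult by (intro mult_mono) (auto intro: order_trans[OF abs_ge_zero])

lemma mvt_real:
  assumes "a < b" "\<And>t. (F has_real_derivative F' t) (at t)"
  obtains t :: real where "a < t" "t < b" "F b - F a = (b - a) * F' t"
  using MVT2[OF assms(1), of F F'] assms(2) by blast

lemma triangle_leg_le:
  fixes s :: "'a::real_normed_vector"
  assumes "0 \<le> t" "t \<le> 1"
  shows "norm (\<xi> + t *\<^sub>R s - x) \<le> norm (\<xi> - x) + norm s"
proof -
  have "norm (\<xi> + t *\<^sub>R s - x) \<le> norm (\<xi> - x) + t * norm s"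
    using norm_triangle_ineq[of "\<xi> - x" "t *\<^sub>R s"] assms by (simp add: algebra_simps)
  also have "t * norm s \<le> 1 * norm s" using assms by (intro mult_right_mono) auto
  finally show ?thesis by simp
qed

lemma moll_taylor1:
  fixes f \<phi> :: "real ^ 'n \<Rightarrow> real" and M :: real
  assumes f: "continuous_on UNIV f" "test_function \<phi>" and M: "M \<ge> 0"
    and bd: "\<And>c \<alpha> \<beta>. c \<in> bond_triangle x \<xi> s \<Longrightarrow> \<bar>moll f \<phi> [\<beta>, \<alpha>] c\<bar> \<le> M"
  shows "\<bar>moll f \<phi> [] (\<xi> + s) - moll f \<phi> [] \<xi> - (\<Sum>\<alpha>\<in>UNIV. s $ \<alpha> * moll f \<phi> [\<alpha>] x)\<bar>
    \<le> (CARD('n))\<^sup>2 * M * norm s * (norm (\<xi> - x) + norm s)"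
proof -
  obtain t where t: "0 < t" "t < 1"
    "moll f \<phi> [] (\<xi> + 1 *\<^sub>R s) - moll f \<phi> [] (\<xi> + 0 *\<^sub>R s) = (1 - 0) * (\<Sum>\<alpha>\<in>UNIV. s $ \<alpha> * moll f \<phi> [\<alpha>] (\<xi> + t *\<^sub>R s))"
    by (rule mvt_real[OF zero_less_one moll_along_line[OF f]])
  define q where "q = \<xi> + t *\<^sub>R s - x"
  have q: "norm q \<le> norm (\<xi> - x) + norm s" unfolding q_def using t by (intro triangle_leg_le) auto
  have "((\<lambda>\<tau>. \<Sum>\<alpha>\<in>UNIV. s $ \<alpha> * moll f \<phi> [\<alpha>] (x + \<tau> *\<^sub>R q)) has_real_derivative
      (\<Sum>\<alpha>\<in>UNIV. s $ \<alpha> * (\<Sum>\<beta>\<in>UNIV. q $ \<beta> * moll f \<phi> [\<beta>, \<alpha>] (x + \<tau> *\<^sub>R q)))) (at \<tau>)" for \<tau>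
    by (intro DERIV_sum DERIV_cmult moll_along_line[OF f])
  then obtain \<tau> where \<tau>: "0 < \<tau>" "\<tau> < 1"
    "(\<Sum>\<alpha>\<in>UNIV. s $ \<alpha> * moll f \<phi> [\<alpha>] (x + 1 *\<^sub>R q)) - (\<Sum>\<alpha>\<in>UNIV. s $ \<alpha> * moll f \<phi> [\<alpha>] (x + 0 *\<^sub>R q))
      = (1 - 0) * (\<Sum>\<alpha>\<in>UNIV. s $ \<alpha> * (\<Sum>\<beta>\<in>UNIV. q $ \<beta> * moll f \<phi> [\<beta>, \<alpha>] (x + \<tau> *\<^sub>R q)))"
    by (rule mvt_real[OF zero_less_one])
  have xq: "x + q = \<xi> + t *\<^sub>R s" by (simp add: q_def)
  have "x + \<tau> *\<^sub>R q \<in> bond_triangle x \<xi> s" unfolding q_def using t \<tau> by (intro bond_triangleI) auto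
  then have "\<bar>\<Sum>\<alpha>\<in>UNIV. s $ \<alpha> * (\<Sum>\<beta>\<in>UNIV. q $ \<beta> * moll f \<phi> [\<beta>, \<alpha>] (x + \<tau> *\<^sub>R q))\<bar>
      \<le> CARD('n) * (norm s * (CARD('n) * (norm q * M)))"
    by (intro sum_abs_bound abs_mult_le bd component_le_norm_cart)
  also have "\<dots> = (CARD('n))\<^sup>2 * M * norm s * norm q" by (simp add: power2_eq_square)
  also have "\<dots> \<le> (CARD('n))\<^sup>2 * M * norm s * (norm (\<xi> - x) + norm s)"
    using q M by (intro mult_left_mono) auto
  finally show ?thesis using t(3) \<tau>(3) by (simp add: xq)
qed

lemma moll_taylor2:
  fixes f \<phi> :: "real ^ 'n \<Rightarrow> real" and M :: real
  assumes f: "continuous_on UNIV f" "test_function \<phi>" and M: "M \<ge> 0"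
    and bd: "\<And>c \<alpha> \<beta> \<gamma>. c \<in> bond_triangle x \<xi> s \<Longrightarrow> \<bar>moll f \<phi> [\<gamma>, \<beta>, \<alpha>] c\<bar> \<le> M"
  shows "\<bar>moll f \<phi> [] (\<xi> + s) - moll f \<phi> [] \<xi> - (\<Sum>\<alpha>\<in>UNIV. s $ \<alpha> * moll f \<phi> [\<alpha>] x)
      - (\<Sum>\<alpha>\<in>UNIV. s $ \<alpha> * (\<Sum>\<beta>\<in>UNIV. (\<xi> - x + s /\<^sub>R 2) $ \<beta> * moll f \<phi> [\<beta>, \<alpha>] x))\<bar>
    \<le> (CARD('n)) ^ 3 * M * norm s * (norm (\<xi> - x) + norm s)\<^sup>2"
proof -
  let ?m = "moll f \<phi>"
  define F where "F = (\<lambda>t. ?m [] (\<xi> + t *\<^sub>R s) - t * (\<Sum>\<alpha>\<in>UNIV. s $ \<alpha> * ?m [\<alpha>] x)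
    - (\<Sum>\<alpha>\<in>UNIV. s $ \<alpha> * (\<Sum>\<beta>\<in>UNIV. (t * (\<xi> - x) $ \<beta> + t\<^sup>2 / 2 * s $ \<beta>) * ?m [\<beta>, \<alpha>] x)))"
  have "(F has_real_derivative (\<Sum>\<alpha>\<in>UNIV. s $ \<alpha> * ?m [\<alpha>] (\<xi> + t *\<^sub>R s)) - 1 * (\<Sum>\<alpha>\<in>UNIV. s $ \<alpha> * ?m [\<alpha>] x)
      - (\<Sum>\<alpha>\<in>UNIV. s $ \<alpha> * (\<Sum>\<beta>\<in>UNIV. (1 * (\<xi> - x) $ \<beta> + t * s $ \<beta>) * ?m [\<beta>, \<alpha>] x))) (at t)" for t
    unfolding F_def
    by (intro DERIV_diff moll_along_line[OF f] DERIV_sum DERIV_cmult DERIV_cmult_right DERIV_add DERIV_ident)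
      (auto intro!: derivative_eq_intros)
  then obtain t where t: "0 < t" "t < 1"
    "F 1 - F 0 = (1 - 0) * ((\<Sum>\<alpha>\<in>UNIV. s $ \<alpha> * ?m [\<alpha>] (\<xi> + t *\<^sub>R s)) - 1 * (\<Sum>\<alpha>\<in>UNIV. s $ \<alpha> * ?m [\<alpha>] x)
      - (\<Sum>\<alpha>\<in>UNIV. s $ \<alpha> * (\<Sum>\<beta>\<in>UNIV. (1 * (\<xi> - x) $ \<beta> + t * s $ \<beta>) * ?m [\<beta>, \<alpha>] x)))"
    by (rule mvt_real[OF zero_less_one])
  define q where "q = \<xi> + t *\<^sub>R s - x"
  have q: "norm q \<le> norm (\<xi> - x) + norm s" unfolding q_def using t by (intro triangle_leg_le) auto
  define P where "P = (\<lambda>\<tau>. (\<Sum>\<alpha>\<in>UNIV. s $ \<alpha> * ?m [\<alpha>] (x + \<tau> *\<^sub>R q))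
    - \<tau> * (\<Sum>\<alpha>\<in>UNIV. s $ \<alpha> * (\<Sum>\<beta>\<in>UNIV. q $ \<beta> * ?m [\<beta>, \<alpha>] x)))"
  have FP: "F 1 - F 0 = P 1 - P 0"
    unfolding t(3) P_def by (simp add: q_def algebra_simps)
  define Q where "Q = (\<lambda>\<tau>. \<Sum>\<alpha>\<in>UNIV. s $ \<alpha> * (\<Sum>\<beta>\<in>UNIV. q $ \<beta> * ?m [\<beta>, \<alpha>] (x + \<tau> *\<^sub>R q)))"
  have "(P has_real_derivative Q \<tau> - 1 * Q 0) (at \<tau>)" for \<tau>
    unfolding P_def Q_def
    by (intro DERIV_diff DERIV_sum DERIV_cmult moll_along_line[OF f]) (auto intro!: derivative_eq_intros)
  then obtain \<tau> where \<tau>: "0 < \<tau>" "\<tau> < 1" "P 1 - P 0 = (1 - 0) * (Q \<tau> - 1 * Q 0)"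
    by (rule mvt_real[OF zero_less_one])
  have "(Q has_real_derivative (\<Sum>\<alpha>\<in>UNIV. s $ \<alpha> * (\<Sum>\<beta>\<in>UNIV. q $ \<beta> * (\<Sum>\<gamma>\<in>UNIV. q $ \<gamma> * ?m [\<gamma>, \<beta>, \<alpha>] (x + \<sigma> *\<^sub>R q))))) (at \<sigma>)" for \<sigma>
    unfolding Q_def by (intro DERIV_sum DERIV_cmult moll_along_line[OF f])
  then obtain \<sigma> where \<sigma>: "0 < \<sigma>" "\<sigma> < \<tau>"
    "Q \<tau> - Q 0 = (\<tau> - 0) * (\<Sum>\<alpha>\<in>UNIV. s $ \<alpha> * (\<Sum>\<beta>\<in>UNIV. q $ \<beta> * (\<Sum>\<gamma>\<in>UNIV. q $ \<gamma> * ?m [\<gamma>, \<beta>, \<alpha>] (x + \<sigma> *\<^sub>R q))))"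
    by (rule mvt_real[OF \<tau>(1)])
  have "x + \<sigma> *\<^sub>R q \<in> bond_triangle x \<xi> s" unfolding q_def using t \<tau> \<sigma> by (intro bond_triangleI) auto
  then have "\<bar>Q \<tau> - Q 0\<bar> \<le> 1 * (CARD('n) * (norm s * (CARD('n) * (norm q * (CARD('n) * (norm q * M))))))"
    unfolding \<sigma>(3) using \<tau>
    by (intro sum_abs_bound abs_mult_le bd component_le_norm_cart) auto
  also have "\<dots> = (CARD('n)) ^ 3 * M * norm s * (norm q)\<^sup>2" by (simp add: power2_eq_square power3_eq_cube)
  also have "\<dots> \<le> (CARD('n)) ^ 3 * M * norm s * (norm (\<xi> - x) + norm s)\<^sup>2"
    using q M by (intro mult_left_mono power_mono) auto
  finally have "\<bar>F 1 - F 0\<bar> \<le> (CARD('n)) ^ 3 * M * norm s * (norm (\<xi> - x) + norm s)\<^sup>2"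
    using FP \<tau>(3) by simp
  then show ?thesis unfolding F_def by (simp add: algebra_simps)
qed

lemma Linf_norm_AE:
  assumes "S \<in> sets lborel" "Linf_norm S f \<le> ennreal M" "M \<ge> 0"
  shows "AE z in lborel. z \<in> S \<longrightarrow> norm (f z) \<le> M"
proof -
  have "AE z in restrict_space lborel S. ennreal (norm (f z)) \<le> Linf_norm S f"
    unfolding Linf_norm_def by (rule esssup_AE)
  then have "AE z in lborel. z \<in> S \<longrightarrow> ennreal (norm (f z)) \<le> Linf_norm S f"
    using assms(1) by (subst (asm) AE_restrict_space_iff) auto
  then show ?thesis
  proof eventually_elim
    case (elim z)
    then show ?case using assms(2,3) by (metis ennreal_le_iff order_trans)
  qed
qed

lemma W_inf_loc_weak_deriv:
  assumes "f \<in> W_inf_loc m" "length is \<le> m"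
  obtains g where "has_weak_deriv f is g" "\<And>K. compact K \<Longrightarrow> \<exists>M\<ge>0. AE z in lborel. z \<in> K \<longrightarrow> \<bar>g z\<bar> \<le> M"
proof -
  obtain g where g: "has_weak_deriv f is g" "\<And>K. compact K \<Longrightarrow> Linf_norm K g < \<infinity>"
    using assms unfolding W_inf_loc_def by blast
  have "\<exists>M\<ge>0. AE z in lborel. z \<in> K \<longrightarrow> \<bar>g z\<bar> \<le> M" if K: "compact K" for K
  proof -
    obtain M where M: "M \<ge> 0" "Linf_norm K g = ennreal M" using g(2)[OF K] by (cases "Linf_norm K g") auto
    have "AE z in lborel. z \<in> K \<longrightarrow> norm (g z) \<le> M"
      by (rule Linf_norm_AE) (use M K in \<open>auto intro: borel_compact\<close>)
    then show ?thesis using M(1) by auto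
  qed
  then show thesis using that g(1) by blast
qed

lemma weak_deriv_W_inf_loc:
  "f \<in> W_inf_loc m \<Longrightarrow> length is \<le> m \<Longrightarrow> has_weak_deriv f is (weak_deriv f is)"
  unfolding weak_deriv_def using W_inf_loc_weak_deriv someI_ex by metis

lemma moll_bound:
  assumes "has_weak_deriv f is g" "mollifier \<delta> \<phi>" "cball p \<delta> \<subseteq> S"
    "AE z in lborel. z \<in> S \<longrightarrow> \<bar>g z\<bar> \<le> M" "M \<ge> 0"
  shows "\<bar>moll f \<phi> is p\<bar> \<le> M"
  using assms correlate_bound[OF assms(2-5)] moll_weak_deriv[OF assms(1)] by (simp add: mollifier_def)

definition mollifier_seq :: "nat \<Rightarrow> real ^ 'n \<Rightarrow> real" where
  "mollifier_seq n = (SOME \<phi>. mollifier (inverse (real (Suc n))) \<phi>)"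

lemma mollifier_seq: "mollifier (inverse (real (Suc n))) (mollifier_seq n)"
  unfolding mollifier_seq_def by (rule someI_ex[OF mollifier_exists]) simp

lemma test_function_mollifier_seq: "test_function (mollifier_seq n)"
  using mollifier_seq unfolding mollifier_def by blast

lemma mollifier_seq_ball: "cball c 1 \<subseteq> S \<Longrightarrow> cball c (inverse (real (Suc n))) \<subseteq> S"
proof -
  have "inverse (real (Suc n)) \<le> 1" by (simp add: inverse_le_1_iff)
  then have "cball c (inverse (real (Suc n))) \<subseteq> cball c 1" by (rule subset_cball)
  then show "cball c 1 \<subseteq> S \<Longrightarrow> cball c (inverse (real (Suc n))) \<subseteq> S" by blast
qed

text \<open>The Taylor estimates pass to the limit because the first and second derivatives of the
  mollified functions at the fixed base point are bounded, so that a subsequence of them converges.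
  Only the remainder needs the bound on the weak derivative near the triangle.\<close>
lemma taylor_expansion:
  fixes f :: "real ^ 'n \<Rightarrow> real"
  assumes f: "continuous_on UNIV f" and W: "f \<in> W_inf_loc 3"
  obtains G :: "real ^ 'n" and H :: "real ^ 'n ^ 'n" where
    "\<And>\<xi> s S (M :: real). M \<ge> 0 \<Longrightarrow> (\<And>c. c \<in> bond_triangle x \<xi> s \<Longrightarrow> cball c 1 \<subseteq> S) \<Longrightarrow>
      (\<And>\<alpha> \<beta>. \<exists>g. has_weak_deriv f [\<beta>, \<alpha>] g \<and> (AE z in lborel. z \<in> S \<longrightarrow> \<bar>g z\<bar> \<le> M)) \<Longrightarrow>
      \<bar>f (\<xi> + s) - f \<xi> - G \<bullet> s\<bar> \<le> (CARD('n))\<^sup>2 * M * norm s * (norm (\<xi> - x) + norm s)"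
    "\<And>\<xi> s S (M :: real). M \<ge> 0 \<Longrightarrow> (\<And>c. c \<in> bond_triangle x \<xi> s \<Longrightarrow> cball c 1 \<subseteq> S) \<Longrightarrow>
      (\<And>\<alpha> \<beta> \<gamma>. \<exists>g. has_weak_deriv f [\<gamma>, \<beta>, \<alpha>] g \<and> (AE z in lborel. z \<in> S \<longrightarrow> \<bar>g z\<bar> \<le> M)) \<Longrightarrow>
      \<bar>f (\<xi> + s) - f \<xi> - G \<bullet> s - s \<bullet> (H *v (\<xi> - x + s /\<^sub>R 2))\<bar>
        \<le> (CARD('n)) ^ 3 * M * norm s * (norm (\<xi> - x) + norm s)\<^sup>2"
proof -
  let ?\<phi> = mollifier_seq
  have bounded_at_x: "\<exists>M. \<forall>n. \<bar>moll f (?\<phi> n) is x\<bar> \<le> M" if len: "length is \<le> 3" for "is"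
  proof -
    obtain g where g: "has_weak_deriv f is g" "\<And>K. compact K \<Longrightarrow> \<exists>M\<ge>0. AE z in lborel. z \<in> K \<longrightarrow> \<bar>g z\<bar> \<le> M"
      using W_inf_loc_weak_deriv[OF W len] by blast
    then obtain M where "M \<ge> 0" "AE z in lborel. z \<in> cball x 1 \<longrightarrow> \<bar>g z\<bar> \<le> M" by (meson compact_cball)
    then have "\<bar>moll f (?\<phi> n) is x\<bar> \<le> M" for n
      using moll_bound[OF g(1) mollifier_seq mollifier_seq_ball[OF subset_refl]] by blast
    then show ?thesis by blast
  qed
  define w where "w = (\<lambda>n. ((\<chi> \<alpha>. moll f (?\<phi> n) [\<alpha>] x) :: real ^ 'n, (\<chi> \<alpha> \<beta>. moll f (?\<phi> n) [\<beta>, \<alpha>] x) :: real ^ 'n ^ 'n))"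
  have "\<forall>\<alpha>. \<exists>M. \<forall>n. \<bar>moll f (?\<phi> n) [\<alpha>] x\<bar> \<le> M" using bounded_at_x by simp
  then obtain M1 where M1: "\<And>\<alpha> n. \<bar>moll f (?\<phi> n) [\<alpha>] x\<bar> \<le> M1 \<alpha>" by metis
  have "\<forall>\<alpha> \<beta>. \<exists>M. \<forall>n. \<bar>moll f (?\<phi> n) [\<beta>, \<alpha>] x\<bar> \<le> M" using bounded_at_x by simp
  then obtain M2 where M2: "\<And>\<alpha> \<beta> n. \<bar>moll f (?\<phi> n) [\<beta>, \<alpha>] x\<bar> \<le> M2 \<alpha> \<beta>" by metis
  have "bounded (range w)"
  proof (rule boundedI)
    fix p assume "p \<in> range w"
    then obtain n where n: "p = w n" by blast
    have "norm (fst (w n)) \<le> (\<Sum>\<alpha>\<in>UNIV. M1 \<alpha>)"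
      unfolding w_def fst_conv by (rule order_trans[OF norm_le_l1_cart]) (auto intro!: sum_mono M1)
    moreover have "norm (snd (w n)) \<le> (\<Sum>\<alpha>\<in>UNIV. \<Sum>\<beta>\<in>UNIV. M2 \<alpha> \<beta>)"
    proof -
      have "norm (snd (w n)) \<le> (\<Sum>\<alpha>\<in>UNIV. norm (snd (w n) $ \<alpha>))"
        unfolding norm_vec_def by (rule L2_set_le_sum) auto
      also have "\<dots> \<le> (\<Sum>\<alpha>\<in>UNIV. \<Sum>\<beta>\<in>UNIV. M2 \<alpha> \<beta>)"
        unfolding w_def snd_conv
        by (intro sum_mono order_trans[OF norm_le_l1_cart]) (auto intro!: sum_mono M2)
      finally show ?thesis .
    qed
    ultimately show "norm p \<le> (\<Sum>\<alpha>\<in>UNIV. M1 \<alpha>) + (\<Sum>\<alpha>\<in>UNIV. \<Sum>\<beta>\<in>UNIV. M2 \<alpha> \<beta>)"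
      unfolding n using norm_Pair_le[of "fst (w n)" "snd (w n)"] by simp
  qed
  then obtain l r where r: "strict_mono (r :: nat \<Rightarrow> nat)" "(w \<circ> r) \<longlonglongrightarrow> l"
    using bounded_imp_convergent_subsequence by blast
  define G where "G = fst l"
  define H where "H = snd l"
  have limG: "(\<lambda>n. moll f (?\<phi> (r n)) [\<alpha>] x) \<longlonglongrightarrow> G $ \<alpha>" for \<alpha>
    using tendsto_vec_nth[OF tendsto_fst[OF r(2)], of \<alpha>] by (simp add: w_def G_def o_def)
  have limH: "(\<lambda>n. moll f (?\<phi> (r n)) [\<beta>, \<alpha>] x) \<longlonglongrightarrow> H $ \<alpha> $ \<beta>" for \<alpha> \<beta>
    using tendsto_vec_nth[OF tendsto_vec_nth[OF tendsto_snd[OF r(2)], of \<alpha>], of \<beta>] by (simp add: w_def H_def o_def)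
  have limf: "(\<lambda>n. moll f (?\<phi> (r n)) [] p) \<longlonglongrightarrow> f p" for p
  proof -
    have "(\<lambda>n. inverse (real (Suc (r n)))) \<longlonglongrightarrow> 0"
      using LIMSEQ_subseq_LIMSEQ[OF LIMSEQ_inverse_real_of_nat r(1)] by (simp add: o_def)
    then show ?thesis by (intro moll_converges[OF f mollifier_seq])
  qed
  show thesis
  proof (rule that[of G H])
    fix \<xi> s S and M :: real
    assume M: "M \<ge> 0" and S: "\<And>c. c \<in> bond_triangle x \<xi> s \<Longrightarrow> cball c 1 \<subseteq> S"
      and w: "\<And>\<alpha> \<beta>. \<exists>g. has_weak_deriv f [\<beta>, \<alpha>] g \<and> (AE z in lborel. z \<in> S \<longrightarrow> \<bar>g z\<bar> \<le> M)"
    have "\<bar>moll f (?\<phi> n) [\<beta>, \<alpha>] c\<bar> \<le> M" if "c \<in> bond_triangle x \<xi> s" for n c \<alpha> \<beta>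
      using w[of \<beta> \<alpha>] moll_bound[OF _ mollifier_seq mollifier_seq_ball[OF S[OF that]] _ M] by blast
    note est = moll_taylor1[OF f test_function_mollifier_seq M this]
    have "(\<lambda>n. \<bar>moll f (?\<phi> (r n)) [] (\<xi> + s) - moll f (?\<phi> (r n)) [] \<xi> - (\<Sum>\<alpha>\<in>UNIV. s $ \<alpha> * moll f (?\<phi> (r n)) [\<alpha>] x)\<bar>)
        \<longlonglongrightarrow> \<bar>f (\<xi> + s) - f \<xi> - (\<Sum>\<alpha>\<in>UNIV. s $ \<alpha> * G $ \<alpha>)\<bar>"
      by (intro tendsto_intros limf limG)
    from LIMSEQ_le_const2[OF this, of "(CARD('n))\<^sup>2 * M * norm s * (norm (\<xi> - x) + norm s)"] est
    show "\<bar>f (\<xi> + s) - f \<xi> - G \<bullet> s\<bar> \<le> (CARD('n))\<^sup>2 * M * norm s * (norm (\<xi> - x) + norm s)"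
      by (auto simp: inner_vec_def mult.commute)
  next
    fix \<xi> s S and M :: real
    assume M: "M \<ge> 0" and S: "\<And>c. c \<in> bond_triangle x \<xi> s \<Longrightarrow> cball c 1 \<subseteq> S"
      and w: "\<And>\<alpha> \<beta> \<gamma>. \<exists>g. has_weak_deriv f [\<gamma>, \<beta>, \<alpha>] g \<and> (AE z in lborel. z \<in> S \<longrightarrow> \<bar>g z\<bar> \<le> M)"
    have "\<bar>moll f (?\<phi> n) [\<gamma>, \<beta>, \<alpha>] c\<bar> \<le> M" if "c \<in> bond_triangle x \<xi> s" for n c \<alpha> \<beta> \<gamma>
      using w[of \<gamma> \<beta> \<alpha>] moll_bound[OF _ mollifier_seq mollifier_seq_ball[OF S[OF that]] _ M] by blast
    note est = moll_taylor2[OF f test_function_mollifier_seq M this]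
    have "(\<lambda>n. \<bar>moll f (?\<phi> (r n)) [] (\<xi> + s) - moll f (?\<phi> (r n)) [] \<xi> - (\<Sum>\<alpha>\<in>UNIV. s $ \<alpha> * moll f (?\<phi> (r n)) [\<alpha>] x)
        - (\<Sum>\<alpha>\<in>UNIV. s $ \<alpha> * (\<Sum>\<beta>\<in>UNIV. (\<xi> - x + s /\<^sub>R 2) $ \<beta> * moll f (?\<phi> (r n)) [\<beta>, \<alpha>] x))\<bar>)
        \<longlonglongrightarrow> \<bar>f (\<xi> + s) - f \<xi> - (\<Sum>\<alpha>\<in>UNIV. s $ \<alpha> * G $ \<alpha>)
        - (\<Sum>\<alpha>\<in>UNIV. s $ \<alpha> * (\<Sum>\<beta>\<in>UNIV. (\<xi> - x + s /\<^sub>R 2) $ \<beta> * H $ \<alpha> $ \<beta>))\<bar>"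
      by (intro tendsto_intros limf limG limH)
    from LIMSEQ_le_const2[OF this, of "(CARD('n)) ^ 3 * M * norm s * (norm (\<xi> - x) + norm s)\<^sup>2"] est
    show "\<bar>f (\<xi> + s) - f \<xi> - G \<bullet> s - s \<bullet> (H *v (\<xi> - x + s /\<^sub>R 2))\<bar>
        \<le> (CARD('n)) ^ 3 * M * norm s * (norm (\<xi> - x) + norm s)\<^sup>2"
      by (auto simp: inner_vec_def matrix_vector_mult_def mult.commute)
  qed
qed

lemma norm_matrix_vector_mult_le:
  fixes A :: "real ^ 'n ^ 'm"
  shows "norm (A *v v) \<le> norm A * norm v"
proof -
  have "norm (A *v v) \<le> L2_set (\<lambda>i. norm (A $ i) * norm v) UNIV"
    unfolding norm_vec_def[of "A *v v"]
    by (rule L2_set_mono) (auto simp: matrix_vector_mul_component Cauchy_Schwarz_ineq2)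
  also have "\<dots> = norm A * norm v" unfolding norm_vec_def[of A] by (simp add: L2_set_left_distrib)
  finally show ?thesis .
qed

text \<open>Testing the increment of the mollified map against the increment of \<open>u\<close> itself gives the
  Lipschitz constant with the Euclidean norm, without a dimensional factor.\<close>
lemma K_set_lipschitz:
  fixes u :: "real ^ 'n \<Rightarrow> real ^ 'n"
  assumes u: "u \<in> K_set \<kappa>" "continuous_on UNIV u" and \<kappa>: "\<kappa> \<ge> 0"
  shows "norm (u (b + v) - u b) \<le> \<kappa> * norm v"
proof -
  let ?\<phi> = mollifier_seq
  define e where "e = u (b + v) - u b"
  have ui: "continuous_on UNIV (\<lambda>x. u x $ i)" for i using u(2) by (intro continuous_intros)
  have W: "(\<lambda>x. u x $ i) \<in> W_inf_loc 1" for i using u(1) by (simp add: K_set_def)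
  have weak: "has_weak_deriv (\<lambda>x. u x $ i) [\<alpha>] (\<lambda>x. weak_grad u x $ i $ \<alpha>)" for i \<alpha>
    using weak_deriv_W_inf_loc[OF W, of "[\<alpha>]"] by (simp add: weak_grad_def)
  have AE: "AE z in lborel. z \<in> UNIV \<longrightarrow> norm (weak_grad u z) \<le> \<kappa>"
    by (rule Linf_norm_AE) (use u(1) \<kappa> in \<open>auto simp: K_set_def\<close>)
  have le: "\<bar>\<Sum>i\<in>UNIV. e $ i * moll (\<lambda>x. u x $ i) (?\<phi> n) [] (b + v) - e $ i * moll (\<lambda>x. u x $ i) (?\<phi> n) [] b\<bar>
      \<le> \<kappa> * norm v * norm e" for n
  proof -
    let ?m = "\<lambda>i. moll (\<lambda>x. u x $ i) (?\<phi> n)"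
    have "((\<lambda>t. \<Sum>i\<in>UNIV. e $ i * ?m i [] (b + t *\<^sub>R v)) has_real_derivative
        (\<Sum>i\<in>UNIV. e $ i * (\<Sum>\<alpha>\<in>UNIV. v $ \<alpha> * ?m i [\<alpha>] (b + t *\<^sub>R v)))) (at t)" for t
      by (intro DERIV_sum DERIV_cmult moll_along_line ui test_function_mollifier_seq)
    then obtain t where t: "(\<Sum>i\<in>UNIV. e $ i * ?m i [] (b + 1 *\<^sub>R v)) - (\<Sum>i\<in>UNIV. e $ i * ?m i [] (b + 0 *\<^sub>R v))
        = (1 - 0) * (\<Sum>i\<in>UNIV. e $ i * (\<Sum>\<alpha>\<in>UNIV. v $ \<alpha> * ?m i [\<alpha>] (b + t *\<^sub>R v)))"
      by (rule mvt_real[OF zero_less_one])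
    let ?c = "b + t *\<^sub>R v"
    have int: "integrable lborel (\<lambda>z. weak_grad u z $ i $ \<alpha> * ?\<phi> n (z - ?c))" for i \<alpha>
      using integrable_correlate[OF _ test_function_mollifier_seq, of "\<lambda>z. weak_grad u z $ i $ \<alpha>" n "[]" ?c]
        weak[of i \<alpha>] by (simp add: has_weak_deriv_def iter_partial_def)
    have "(\<Sum>i\<in>UNIV. e $ i * (\<Sum>\<alpha>\<in>UNIV. v $ \<alpha> * ?m i [\<alpha>] ?c))
        = (\<Sum>i\<in>UNIV. e $ i * (\<Sum>\<alpha>\<in>UNIV. v $ \<alpha> * correlate (\<lambda>z. weak_grad u z $ i $ \<alpha>) (?\<phi> n) ?c))"
      by (simp add: moll_weak_deriv[OF weak test_function_mollifier_seq])
    also have "\<dots> = (LINT z|lborel. (\<Sum>i\<in>UNIV. e $ i * (\<Sum>\<alpha>\<in>UNIV. v $ \<alpha> * (weak_grad u z $ i $ \<alpha> * ?\<phi> n (z - ?c)))))"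
      unfolding correlate_def using int
      by (simp add: Bochner_Integration.integral_sum Bochner_Integration.integrable_sum)
    also have "\<dots> = correlate (\<lambda>z. e \<bullet> (weak_grad u z *v v)) (?\<phi> n) ?c"
      unfolding correlate_def
      by (simp add: inner_vec_def matrix_vector_mult_def sum_distrib_left sum_distrib_right mult_ac)
    finally have eq: "(\<Sum>i\<in>UNIV. e $ i * (\<Sum>\<alpha>\<in>UNIV. v $ \<alpha> * ?m i [\<alpha>] ?c)) = \<dots>" .
    have "\<bar>correlate (\<lambda>z. e \<bullet> (weak_grad u z *v v)) (?\<phi> n) ?c\<bar> \<le> \<kappa> * norm v * norm e"
    proof (rule correlate_bound[OF mollifier_seq subset_UNIV])
      show "AE z in lborel. z \<in> UNIV \<longrightarrow> \<bar>e \<bullet> (weak_grad u z *v v)\<bar> \<le> \<kappa> * norm v * norm e"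
        using AE
      proof eventually_elim
        case (elim z)
        have "\<bar>e \<bullet> (weak_grad u z *v v)\<bar> \<le> norm e * (norm (weak_grad u z) * norm v)"
          by (rule order_trans[OF Cauchy_Schwarz_ineq2]) (intro mult_left_mono norm_matrix_vector_mult_le norm_ge_zero)
        also have "\<dots> \<le> norm e * (\<kappa> * norm v)" using elim by (intro mult_left_mono mult_right_mono) auto
        finally show ?case by (simp add: mult_ac)
      qed
    qed (use \<kappa> in simp)
    then show ?thesis using t eq by (simp add: sum_subtractf)
  qed
  have "(\<lambda>n. \<bar>\<Sum>i\<in>UNIV. e $ i * moll (\<lambda>x. u x $ i) (?\<phi> n) [] (b + v) - e $ i * moll (\<lambda>x. u x $ i) (?\<phi> n) [] b\<bar>)
      \<longlonglongrightarrow> \<bar>\<Sum>i\<in>UNIV. e $ i * u (b + v) $ i - e $ i * u b $ i\<bar>"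
    by (intro tendsto_intros moll_converges[OF ui mollifier_seq LIMSEQ_inverse_real_of_nat])
  from LIMSEQ_le_const2[OF this, of "\<kappa> * norm v * norm e"] le
  have "\<bar>\<Sum>i\<in>UNIV. e $ i * u (b + v) $ i - e $ i * u b $ i\<bar> \<le> \<kappa> * norm v * norm e" by blast
  moreover have "(\<Sum>i\<in>UNIV. e $ i * u (b + v) $ i - e $ i * u b $ i) = norm e * norm e"
    unfolding power2_eq_square[symmetric] power2_norm_eq_inner by (simp add: e_def inner_vec_def algebra_simps)
  ultimately have "norm e * norm e \<le> \<kappa> * norm v * norm e" by simp
  then have "norm e \<le> \<kappa> * norm v"
    using \<kappa> by (cases "norm e = 0") (auto simp: mult_le_cancel_right)
  then show ?thesis by (simp add: e_def)
qed

lemma derivative_norm_le_lipschitz: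
  fixes u :: "'a::real_normed_vector \<Rightarrow> 'b::real_normed_vector"
  assumes D: "(u has_derivative D) (at x)" and lip: "\<And>v. norm (u (x + v) - u x) \<le> \<kappa> * norm v"
  shows "norm (D v) \<le> \<kappa> * norm v"
proof (cases "v = 0")
  case True
  then show ?thesis using linear_0[OF has_derivative_linear[OF D]] by simp
next
  case False
  show ?thesis
  proof (rule field_le_epsilon)
    fix e :: real assume "e > 0"
    then have e': "e / norm v > 0" using False by simp
    then obtain d where d: "d > 0" "\<And>y. norm (y - x) < d \<Longrightarrow> norm (u y - u x - D (y - x)) \<le> e / norm v * norm (y - x)"
      using D unfolding has_derivative_at_alt by blast
    define c where "c = d / (2 * norm v)"
    have c: "c > 0" "norm (c *\<^sub>R v) < d" using d False by (auto simp: c_def)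
    have "norm (D (c *\<^sub>R v)) \<le> norm (u (x + c *\<^sub>R v) - u x) + norm (u (x + c *\<^sub>R v) - u x - D (c *\<^sub>R v))"
      by (metis add_diff_cancel_left' diff_diff_eq2 norm_triangle_sub norm_minus_commute add.commute diff_add_cancel)
    also have "\<dots> \<le> \<kappa> * norm (c *\<^sub>R v) + e / norm v * norm (c *\<^sub>R v)"
      using lip[of "c *\<^sub>R v"] d(2)[of "x + c *\<^sub>R v"] c by (intro add_mono) auto
    finally have "c * norm (D v) \<le> c * (\<kappa> * norm v + e)"
      using c False linear_cmul[OF has_derivative_linear[OF D], of c v] by (simp add: algebra_simps)
    then show "norm (D v) \<le> \<kappa> * norm v + e" using c by simp
  qed
qed

text \<open>An infinite norm makes the bound trivial, except where its coefficient vanishes.\<close>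
lemma ennreal_le_mult_Linf:
  assumes "c \<ge> 0" "c = 0 \<Longrightarrow> a \<le> 0" "\<And>M. M \<ge> 0 \<Longrightarrow> L \<le> ennreal M \<Longrightarrow> a \<le> c * M"
  shows "ennreal a \<le> ennreal c * L"
proof (cases L)
  case (real M)
  then have "a \<le> c * M" using assms(3) by simp
  then show ?thesis using real assms(1) by (simp add: ennreal_mult[symmetric] ennreal_leI)
next
  case top
  show ?thesis
  proof (cases "c = 0")
    case True
    then show ?thesis using assms(2) by (simp add: ennreal_eq_0_iff)
  next
    case False
    then show ?thesis using top assms(1) by (simp add: ennreal_mult_top ennreal_eq_0_iff)
  qed
qed

lemma norm_vec_le_comp:
  fixes w :: "real ^ 'n" and b :: real
  assumes "\<And>i. \<bar>w $ i\<bar> \<le> b"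
  shows "norm w \<le> CARD('n) * b"
  using order_trans[OF norm_le_l1_cart, of w] sum_bounded_above[of UNIV "\<lambda>i. \<bar>w $ i\<bar>" b] assms by simp

text \<open>The deformation \<open>y\<close> and the displacement \<open>u\<close> differ by a linear map, so they share their
  second and third weak derivatives.\<close>
lemma displacement_taylor:
  fixes u :: "real ^ 'n \<Rightarrow> real ^ 'n" and A :: "real ^ 'n ^ 'n"
  assumes u: "u \<in> W3_inf_dot" "continuous_on UNIV u" and y: "y = (\<lambda>z. A *v z + u z)"
  obtains F :: "real ^ 'n ^ 'n" and B :: "real ^ 'n \<Rightarrow> real ^ 'n \<Rightarrow> real ^ 'n" where
    "(u has_derivative (*v) F) (at x)" "bilinear B"
    "\<And>\<xi> s S. S \<in> sets lborel \<Longrightarrow> (\<And>c. c \<in> bond_triangle x \<xi> s \<Longrightarrow> cball c 1 \<subseteq> S) \<Longrightarrow>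
      ennreal (norm (u (\<xi> + s) - u \<xi> - F *v s))
        \<le> ennreal (CARD('n) ^ 3 * (norm s * (norm (\<xi> - x) + norm s))) * Linf_norm S (weak_grad2 y)"
    "\<And>\<xi> s S. S \<in> sets lborel \<Longrightarrow> (\<And>c. c \<in> bond_triangle x \<xi> s \<Longrightarrow> cball c 1 \<subseteq> S) \<Longrightarrow>
      ennreal (norm (u (\<xi> + s) - u \<xi> - F *v s - B s (\<xi> - x + s /\<^sub>R 2)))
        \<le> ennreal (CARD('n) ^ 4 * (norm s * (norm (\<xi> - x) + norm s)\<^sup>2)) * Linf_norm S (weak_grad3 y)"
proof -
  let ?u = "\<lambda>i x. u x $ i"
  have ui: "continuous_on UNIV (?u i)" for i using u(2) by (intro continuous_intros)
  have W: "?u i \<in> W_inf_loc 3" for i using u(1) by (simp add: W3_inf_dot_def)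
  define P where "P = (\<lambda>i (G :: real ^ 'n) (H :: real ^ 'n ^ 'n).
    (\<forall>\<xi> s S (M :: real). M \<ge> 0 \<longrightarrow> (\<forall>c. c \<in> bond_triangle x \<xi> s \<longrightarrow> cball c 1 \<subseteq> S) \<longrightarrow>
      (\<forall>\<alpha> \<beta>. \<exists>g. has_weak_deriv (?u i) [\<beta>, \<alpha>] g \<and> (AE z in lborel. z \<in> S \<longrightarrow> \<bar>g z\<bar> \<le> M)) \<longrightarrow>
      \<bar>?u i (\<xi> + s) - ?u i \<xi> - G \<bullet> s\<bar> \<le> (CARD('n))\<^sup>2 * M * norm s * (norm (\<xi> - x) + norm s)) \<and>
    (\<forall>\<xi> s S (M :: real). M \<ge> 0 \<longrightarrow> (\<forall>c. c \<in> bond_triangle x \<xi> s \<longrightarrow> cball c 1 \<subseteq> S) \<longrightarrow>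
      (\<forall>\<alpha> \<beta> \<gamma>. \<exists>g. has_weak_deriv (?u i) [\<gamma>, \<beta>, \<alpha>] g \<and> (AE z in lborel. z \<in> S \<longrightarrow> \<bar>g z\<bar> \<le> M)) \<longrightarrow>
      \<bar>?u i (\<xi> + s) - ?u i \<xi> - G \<bullet> s - s \<bullet> (H *v (\<xi> - x + s /\<^sub>R 2))\<bar>
        \<le> (CARD('n)) ^ 3 * M * norm s * (norm (\<xi> - x) + norm s)\<^sup>2))"
  have "\<forall>i. \<exists>G H. P i G H"
  proof
    fix i
    show "\<exists>G H. P i G H"
      by (rule taylor_expansion[OF ui[of i] W[of i], where x = x]) (unfold P_def, blast)
  qed
  then obtain G H where GH: "\<And>i. P i (G i) (H i)" by metis
  note T1 = GH[unfolded P_def, THEN conjunct1, rule_format]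
  note T2 = GH[unfolded P_def, THEN conjunct2, rule_format]
  define F :: "real ^ 'n ^ 'n" where "F = (\<chi> i. G i)"
  define B where "B = (\<lambda>s w. \<chi> i. s \<bullet> (H i *v w))"
  have Fs: "(F *v s) $ i = G i \<bullet> s" for s i by (simp add: F_def matrix_vector_mul_component)
  have weak_y: "has_weak_deriv (?u i) is (weak_deriv (\<lambda>z. y z $ i) is)" if len: "2 \<le> length is" "length is \<le> 3" for i "is"
  proof -
    have y_i: "(\<lambda>z. y z $ i) = (\<lambda>z. A $ i \<bullet> z + ?u i z)"
      by (simp add: y fun_eq_iff matrix_vector_mul_component)
    have "has_weak_deriv (?u i) is (weak_deriv (?u i) is)" using weak_deriv_W_inf_loc[OF W len(2)] .
    then have "has_weak_deriv (\<lambda>z. y z $ i) is (weak_deriv (?u i) is)"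
      unfolding y_i using len(1) by (rule has_weak_deriv_add_linear)
    then have "has_weak_deriv (\<lambda>z. y z $ i) is (weak_deriv (\<lambda>z. y z $ i) is)"
      by (subst weak_deriv_def) (rule someI[where P = "has_weak_deriv (\<lambda>z. y z $ i) is"])
    then have "has_weak_deriv (\<lambda>z. (- A $ i) \<bullet> z + y z $ i) is (weak_deriv (\<lambda>z. y z $ i) is)"
      using len(1) by (rule has_weak_deriv_add_linear)
    moreover have "(\<lambda>z. (- A $ i) \<bullet> z + y z $ i) = ?u i"
      by (simp add: y fun_eq_iff matrix_vector_mul_component)
    ultimately show ?thesis by simp
  qed
  have est2: "ennreal (norm (u (\<xi> + s) - u \<xi> - F *v s))
        \<le> ennreal (CARD('n) ^ 3 * (norm s * (norm (\<xi> - x) + norm s))) * Linf_norm S (weak_grad2 y)"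
    if S: "S \<in> sets lborel" "\<And>c. c \<in> bond_triangle x \<xi> s \<Longrightarrow> cball c 1 \<subseteq> S" for \<xi> s S
  proof (rule ennreal_le_mult_Linf)
    fix M assume M: "M \<ge> 0" "Linf_norm S (weak_grad2 y) \<le> ennreal M"
    have AE: "AE z in lborel. z \<in> S \<longrightarrow> norm (weak_grad2 y z) \<le> M" by (rule Linf_norm_AE[OF S(1) M(2,1)])
    have "\<exists>g. has_weak_deriv (?u i) [\<beta>, \<alpha>] g \<and> (AE z in lborel. z \<in> S \<longrightarrow> \<bar>g z\<bar> \<le> M)" for i \<alpha> \<beta>
    proof (intro exI conjI)
      show "has_weak_deriv (?u i) [\<beta>, \<alpha>] (weak_deriv (\<lambda>z. y z $ i) [\<beta>, \<alpha>])" by (rule weak_y) auto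
      show "AE z in lborel. z \<in> S \<longrightarrow> \<bar>weak_deriv (\<lambda>z. y z $ i) [\<beta>, \<alpha>] z\<bar> \<le> M"
        using AE
      proof eventually_elim
        case (elim z)
        have "\<bar>weak_deriv (\<lambda>z. y z $ i) [\<beta>, \<alpha>] z\<bar> = norm (weak_grad2 y z $ i $ \<beta> $ \<alpha>)" by (simp add: weak_grad2_def)
        also have "\<dots> \<le> norm (weak_grad2 y z)" by (meson Finite_Cartesian_Product.norm_nth_le order_trans)
        finally show ?case using elim by linarith
      qed
    qed
    from T1[OF M(1) S(2) this]
    have "\<bar>(u (\<xi> + s) - u \<xi> - F *v s) $ i\<bar> \<le> (CARD('n))\<^sup>2 * M * norm s * (norm (\<xi> - x) + norm s)" for i
      by (simp add: Fs)
    from norm_vec_le_comp[OF this]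
    show "norm (u (\<xi> + s) - u \<xi> - F *v s) \<le> CARD('n) ^ 3 * (norm s * (norm (\<xi> - x) + norm s)) * M"
      by (simp add: power2_eq_square power3_eq_cube mult_ac)
  qed (auto simp: add_nonneg_eq_0_iff)
  have est3: "ennreal (norm (u (\<xi> + s) - u \<xi> - F *v s - B s (\<xi> - x + s /\<^sub>R 2)))
        \<le> ennreal (CARD('n) ^ 4 * (norm s * (norm (\<xi> - x) + norm s)\<^sup>2)) * Linf_norm S (weak_grad3 y)"
    if S: "S \<in> sets lborel" "\<And>c. c \<in> bond_triangle x \<xi> s \<Longrightarrow> cball c 1 \<subseteq> S" for \<xi> s S
  proof (rule ennreal_le_mult_Linf)
    fix M assume M: "M \<ge> 0" "Linf_norm S (weak_grad3 y) \<le> ennreal M"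
    have AE: "AE z in lborel. z \<in> S \<longrightarrow> norm (weak_grad3 y z) \<le> M" by (rule Linf_norm_AE[OF S(1) M(2,1)])
    have "\<exists>g. has_weak_deriv (?u i) [\<gamma>, \<beta>, \<alpha>] g \<and> (AE z in lborel. z \<in> S \<longrightarrow> \<bar>g z\<bar> \<le> M)" for i \<alpha> \<beta> \<gamma>
    proof (intro exI conjI)
      show "has_weak_deriv (?u i) [\<gamma>, \<beta>, \<alpha>] (weak_deriv (\<lambda>z. y z $ i) [\<gamma>, \<beta>, \<alpha>])" by (rule weak_y) auto
      show "AE z in lborel. z \<in> S \<longrightarrow> \<bar>weak_deriv (\<lambda>z. y z $ i) [\<gamma>, \<beta>, \<alpha>] z\<bar> \<le> M"
        using AE
      proof eventually_elim
        case (elim z)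
        have "\<bar>weak_deriv (\<lambda>z. y z $ i) [\<gamma>, \<beta>, \<alpha>] z\<bar> = norm (weak_grad3 y z $ i $ \<gamma> $ \<beta> $ \<alpha>)" by (simp add: weak_grad3_def)
        also have "\<dots> \<le> norm (weak_grad3 y z)" by (meson Finite_Cartesian_Product.norm_nth_le order_trans)
        finally show ?case using elim by linarith
      qed
    qed
    from T2[OF M(1) S(2) this]
    have "\<bar>(u (\<xi> + s) - u \<xi> - F *v s - B s (\<xi> - x + s /\<^sub>R 2)) $ i\<bar>
        \<le> (CARD('n)) ^ 3 * M * norm s * (norm (\<xi> - x) + norm s)\<^sup>2" for i
      by (simp add: Fs B_def)
    from norm_vec_le_comp[OF this]
    show "norm (u (\<xi> + s) - u \<xi> - F *v s - B s (\<xi> - x + s /\<^sub>R 2))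
        \<le> CARD('n) ^ 4 * (norm s * (norm (\<xi> - x) + norm s)\<^sup>2) * M"
      by (simp add: power4_eq_xxxx power3_eq_cube mult_ac)
  next
    assume "CARD('n) ^ 4 * (norm s * (norm (\<xi> - x) + norm s)\<^sup>2) = (0 :: real)"
    then have s0: "s = 0" by (auto simp: add_nonneg_eq_0_iff)
    have "B 0 w = 0" for w by (simp add: B_def vec_eq_iff)
    then show "norm (u (\<xi> + s) - u \<xi> - F *v s - B s (\<xi> - x + s /\<^sub>R 2)) \<le> 0" unfolding s0 by simp
  qed simp
  have bilin: "bilinear B"
    unfolding bilinear_def B_def
    by (auto intro!: linearI simp: vec_eq_iff inner_add_left inner_add_right matrix_vector_right_distrib matrix_vector_mult_scaleR)
  have deriv: "(u has_derivative (*v) F) (at x)"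
  proof -
    define Q where "Q = (\<lambda>i \<beta> \<alpha> M. M \<ge> 0 \<and> (\<exists>g. has_weak_deriv (?u i) [\<beta>, \<alpha>] g \<and> (AE z in lborel. z \<in> cball x 2 \<longrightarrow> \<bar>g z\<bar> \<le> M)))"
    have "\<exists>M. Q i \<beta> \<alpha> M" for i \<beta> \<alpha>
    proof -
      have "length [\<beta>, \<alpha>] \<le> 3" by simp
      from W_inf_loc_weak_deriv[OF W this] obtain g where g: "has_weak_deriv (?u i) [\<beta>, \<alpha>] g"
        "\<And>K. compact K \<Longrightarrow> \<exists>M\<ge>0. AE z in lborel. z \<in> K \<longrightarrow> \<bar>g z\<bar> \<le> M" by blast
      obtain M where "M \<ge> 0" "AE z in lborel. z \<in> cball x 2 \<longrightarrow> \<bar>g z\<bar> \<le> M" using g(2)[OF compact_cball] by blast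
      then show ?thesis using g(1) unfolding Q_def by blast
    qed
    then have Q: "Q i \<beta> \<alpha> (SOME M. Q i \<beta> \<alpha> M)" for i \<beta> \<alpha> by (rule someI_ex)
    define M where "M = (\<lambda>i \<beta> \<alpha>. SOME M. Q i \<beta> \<alpha> M)"
    have M: "M i \<beta> \<alpha> \<ge> 0" "\<exists>g. has_weak_deriv (?u i) [\<beta>, \<alpha>] g \<and> (AE z in lborel. z \<in> cball x 2 \<longrightarrow> \<bar>g z\<bar> \<le> M i \<beta> \<alpha>)" for i \<beta> \<alpha>
      using Q[of i \<beta> \<alpha>] unfolding M_def Q_def by blast+
    define N where "N = (\<Sum>i\<in>UNIV. \<Sum>\<beta>\<in>UNIV. \<Sum>\<alpha>\<in>UNIV. M i \<beta> \<alpha>)"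
    have N: "M i \<beta> \<alpha> \<le> N" for i \<beta> \<alpha>
    proof -
      have "M i \<beta> \<alpha> \<le> (\<Sum>\<alpha>\<in>UNIV. M i \<beta> \<alpha>)" by (intro member_le_sum) (auto simp: M)
      also have "\<dots> \<le> (\<Sum>\<beta>\<in>UNIV. \<Sum>\<alpha>\<in>UNIV. M i \<beta> \<alpha>)"
        by (rule member_le_sum[of \<beta> UNIV "\<lambda>\<beta>. \<Sum>\<alpha>\<in>UNIV. M i \<beta> \<alpha>"]) (auto simp: M intro: sum_nonneg)
      also have "\<dots> \<le> N" unfolding N_def
        by (rule member_le_sum[of i UNIV "\<lambda>i. \<Sum>\<beta>\<in>UNIV. \<Sum>\<alpha>\<in>UNIV. M i \<beta> \<alpha>"]) (auto simp: M intro!: sum_nonneg)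
      finally show ?thesis .
    qed
    have N0: "N \<ge> 0" unfolding N_def by (intro sum_nonneg) (simp add: M)
    have wd: "\<exists>g. has_weak_deriv (?u i) [\<beta>, \<alpha>] g \<and> (AE z in lborel. z \<in> cball x 2 \<longrightarrow> \<bar>g z\<bar> \<le> N)" for i \<beta> \<alpha>
    proof -
      obtain g where g: "has_weak_deriv (?u i) [\<beta>, \<alpha>] g" "AE z in lborel. z \<in> cball x 2 \<longrightarrow> \<bar>g z\<bar> \<le> M i \<beta> \<alpha>"
        using M(2) by blast
      have "AE z in lborel. z \<in> cball x 2 \<longrightarrow> \<bar>g z\<bar> \<le> N"
        using g(2) by eventually_elim (use N[of i \<beta> \<alpha>] in auto)
      then show ?thesis using g(1) by blast
    qed
    define C where "C = CARD('n) * ((CARD('n))\<^sup>2 * N)"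
    have C: "C \<ge> 0" using N0 by (simp add: C_def)
    have quad: "norm (u (x + s) - u x - F *v s) \<le> C * norm s * norm s" if s: "norm s \<le> 1" for s
    proof -
      have sub: "cball c 1 \<subseteq> cball x 2" if "c \<in> bond_triangle x x s" for c
      proof -
        obtain \<tau> t where c: "c = x + \<tau> *\<^sub>R (x + t *\<^sub>R s - x)" "0 \<le> \<tau>" "\<tau> \<le> 1" "0 \<le> t" "t \<le> 1"
          using \<open>c \<in> _\<close> unfolding bond_triangle_def by blast
        have "\<tau> * (t * norm s) \<le> 1 * (1 * 1)" using c s by (intro mult_mono) auto
        then have "dist x c \<le> 1" using c by (simp add: dist_norm)
        show ?thesis
        proof
          fix z assume "z \<in> cball c 1"
          then show "z \<in> cball x 2" using \<open>dist x c \<le> 1\<close> dist_triangle[of x z c] by simp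
        qed
      qed
      have "\<bar>(u (x + s) - u x - F *v s) $ i\<bar> \<le> (CARD('n))\<^sup>2 * N * norm s * norm s" for i
        using T1[of N x s "cball x 2" i, OF N0 sub wd] by (simp add: Fs)
      from norm_vec_le_comp[OF this] show ?thesis by (simp add: C_def mult_ac)
    qed
    show ?thesis
      unfolding has_derivative_at_alt
    proof (intro conjI allI impI)
      show "bounded_linear ((*v) F)" by (rule matrix_vector_mul_bounded_linear)
      fix e :: real assume e: "e > 0"
      define d where "d = min 1 (e / (C + 1))"
      have d: "d > 0" "d \<le> 1" "C * d \<le> e"
      proof -
        show "d > 0" "d \<le> 1" using e C by (auto simp: d_def)
        have "C * d \<le> (C + 1) * (e / (C + 1))" using C e unfolding d_def by (intro mult_mono) auto
        then show "C * d \<le> e" using C by simp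
      qed
      show "\<exists>d>0. \<forall>z. norm (z - x) < d \<longrightarrow> norm (u z - u x - F *v (z - x)) \<le> e * norm (z - x)"
      proof (intro exI[of _ d] conjI allI impI d(1))
        fix z assume z: "norm (z - x) < d"
        have "norm (u z - u x - F *v (z - x)) \<le> C * norm (z - x) * norm (z - x)"
          using quad[of "z - x"] z d(2) by simp
        also have "\<dots> \<le> (C * d) * norm (z - x)" using C z by (intro mult_right_mono mult_left_mono) auto
        also have "\<dots> \<le> e * norm (z - x)" using d(3) by (intro mult_right_mono) auto
        finally show "norm (u z - u x - F *v (z - x)) \<le> e * norm (z - x)" .
      qed
    qed
  qed
  show thesis by (rule that[OF deriv bilin est2 est3])
qed

section \<open>Families of vectors and the interaction potential\<close>

lemma lattice_nz_uminus: "- \<rho> \<in> lattice_nz \<longleftrightarrow> \<rho> \<in> lattice_nz"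
  by (auto simp: lattice_nz_def lattice_def)

lemma lattice_nz_norm_ge_1:
  assumes "\<rho> \<in> lattice_nz"
  shows "norm \<rho> \<ge> 1"
proof -
  have "\<rho> \<noteq> 0" "\<And>i. \<rho> $ i \<in> \<int>" using assms by (auto simp: lattice_nz_def lattice_def)
  then obtain i where "\<rho> $ i \<noteq> 0" by (auto simp: vec_eq_iff)
  then have "1 \<le> \<bar>\<rho> $ i\<bar>" using Ints_nonzero_abs_ge1 \<open>\<And>i. \<rho> $ i \<in> \<int>\<close> by blast
  then show ?thesis using component_le_norm_cart[of \<rho> i] by linarith
qed

lemma finite_lattice_ball: "finite {\<xi> \<in> lattice. norm (\<xi> :: real ^ 'n) \<le> r}"
proof -
  let ?I = "UNIV \<rightarrow>\<^sub>E {- \<lceil>r\<rceil>..\<lceil>r\<rceil>} :: ('n \<Rightarrow> int) set"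
  have "{\<xi> \<in> lattice. norm (\<xi> :: real ^ 'n) \<le> r} \<subseteq> (\<lambda>f. \<chi> i. real_of_int (f i)) ` ?I"
  proof
    fix \<xi> :: "real ^ 'n" assume \<xi>: "\<xi> \<in> {\<xi> \<in> lattice. norm \<xi> \<le> r}"
    then have int: "real_of_int \<lfloor>\<xi> $ i\<rfloor> = \<xi> $ i" for i by (auto simp: lattice_def elim: Ints_cases)
    have "\<lfloor>\<xi> $ i\<rfloor> \<in> {- \<lceil>r\<rceil>..\<lceil>r\<rceil>}" for i
      using component_le_norm_cart[of \<xi> i] \<xi> by auto linarith+
    then have "(\<lambda>i. \<lfloor>\<xi> $ i\<rfloor>) \<in> ?I" by auto
    then show "\<xi> \<in> (\<lambda>f. \<chi> i. real_of_int (f i)) ` ?I"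
      by (intro image_eqI[where x = "\<lambda>i. \<lfloor>\<xi> $ i\<rfloor>"]) (simp_all add: int vec_eq_iff)
  qed
  moreover have "finite ?I" by (intro finite_PiE) auto
  ultimately show ?thesis by (meson finite_imageI finite_subset)
qed

lemma fam_eqI: "fam g = fam h \<Longrightarrow> g = h"
  by (simp add: fam_inject)

lemma norm_fam_le: "norm (fam g \<rho>) \<le> norm g * norm \<rho>"
proof (cases "\<rho> \<in> lattice_nz")
  case True
  then show ?thesis using fam_le[OF True, of g] lattice_nz_pos[OF True] by (simp add: norm_dfam_def divide_le_eq)
qed (simp add: fam_off)

lemma norm_dfam_le:
  fixes g :: "'n::finite dfam"
  assumes "\<And>\<rho>. \<rho> \<in> lattice_nz \<Longrightarrow> norm (fam g \<rho>) \<le> C * norm \<rho>"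
  shows "norm g \<le> C"
  unfolding norm_dfam_def
  by (rule cSUP_least[OF lattice_nz_nonempty]) (use assms lattice_nz_pos in \<open>auto simp: divide_le_eq\<close>)

lemma fam_dfam_of:
  assumes "\<And>\<rho>. \<rho> \<in> lattice_nz \<Longrightarrow> norm (v \<rho>) \<le> C * norm \<rho>"
  shows "fam (dfam_of v) = (\<lambda>\<rho>. if \<rho> \<in> lattice_nz then v \<rho> else 0)"
  unfolding dfam_of_def
  by (intro Fam_inverse dfam_carrierI[where C = C]) (use assms lattice_nz_pos in \<open>auto simp: divide_le_eq\<close>)

lemma norm_dfam_of_le:
  assumes "\<And>\<rho>. \<rho> \<in> lattice_nz \<Longrightarrow> norm (v \<rho>) \<le> C * norm \<rho>"
  shows "norm (dfam_of v) \<le> C"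
  by (rule norm_dfam_le) (use assms in \<open>simp add: fam_dfam_of[OF assms]\<close>)

lemma fam_diff_family:
  assumes "\<And>b v. norm (u (b + v) - u b) \<le> \<kappa> * norm v"
  shows "fam (diff_family u \<xi>) = (\<lambda>\<rho>. if \<rho> \<in> lattice_nz then u (\<xi> + \<rho>) - u \<xi> else 0)"
  unfolding diff_family_def by (rule fam_dfam_of) (rule assms)

lemma norm_diff_family_le:
  assumes "\<And>b v. norm (u (b + v) - u b) \<le> \<kappa> * norm v"
  shows "norm (diff_family u \<xi>) \<le> \<kappa>"
  unfolding diff_family_def by (rule norm_dfam_of_le) (rule assms)

lemma fam_linear_family: "fam (linear_family F) = (\<lambda>\<rho>. if \<rho> \<in> lattice_nz then F *v \<rho> else 0)"
  unfolding linear_family_def by (rule fam_dfam_of) (rule norm_matrix_vector_mult_le)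

lemma bounded_linear_linear_family: "bounded_linear linear_family"
proof (rule bounded_linear_intro[where K = 1])
  fix F G :: "real ^ 'n ^ 'n" and c :: real
  show "linear_family (F + G) = linear_family F + linear_family G"
    by (rule fam_eqI) (auto simp: fam_linear_family fam_plus fun_eq_iff matrix_vector_mult_add_rdistrib)
  show "linear_family (c *\<^sub>R F) = c *\<^sub>R linear_family F"
    by (rule fam_eqI) (auto simp: fam_linear_family fam_scaleR fun_eq_iff scaleR_matrix_vector_assoc)
  have "norm (linear_family F) \<le> norm F"
    unfolding linear_family_def by (rule norm_dfam_of_le) (rule norm_matrix_vector_mult_le)
  then show "norm (linear_family F) \<le> norm F * 1" by simp
qed

lemma fam_single_family: "\<rho> \<in> lattice_nz \<Longrightarrow> fam (single_family \<rho> v) = (\<lambda>\<sigma>. if \<sigma> = \<rho> then v else 0)"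
  unfolding single_family_def
  by (subst fam_dfam_of[where C = "norm v / norm \<rho>"]) (auto simp: fun_eq_iff lattice_nz_pos dest: lattice_nz_pos)

lemma single_family_scaleR: "\<rho> \<in> lattice_nz \<Longrightarrow> single_family \<rho> (c *\<^sub>R v) = c *\<^sub>R single_family \<rho> v"
  by (rule fam_eqI) (auto simp: fam_single_family fam_scaleR)

lemma fam_reflect_family: "fam (reflect_family g) = (\<lambda>\<rho>. - fam g (- \<rho>))"
proof -
  have "norm (- fam g (- \<rho>)) \<le> norm g * norm \<rho>" for \<rho> using norm_fam_le[of g "- \<rho>"] by simp
  then show ?thesis unfolding reflect_family_def
    by (subst fam_dfam_of) (auto simp: fun_eq_iff fam_off lattice_nz_uminus)
qed

lemma norm_reflect_family_le: "norm (reflect_family g) \<le> norm g"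
  by (rule norm_dfam_le) (metis fam_reflect_family norm_fam_le norm_minus_cancel)

lemma bounded_linear_reflect_family: "bounded_linear reflect_family"
proof (rule bounded_linear_intro[where K = 1])
  show "norm (reflect_family g) \<le> norm g * 1" for g :: "'n::finite dfam" using norm_reflect_family_le by simp
qed (rule fam_eqI; auto simp: fam_reflect_family fam_plus fam_scaleR)+

lemma reflect_single_family: "\<rho> \<in> lattice_nz \<Longrightarrow> reflect_family (single_family \<rho> v) = single_family (- \<rho>) (- v)"
  by (rule fam_eqI) (auto simp: fam_reflect_family fam_single_family lattice_nz_uminus fun_eq_iff)

lemma reflect_linear_family: "reflect_family (linear_family F) = linear_family F"
  by (rule fam_eqI) (auto simp: fam_reflect_family fam_linear_family lattice_nz_uminus fun_eq_iff linear_neg[OF matrix_vector_mul_linear])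

locale potential =
  fixes k :: nat and \<kappa> :: real and V :: "'n::finite dfam \<Rightarrow> ereal"
  assumes k: "k \<ge> 3" and \<kappa>: "\<kappa> > 0" and admissible: "admissible_potential k \<kappa> V"

sublocale potential \<subseteq> smooth_on_ball k \<kappa> "\<lambda>g. real_of_ereal (V g)"
  by unfold_locales (use \<kappa> admissible in \<open>auto simp: admissible_potential_def\<close>)

context potential
begin

lemma V_partial_eq: "V_partial \<kappa> V \<rho>s g vs = D (map2 single_family \<rho>s vs) g"
  by (simp add: V_partial_def V_deriv_def)

lemma deriv_has_sum:
  assumes "j \<in> {1..3}" "g \<in> S" "length hs = j"
  shows "((\<lambda>\<rho>s. V_partial \<kappa> V \<rho>s g (map2 fam hs \<rho>s)) has_sum D hs g) (lattice_tuples j)"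
  using admissible assms k unfolding admissible_potential_def V_deriv_def by auto

lemma m_weight_summable: "j \<in> {1..3} \<Longrightarrow> (\<Sum>\<^sub>\<infinity>\<rho>s\<in>lattice_tuples j. m_weight \<kappa> V \<rho>s) < \<infinity>"
  using admissible k unfolding admissible_potential_def by auto

lemma map2_single_scale:
  "length cs = length vs \<Longrightarrow> length \<rho>s = length vs \<Longrightarrow> set \<rho>s \<subseteq> lattice_nz \<Longrightarrow>
    map2 single_family \<rho>s (map2 (*\<^sub>R) cs vs) = map2 (*\<^sub>R) cs (map2 single_family \<rho>s vs)"
  by (rule nth_equalityI) (auto simp: single_family_scaleR subset_iff)

lemma V_partial_scale:
  assumes "\<rho>s \<in> lattice_tuples j" "j \<le> k" "length cs = j" "length vs = j" "g \<in> S"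
  shows "V_partial \<kappa> V \<rho>s g (map2 (*\<^sub>R) cs vs) = prod_list cs * V_partial \<kappa> V \<rho>s g vs"
  using assms deriv_scale[of cs "map2 single_family \<rho>s vs" g]
  by (simp add: V_partial_eq map2_single_scale lattice_tuples_def)

text \<open>The norm of a form is a supremum of values without absolute values; changing the sign of one
  argument supplies them.\<close>
lemma V_partial_le_form_norm:
  assumes \<rho>s: "\<rho>s \<in> lattice_tuples j" and j: "1 \<le> j" "j \<le> k" and vs: "length vs = j" "\<And>v. v \<in> set vs \<Longrightarrow> norm v = 1"
    and g: "g \<in> S"
  shows "ennreal \<bar>V_partial \<kappa> V \<rho>s g vs\<bar> \<le> form_norm j (V_partial \<kappa> V \<rho>s g)"
proof -
  have le: "ennreal (V_partial \<kappa> V \<rho>s g ws) \<le> form_norm j (V_partial \<kappa> V \<rho>s g)"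
    if "length ws = j" "\<And>v. v \<in> set ws \<Longrightarrow> norm v = 1" for ws
    unfolding form_norm_def by (rule SUP_upper) (use that in auto)
  show ?thesis
  proof (cases "V_partial \<kappa> V \<rho>s g vs \<ge> 0")
    case True
    then show ?thesis using le[OF vs] by simp
  next
    case False
    obtain w ws where w: "vs = w # ws" using vs j by (cases vs) auto
    have eq: "map2 (*\<^sub>R) (- 1 # replicate (length ws) 1) (w # ws) = (- w) # ws"
      by (simp, rule nth_equalityI) auto
    have "V_partial \<kappa> V \<rho>s g ((- w) # ws) = - V_partial \<kappa> V \<rho>s g vs"
      using V_partial_scale[OF \<rho>s j(2), of "- 1 # replicate (length ws) 1" "w # ws" g] vs g unfolding eq w by simp
    moreover have "ennreal (V_partial \<kappa> V \<rho>s g ((- w) # ws)) \<le> form_norm j (V_partial \<kappa> V \<rho>s g)"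
      by (rule le) (use vs w in auto)
    ultimately show ?thesis using False by simp
  qed
qed

lemma V_partial_bound:
  assumes \<rho>s: "\<rho>s \<in> lattice_tuples j" and j: "1 \<le> j" "j \<le> k" and vs: "length vs = j" and g: "g \<in> S"
  shows "ennreal ((\<Prod>\<rho>\<leftarrow>\<rho>s. norm \<rho>) * \<bar>V_partial \<kappa> V \<rho>s g vs\<bar>) \<le> m_weight \<kappa> V \<rho>s * ennreal (\<Prod>v\<leftarrow>vs. norm v)"
proof -
  define e where "e = (\<lambda>v :: real ^ 'n. if v = 0 then axis undefined 1 else v /\<^sub>R norm v)"
  have e: "norm (e v) = 1" "norm v *\<^sub>R e v = v" for v by (auto simp: e_def)
  have "map2 (*\<^sub>R) (map norm vs) (map e vs) = vs"
    by (rule nth_equalityI) (auto simp: e)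
  then have eq: "V_partial \<kappa> V \<rho>s g vs = prod_list (map norm vs) * V_partial \<kappa> V \<rho>s g (map e vs)"
    using V_partial_scale[OF \<rho>s j(2), of "map norm vs" "map e vs" g] vs g by simp
  have nn: "prod_list (map norm xs) \<ge> 0" for xs :: "(real ^ 'n) list" by (induction xs) auto
  have "ennreal \<bar>V_partial \<kappa> V \<rho>s g (map e vs)\<bar> \<le> form_norm j (V_partial \<kappa> V \<rho>s g)"
    by (rule V_partial_le_form_norm[OF \<rho>s j]) (use vs e g in auto)
  also have "\<dots> \<le> (SUP g\<in>S. form_norm (length \<rho>s) (V_partial \<kappa> V \<rho>s g))"
    using g \<rho>s by (intro SUP_upper2[of g]) (auto simp: lattice_tuples_def)
  finally have le: "ennreal \<bar>V_partial \<kappa> V \<rho>s g (map e vs)\<bar> \<le> \<dots>" .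
  have "ennreal ((\<Prod>\<rho>\<leftarrow>\<rho>s. norm \<rho>) * \<bar>V_partial \<kappa> V \<rho>s g vs\<bar>)
      = ennreal (\<Prod>\<rho>\<leftarrow>\<rho>s. norm \<rho>) * ennreal \<bar>V_partial \<kappa> V \<rho>s g (map e vs)\<bar> * ennreal (\<Prod>v\<leftarrow>vs. norm v)"
    unfolding eq abs_mult using nn by (simp add: ennreal_mult' mult_ac)
  also have "\<dots> \<le> ennreal (\<Prod>\<rho>\<leftarrow>\<rho>s. norm \<rho>) * (SUP g\<in>S. form_norm (length \<rho>s) (V_partial \<kappa> V \<rho>s g)) * ennreal (\<Prod>v\<leftarrow>vs. norm v)"
    using le by (intro mult_right_mono mult_left_mono) auto
  finally show ?thesis unfolding m_weight_def .
qed

lemma V_partial_zero: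
  assumes "\<rho>s \<in> lattice_tuples j" "j \<le> k" "length vs = j" "0 \<in> set vs" "g \<in> S"
  shows "V_partial \<kappa> V \<rho>s g vs = 0"
proof -
  have "map2 (*\<^sub>R) (map (\<lambda>v. if v = 0 then 0 else 1) vs) vs = vs"
    by (rule nth_equalityI) auto
  moreover have "prod_list (map (\<lambda>v. if v = 0 then 0 else 1) vs) = (0 :: real)"
    using assms(4) by (induction vs) auto
  ultimately show ?thesis using V_partial_scale[of \<rho>s j "map (\<lambda>v. if v = 0 then 0 else 1) vs" vs g] assms by simp
qed

text \<open>Point symmetry of the potential: reflecting both bonds reproduces the second derivative at a
  homogeneous deformation. This cancels the second-order terms of the Taylor expansion.\<close>
lemma V_partial_reflect:
  assumes "\<sigma> \<in> lattice_nz" "\<rho> \<in> lattice_nz" "linear_family F \<in> S"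
  shows "V_partial \<kappa> V [- \<sigma>, - \<rho>] (linear_family F) [v, w] = V_partial \<kappa> V [\<sigma>, \<rho>] (linear_family F) [v, w]"
proof -
  let ?g = "linear_family F"
  have m: "- \<sigma> \<in> lattice_nz" "- \<rho> \<in> lattice_nz" using assms by (auto simp: lattice_nz_uminus)
  have "D (map reflect_family [single_family \<sigma> v, single_family \<rho> w]) (reflect_family ?g) = D [single_family \<sigma> v, single_family \<rho> w] ?g"
  proof (rule deriv_symmetry[OF bounded_linear_reflect_family])
    show "reflect_family ` S \<subseteq> S" by (auto intro: order_trans[OF norm_reflect_family_le])
    show "real_of_ereal (V (reflect_family g)) = real_of_ereal (V g)" for g
      using admissible by (simp add: admissible_potential_def)
  qed (use k assms in auto)
  then have "V_partial \<kappa> V [- \<sigma>, - \<rho>] ?g [- v, - w] = V_partial \<kappa> V [\<sigma>, \<rho>] ?g [v, w]"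
    using assms by (simp add: V_partial_eq reflect_linear_family reflect_single_family)
  moreover have "V_partial \<kappa> V [- \<sigma>, - \<rho>] ?g (map2 (*\<^sub>R) [- 1, - 1] [v, w]) = prod_list [- 1, - 1] * V_partial \<kappa> V [- \<sigma>, - \<rho>] ?g [v, w]"
    by (rule V_partial_scale[where j = 2]) (use k m assms in \<open>auto simp: lattice_tuples_def\<close>)
  ultimately show ?thesis by simp
qed

end

section \<open>Sums of extended nonnegative reals\<close>

lemma infsum_ennreal_le_iff:
  fixes f :: "'a \<Rightarrow> ennreal"
  shows "infsum f A \<le> c \<longleftrightarrow> (\<forall>F. finite F \<and> F \<subseteq> A \<longrightarrow> sum f F \<le> c)"
  by (subst nonneg_infsum_complete) (auto simp: SUP_le_iff)

lemma sum_le_infsum_ennreal: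
  fixes f :: "'a \<Rightarrow> ennreal"
  shows "finite F \<Longrightarrow> F \<subseteq> A \<Longrightarrow> sum f F \<le> infsum f A"
  using infsum_ennreal_le_iff by blast

lemma infsum_ennreal_mono:
  fixes f g :: "'a \<Rightarrow> ennreal"
  assumes "\<And>x. x \<in> A \<Longrightarrow> f x \<le> g x"
  shows "infsum f A \<le> infsum g A"
  unfolding infsum_ennreal_le_iff
proof (intro allI impI)
  fix F assume F: "finite F \<and> F \<subseteq> A"
  then have "sum f F \<le> sum g F" using assms by (intro sum_mono) blast
  also have "\<dots> \<le> infsum g A" using F sum_le_infsum_ennreal by blast
  finally show "sum f F \<le> infsum g A" .
qed

lemma infsum_ennreal_cmult_le:
  fixes f :: "'a \<Rightarrow> ennreal"
  shows "(\<Sum>\<^sub>\<infinity>x\<in>A. c * f x) \<le> c * infsum f A"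
  unfolding infsum_ennreal_le_iff
  by (auto simp: sum_distrib_left[symmetric] intro!: mult_left_mono sum_le_infsum_ennreal)

lemma infsum_ennreal_reindex:
  fixes f :: "'b \<Rightarrow> ennreal"
  assumes "inj_on h A"
  shows "infsum f (h ` A) = (\<Sum>\<^sub>\<infinity>x\<in>A. f (h x))"
  using infsum_reindex[OF assms, of f] by (simp add: o_def)

lemma infsum_ennreal_sum:
  fixes g :: "'a \<Rightarrow> 'b \<Rightarrow> ennreal"
  shows "finite F \<Longrightarrow> (\<Sum>a\<in>F. infsum (g a) B) = (\<Sum>\<^sub>\<infinity>b\<in>B. \<Sum>a\<in>F. g a b)"
  by (induction rule: finite_induct) (simp_all add: infsum_add nonneg_summable_on_complete)

text \<open>Summing over the fibres of a map counts every term at most once.\<close>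
lemma infsum_ennreal_fibres:
  fixes f :: "'b \<Rightarrow> ennreal"
  shows "(\<Sum>\<^sub>\<infinity>a\<in>A. \<Sum>\<^sub>\<infinity>b\<in>B. if h b = a then f b else 0) \<le> infsum f B"
  unfolding infsum_ennreal_le_iff
proof (intro allI impI)
  fix F assume F: "finite F \<and> F \<subseteq> A"
  have "(\<Sum>a\<in>F. \<Sum>\<^sub>\<infinity>b\<in>B. if h b = a then f b else 0) = (\<Sum>\<^sub>\<infinity>b\<in>B. \<Sum>a\<in>F. if h b = a then f b else 0)"
    using F by (intro infsum_ennreal_sum) auto
  also have "\<dots> \<le> infsum f B"
    using F by (intro infsum_ennreal_mono) (auto simp: sum.delta')
  finally show "(\<Sum>a\<in>F. \<Sum>\<^sub>\<infinity>b\<in>B. if h b = a then f b else 0) \<le> infsum f B" .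
qed

lemma ennreal_abs_has_sum_le:
  fixes f :: "'a \<Rightarrow> real"
  assumes "(f has_sum s) A"
  shows "ennreal \<bar>s\<bar> \<le> (\<Sum>\<^sub>\<infinity>x\<in>A. ennreal \<bar>f x\<bar>)"
proof -
  have abs: "(\<lambda>x. \<bar>f x\<bar>) summable_on A"
    using assms has_sum_imp_summable summable_on_iff_abs_summable_on_real[of f A] by auto
  have "\<bar>s\<bar> \<le> (\<Sum>\<^sub>\<infinity>x\<in>A. \<bar>f x\<bar>)"
    using norm_infsum_bound[of f A] abs infsumI[OF assms] by simp
  then have "ennreal \<bar>s\<bar> \<le> ennreal (\<Sum>\<^sub>\<infinity>x\<in>A. \<bar>f x\<bar>)" by (rule ennreal_leI)
  also have "\<dots> = (SUP F\<in>{F. finite F \<and> F \<subseteq> A}. ennreal (\<Sum>x\<in>F. \<bar>f x\<bar>))"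
    using abs by (intro infsum_nonneg_is_SUPREMUM_ennreal) auto
  also have "\<dots> \<le> (\<Sum>\<^sub>\<infinity>x\<in>A. ennreal \<bar>f x\<bar>)"
    by (auto simp: SUP_le_iff sum_ennreal[symmetric] simp del: sum_ennreal intro!: sum_le_infsum_ennreal)
  finally show ?thesis .
qed

lemma summable_on_if_ennreal_finite:
  fixes f :: "'a \<Rightarrow> real"
  assumes "(\<Sum>\<^sub>\<infinity>x\<in>A. ennreal \<bar>f x\<bar>) < \<infinity>"
  shows "f summable_on A"
proof -
  obtain M where M: "M \<ge> 0" "(\<Sum>\<^sub>\<infinity>x\<in>A. ennreal \<bar>f x\<bar>) = ennreal M"
    using assms by (cases "\<Sum>\<^sub>\<infinity>x\<in>A. ennreal \<bar>f x\<bar>") auto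
  have "(\<Sum>x\<in>F. \<bar>f x\<bar>) \<le> M" if "finite F" "F \<subseteq> A" for F
  proof -
    have "ennreal (\<Sum>x\<in>F. \<bar>f x\<bar>) \<le> ennreal M"
      using sum_le_infsum_ennreal[OF that, of "\<lambda>x. ennreal \<bar>f x\<bar>"] M(2) by simp
    then show ?thesis using M(1) by simp
  qed
  then have "bdd_above (sum (\<lambda>x. norm (f x)) ` {F. F \<subseteq> A \<and> finite F})" by (auto intro!: bdd_aboveI2[where M = M])
  then show ?thesis
    using abs_summable_iff_bdd_above[THEN iffD2] summable_on_iff_abs_summable_on_real[THEN iffD2] by blast
qed

section \<open>Bond weights\<close>

lemma has_sum_finite_support:
  fixes f :: "'a \<Rightarrow> real"
  assumes "(f has_sum s) A" "finite N" "N \<subseteq> A" "\<And>x. x \<in> A - N \<Longrightarrow> f x = 0"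
  shows "s = sum f N"
proof -
  have "(f has_sum s) N"
    using assms has_sum_cong_neutral[of N A f f s] by auto
  then show ?thesis using has_sum_finite[OF assms(2)] has_sum_unique by blast
qed

locale bond_weights =
  fixes \<zeta> :: "real ^ 'n \<Rightarrow> real" and R :: real
  assumes cont: "continuous_on UNIV \<zeta>" and nonneg: "\<zeta> z \<ge> 0" and R: "R > 0"
    and support: "norm z > R \<Longrightarrow> \<zeta> z = 0" and even: "\<zeta> (- z) = \<zeta> z"
    and reproduce: "((\<lambda>\<xi>. (a + b \<bullet> \<xi>) * \<zeta> (z - \<xi>)) has_sum (a + b \<bullet> z)) lattice"
begin

lemma bond_weight_nonneg: "bond_weight \<zeta> \<xi> \<rho> x \<ge> 0"
  unfolding bond_weight_def
  by (intro integral_nonneg integrable_continuous_real continuous_on_compose2[OF cont _ subset_UNIV])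
    (auto intro!: continuous_intros nonneg)

lemma bond_weight_nonzero:
  assumes "bond_weight \<zeta> \<xi> \<rho> x \<noteq> 0"
  obtains t where "0 \<le> t" "t \<le> 1" "norm (\<xi> + t *\<^sub>R \<rho> - x) \<le> R"
proof -
  have "\<exists>t\<in>{0..1}. \<zeta> (\<xi> + t *\<^sub>R \<rho> - x) \<noteq> 0"
  proof (rule ccontr)
    assume "\<not> ?thesis"
    then have "bond_weight \<zeta> \<xi> \<rho> x = integral {0..1} (\<lambda>t :: real. 0 :: real)"
      unfolding bond_weight_def by (intro Henstock_Kurzweil_Integration.integral_cong) auto
    then show False using assms by simp
  qed
  then show thesis using that support by (meson atLeastAtMost_iff not_le)
qed

lemma bond_weight_dist:
  assumes "bond_weight \<zeta> \<xi> \<rho> x \<noteq> 0"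
  shows "norm (\<xi> - x) \<le> norm \<rho> + R"
proof -
  obtain t where t: "0 \<le> t" "t \<le> 1" "norm (\<xi> + t *\<^sub>R \<rho> - x) \<le> R" using bond_weight_nonzero[OF assms] .
  have "norm (\<xi> - x) \<le> norm (\<xi> + t *\<^sub>R \<rho> - x) + norm (t *\<^sub>R \<rho>)"
    using norm_triangle_ineq4[of "\<xi> + t *\<^sub>R \<rho> - x" "t *\<^sub>R \<rho>"] by (simp add: algebra_simps)
  moreover have "norm (t *\<^sub>R \<rho>) \<le> norm \<rho>" using t by (simp add: mult_left_le_one_le)
  ultimately show ?thesis using t by linarith
qed

definition sites :: "real ^ 'n \<Rightarrow> real ^ 'n \<Rightarrow> (real ^ 'n) set" where
  "sites x \<rho> = {\<xi> \<in> lattice. norm \<xi> \<le> norm x + norm \<rho> + R}"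

lemma finite_sites: "finite (sites x \<rho>)"
  unfolding sites_def by (rule finite_lattice_ball)

lemma sites_lattice: "sites x \<rho> \<subseteq> lattice"
  by (auto simp: sites_def)

lemma bond_weight_off_sites: "\<xi> \<in> lattice - sites x \<rho> \<Longrightarrow> bond_weight \<zeta> \<xi> \<rho> x = 0"
  using bond_weight_dist[of \<xi> \<rho> x] norm_triangle_sub[of \<xi> x] by (force simp: sites_def)

text \<open>Averaging the reproduction of affine functions over the bond places the barycentre of the
  sites at the midpoint of the reversed bond from \<open>x\<close>.\<close>
lemma bond_weight_affine:
  "(\<Sum>\<xi>\<in>sites x \<rho>. bond_weight \<zeta> \<xi> \<rho> x * (a + b \<bullet> \<xi>)) = a + b \<bullet> x - (b \<bullet> \<rho>) / 2"
proof -
  have int: "(\<lambda>t. (a + b \<bullet> \<xi>) * \<zeta> (\<xi> + t *\<^sub>R \<rho> - x)) integrable_on {0..1}" for \<xi>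
    by (intro integrable_continuous_real continuous_on_mult continuous_on_const continuous_on_compose2[OF cont _ subset_UNIV])
      (auto intro!: continuous_intros)
  have pt: "(\<Sum>\<xi>\<in>sites x \<rho>. (a + b \<bullet> \<xi>) * \<zeta> (\<xi> + t *\<^sub>R \<rho> - x)) = a + b \<bullet> x - t * (b \<bullet> \<rho>)" if t: "t \<in> {0..1}" for t
  proof -
    have z: "\<zeta> (\<xi> + t *\<^sub>R \<rho> - x) = \<zeta> ((x - t *\<^sub>R \<rho>) - \<xi>)" for \<xi>
      using even[of "\<xi> + t *\<^sub>R \<rho> - x"] by (simp add: algebra_simps)
    have far: "\<zeta> ((x - t *\<^sub>R \<rho>) - \<xi>) = 0" if "\<xi> \<in> lattice - sites x \<rho>" for \<xi>
    proof (rule support)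
      have "norm (x - t *\<^sub>R \<rho>) \<le> norm x + norm \<rho>"
        using norm_triangle_ineq4[of x "t *\<^sub>R \<rho>"] t mult_left_le_one_le[of "norm \<rho>" t] by simp
      moreover have "norm \<xi> > norm x + norm \<rho> + R" using that by (auto simp: sites_def)
      ultimately show "R < norm (x - t *\<^sub>R \<rho> - \<xi>)"
        using norm_triangle_ineq2[of \<xi> "x - t *\<^sub>R \<rho>"] norm_minus_commute[of \<xi> "x - t *\<^sub>R \<rho>"] by linarith
    qed
    have "a + b \<bullet> (x - t *\<^sub>R \<rho>) = (\<Sum>\<xi>\<in>sites x \<rho>. (a + b \<bullet> \<xi>) * \<zeta> ((x - t *\<^sub>R \<rho>) - \<xi>))"
      by (rule has_sum_finite_support[OF reproduce finite_sites sites_lattice]) (simp add: far)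
    then show ?thesis by (simp add: z inner_diff_right)
  qed
  have "(\<Sum>\<xi>\<in>sites x \<rho>. bond_weight \<zeta> \<xi> \<rho> x * (a + b \<bullet> \<xi>))
      = (\<Sum>\<xi>\<in>sites x \<rho>. integral {0..1} (\<lambda>t. (a + b \<bullet> \<xi>) * \<zeta> (\<xi> + t *\<^sub>R \<rho> - x)))"
    by (simp add: bond_weight_def mult.commute)
  also have "\<dots> = integral {0..1} (\<lambda>t. \<Sum>\<xi>\<in>sites x \<rho>. (a + b \<bullet> \<xi>) * \<zeta> (\<xi> + t *\<^sub>R \<rho> - x))"
    using int finite_sites by (intro Henstock_Kurzweil_Integration.integral_sum[symmetric]) auto
  also have "\<dots> = integral {0..1} (\<lambda>t. a + b \<bullet> x - t * (b \<bullet> \<rho>))"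
    using pt by (intro Henstock_Kurzweil_Integration.integral_cong) auto
  also have "\<dots> = a + b \<bullet> x - (b \<bullet> \<rho>) / 2"
  proof (rule integral_unique)
    have "((\<lambda>t. a + b \<bullet> x - t * (b \<bullet> \<rho>)) has_integral
        ((1 * (a + b \<bullet> x) - 1\<^sup>2 / 2 * (b \<bullet> \<rho>)) - (0 * (a + b \<bullet> x) - 0\<^sup>2 / 2 * (b \<bullet> \<rho>)))) {0..1}"
      by (rule fundamental_theorem_of_calculus)
        (auto simp flip: has_real_derivative_iff_has_vector_derivative intro!: derivative_eq_intros)
    then show "((\<lambda>t. a + b \<bullet> x - t * (b \<bullet> \<rho>)) has_integral a + b \<bullet> x - (b \<bullet> \<rho>) / 2) {0..1}" by simp
  qed
  finally show ?thesis .
qed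

lemma bond_weight_sum: "(\<Sum>\<xi>\<in>sites x \<rho>. bond_weight \<zeta> \<xi> \<rho> x) = 1"
  using bond_weight_affine[where x = x and \<rho> = \<rho> and a = 1 and b = 0] by simp

lemma bond_weight_mean: "(\<Sum>\<xi>\<in>sites x \<rho>. bond_weight \<zeta> \<xi> \<rho> x *\<^sub>R \<xi>) = x - \<rho> /\<^sub>R 2"
proof -
  have "(\<Sum>\<xi>\<in>sites x \<rho>. bond_weight \<zeta> \<xi> \<rho> x * \<xi> $ i) = x $ i - \<rho> $ i / 2" for i
    using bond_weight_affine[where x = x and \<rho> = \<rho> and a = 0 and b = "axis i 1"] by (simp add: inner_axis' )
  then show ?thesis by (simp add: vec_eq_iff)
qed

text \<open>A site of nonzero weight is \<open>\<xi> = x - t \<rho> + z\<close> with \<open>0 \<le> t \<le> 1\<close> and \<open>|z| \<le> R\<close>; moving from the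
  bond towards \<open>x\<close> only shrinks the coefficients of \<open>\<rho>\<close> and \<open>\<sigma>\<close> and the vector \<open>z\<close>.\<close>
lemma triangle_in_region:
  assumes "bond_weight \<zeta> \<xi> \<rho> x \<noteq> 0" "c \<in> bond_triangle x \<xi> \<sigma>"
  shows "cball c 1 \<subseteq> (+) x ` region (R + 1) \<rho> \<sigma>"
proof
  fix p assume p: "p \<in> cball c 1"
  obtain t where t: "0 \<le> t" "t \<le> 1" "norm (\<xi> + t *\<^sub>R \<rho> - x) \<le> R" using bond_weight_nonzero[OF assms(1)] .
  obtain \<tau> s where c: "c = x + \<tau> *\<^sub>R (\<xi> + s *\<^sub>R \<sigma> - x)" "0 \<le> \<tau>" "\<tau> \<le> 1" "0 \<le> s" "s \<le> 1"
    using assms(2) unfolding bond_triangle_def by blast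
  define z where "z = \<tau> *\<^sub>R (\<xi> + t *\<^sub>R \<rho> - x) + (p - c)"
  have "norm z \<le> \<tau> * norm (\<xi> + t *\<^sub>R \<rho> - x) + norm (p - c)"
    unfolding z_def using c norm_triangle_ineq[of "\<tau> *\<^sub>R (\<xi> + t *\<^sub>R \<rho> - x)" "p - c"] by simp
  also have "\<dots> \<le> 1 * R + 1" using p c t by (intro add_mono mult_mono) (auto simp: dist_norm norm_minus_commute)
  finally have "(- (\<tau> * t)) *\<^sub>R \<rho> + (\<tau> * s) *\<^sub>R \<sigma> + z \<in> region (R + 1) \<rho> \<sigma>"
    using t c by (intro regionI) (auto simp: abs_mult mult_le_one)
  moreover have "p = x + ((- (\<tau> * t)) *\<^sub>R \<rho> + (\<tau> * s) *\<^sub>R \<sigma> + z)"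
    unfolding z_def c(1) by (simp add: algebra_simps)
  ultimately show "p \<in> (+) x ` region (R + 1) \<rho> \<sigma>" by blast
qed

lemma region_shift_measurable: "(+) x ` region r \<rho> \<sigma> \<in> sets lborel"
  using borel_compact[OF compact_translation[OF compact_region]] by simp

end

section \<open>The stress error\<close>

lemma fam_sum: "fam (\<Sum>a\<in>A. f a) \<sigma> = (\<Sum>a\<in>A. fam (f a) \<sigma>)"
  by (induction A rule: infinite_finite_induct) (auto simp: fam_zero fam_plus)

lemma lattice_tuples_1: "lattice_tuples 1 = (\<lambda>\<rho>. [\<rho>]) ` lattice_nz"
  by (auto simp: lattice_tuples_def length_Suc_conv)

lemma lattice_tuples_2: "lattice_tuples 2 = (\<lambda>(\<rho>, \<sigma>). [\<sigma>, \<rho>]) ` (lattice_nz \<times> lattice_nz)"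
  by (force simp: lattice_tuples_def numeral_2_eq_2 length_Suc_conv image_iff)

lemma lattice_tuples_3E:
  assumes "\<rho>s \<in> lattice_tuples 3"
  obtains \<rho> \<sigma> \<tau> where "\<rho>s = [\<rho>, \<sigma>, \<tau>]" "\<rho> \<in> lattice_nz" "\<sigma> \<in> lattice_nz" "\<tau> \<in> lattice_nz"
  using assms by (auto simp: lattice_tuples_def numeral_3_eq_3 length_Suc_conv)

lemma infsum_tuples_2:
  fixes f :: "(real ^ 'n) list \<Rightarrow> ennreal"
  shows "infsum f (lattice_tuples 2) = (\<Sum>\<^sub>\<infinity>(\<rho>, \<sigma>)\<in>lattice_nz \<times> lattice_nz. f [\<sigma>, \<rho>])"
  unfolding lattice_tuples_2 by (subst infsum_ennreal_reindex) (auto simp: inj_on_def case_prod_unfold)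

context potential
begin

lemma deriv1_has_sum:
  assumes "g \<in> S"
  shows "((\<lambda>\<sigma>. V_partial \<kappa> V [\<sigma>] g [fam h \<sigma>]) has_sum D [h] g) lattice_nz"
proof -
  have "((\<lambda>\<rho>s. V_partial \<kappa> V \<rho>s g (map2 fam [h] \<rho>s)) has_sum D [h] g) ((\<lambda>\<rho>. [\<rho>]) ` lattice_nz)"
    unfolding lattice_tuples_1[symmetric] using deriv_has_sum[of 1 g "[h]"] assms by auto
  then show ?thesis by (subst (asm) has_sum_reindex) (auto simp: inj_on_def o_def)
qed

lemma deriv2_has_sum:
  assumes g: "g \<in> S" and \<rho>: "\<rho> \<in> lattice_nz"
  shows "((\<lambda>\<sigma>. V_partial \<kappa> V [\<sigma>, \<rho>] g [fam h \<sigma>, v]) has_sum D [h, single_family \<rho> v] g) lattice_nz"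
proof -
  let ?h = "[h, single_family \<rho> v]"
  let ?f = "\<lambda>\<rho>s. V_partial \<kappa> V \<rho>s g (map2 fam ?h \<rho>s)"
  have "(?f has_sum D ?h g) (lattice_tuples 2)" by (rule deriv_has_sum) (use g in auto)
  moreover have "(?f has_sum D ?h g) (lattice_tuples 2) \<longleftrightarrow> (?f has_sum D ?h g) ((\<lambda>\<sigma>. [\<sigma>, \<rho>]) ` lattice_nz)"
  proof (rule has_sum_cong_neutral)
    fix \<rho>s assume "\<rho>s \<in> lattice_tuples 2 - (\<lambda>\<sigma>. [\<sigma>, \<rho>]) ` lattice_nz"
    then obtain a b where ab: "\<rho>s = [a, b]" "a \<in> lattice_nz" "b \<in> lattice_nz" "b \<noteq> \<rho>"
      unfolding lattice_tuples_2 by auto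
    have "V_partial \<kappa> V [a, b] g [fam h a, 0] = 0"
      by (rule V_partial_zero[where j = 2]) (use ab g k in \<open>auto simp: lattice_tuples_def\<close>)
    then show "?f \<rho>s = 0" using ab by (simp add: fam_single_family[OF \<rho>])
  qed (use \<rho> in \<open>auto simp: lattice_tuples_def\<close>)
  ultimately have "(?f has_sum D ?h g) ((\<lambda>\<sigma>. [\<sigma>, \<rho>]) ` lattice_nz)" by simp
  then show ?thesis
    by (subst (asm) has_sum_reindex) (auto simp: inj_on_def o_def fam_single_family[OF \<rho>])
qed

lemma force_bound:
  assumes "\<rho> \<in> lattice_nz" "g \<in> S" "norm e = 1"
  shows "ennreal \<bar>\<rho> $ \<alpha> * V_partial \<kappa> V [\<rho>] g [e]\<bar> \<le> m_weight \<kappa> V [\<rho>]"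
proof -
  have "\<bar>\<rho> $ \<alpha> * V_partial \<kappa> V [\<rho>] g [e]\<bar> \<le> norm \<rho> * \<bar>V_partial \<kappa> V [\<rho>] g [e]\<bar>"
    unfolding abs_mult by (intro mult_right_mono component_le_norm_cart) auto
  then have "ennreal \<bar>\<rho> $ \<alpha> * V_partial \<kappa> V [\<rho>] g [e]\<bar> \<le> ennreal (norm \<rho> * \<bar>V_partial \<kappa> V [\<rho>] g [e]\<bar>)"
    by (rule ennreal_leI)
  also have "\<dots> \<le> m_weight \<kappa> V [\<rho>]"
    using V_partial_bound[of "[\<rho>]" 1 "[e]" g] assms k by (simp add: lattice_tuples_def)
  finally show ?thesis .
qed

lemma force_derivative_bound:
  assumes \<rho>: "\<rho> \<in> lattice_nz" and \<sigma>: "\<sigma> \<in> lattice_nz" and g: "g \<in> S" and e: "norm e = 1"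
  shows "ennreal \<bar>\<rho> $ \<alpha> * V_partial \<kappa> V [\<sigma>, \<rho>] g [v, e]\<bar> \<le> m_weight \<kappa> V [\<sigma>, \<rho>] * ennreal (norm v / norm \<sigma>)"
proof -
  let ?P = "\<bar>V_partial \<kappa> V [\<sigma>, \<rho>] g [v, e]\<bar>"
  have \<sigma>0: "norm \<sigma> > 0" by (rule lattice_nz_pos[OF \<sigma>])
  have "\<bar>\<rho> $ \<alpha> * V_partial \<kappa> V [\<sigma>, \<rho>] g [v, e]\<bar> \<le> norm \<rho> * ?P"
    unfolding abs_mult by (intro mult_right_mono component_le_norm_cart) auto
  also have "\<dots> = 1 / norm \<sigma> * (norm \<sigma> * norm \<rho> * ?P)" using \<sigma>0 by simp
  finally have "ennreal \<bar>\<rho> $ \<alpha> * V_partial \<kappa> V [\<sigma>, \<rho>] g [v, e]\<bar> \<le> ennreal (1 / norm \<sigma>) * ennreal (norm \<sigma> * norm \<rho> * ?P)"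
    by (simp add: ennreal_leI flip: ennreal_mult)
  also have "\<dots> \<le> ennreal (1 / norm \<sigma>) * (m_weight \<kappa> V [\<sigma>, \<rho>] * ennreal (norm v))"
    using V_partial_bound[of "[\<sigma>, \<rho>]" 2 "[v, e]" g] assms k
    by (intro mult_left_mono) (auto simp: lattice_tuples_def)
  also have "\<dots> = m_weight \<kappa> V [\<sigma>, \<rho>] * (ennreal (1 / norm \<sigma>) * ennreal (norm v))" by (simp add: mult_ac)
  also have "ennreal (1 / norm \<sigma>) * ennreal (norm v) = ennreal (norm v / norm \<sigma>)" by (simp flip: ennreal_mult)
  finally show ?thesis .
qed

lemma force_second_derivative_bound:
  assumes \<rho>: "\<rho> \<in> lattice_nz" and \<sigma>: "\<sigma> \<in> lattice_nz" and \<tau>: "\<tau> \<in> lattice_nz" and g: "g \<in> S" and e: "norm e = 1"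
  shows "ennreal \<bar>\<rho> $ \<alpha> * V_partial \<kappa> V [\<rho>, \<sigma>, \<tau>] g [e, v, w]\<bar>
    \<le> m_weight \<kappa> V [\<rho>, \<sigma>, \<tau>] * (ennreal (norm v / norm \<sigma>) * ennreal (norm w / norm \<tau>))"
proof -
  let ?P = "\<bar>V_partial \<kappa> V [\<rho>, \<sigma>, \<tau>] g [e, v, w]\<bar>"
  have pos: "norm \<sigma> > 0" "norm \<tau> > 0" using lattice_nz_pos \<sigma> \<tau> by auto
  have "\<bar>\<rho> $ \<alpha> * V_partial \<kappa> V [\<rho>, \<sigma>, \<tau>] g [e, v, w]\<bar> \<le> norm \<rho> * ?P"
    unfolding abs_mult by (intro mult_right_mono component_le_norm_cart) auto
  also have "\<dots> = 1 / (norm \<sigma> * norm \<tau>) * (norm \<rho> * (norm \<sigma> * norm \<tau>) * ?P)" using pos by simp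
  finally have "ennreal \<bar>\<rho> $ \<alpha> * V_partial \<kappa> V [\<rho>, \<sigma>, \<tau>] g [e, v, w]\<bar>
      \<le> ennreal (1 / (norm \<sigma> * norm \<tau>)) * ennreal (norm \<rho> * (norm \<sigma> * norm \<tau>) * ?P)"
    using pos by (simp add: ennreal_leI flip: ennreal_mult)
  also have "\<dots> \<le> ennreal (1 / (norm \<sigma> * norm \<tau>)) * (m_weight \<kappa> V [\<rho>, \<sigma>, \<tau>] * ennreal (norm v * norm w))"
    using V_partial_bound[of "[\<rho>, \<sigma>, \<tau>]" 3 "[e, v, w]" g] assms k
    by (intro mult_left_mono) (auto simp: lattice_tuples_def)
  also have "\<dots> = m_weight \<kappa> V [\<rho>, \<sigma>, \<tau>] * (ennreal (1 / (norm \<sigma> * norm \<tau>)) * ennreal (norm v * norm w))"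
    by (simp add: mult_ac)
  also have "ennreal (1 / (norm \<sigma> * norm \<tau>)) * ennreal (norm v * norm w) = ennreal (norm v / norm \<sigma>) * ennreal (norm w / norm \<tau>)"
    using pos by (simp add: field_simps flip: ennreal_mult)
  finally show ?thesis .
qed

lemma V_partial_first_diff:
  assumes "\<rho> \<in> lattice_nz" "\<sigma> \<in> lattice_nz" "g \<in> S"
  shows "V_partial \<kappa> V [\<sigma>, \<rho>] g [v - w, e] = V_partial \<kappa> V [\<sigma>, \<rho>] g [v, e] - V_partial \<kappa> V [\<sigma>, \<rho>] g [w, e]"
proof -
  have "single_family \<sigma> (v - w) = single_family \<sigma> v - single_family \<sigma> w"
    by (rule fam_eqI) (auto simp: fam_single_family[OF assms(2)] fam_minus)
  moreover have lin: "linear (\<lambda>h. D [h, single_family \<rho> e] g)" by (rule linear_deriv) (use assms k in auto)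
  ultimately show ?thesis
    using linear_diff[OF lin, of "single_family \<sigma> v" "single_family \<sigma> w"] by (simp add: V_partial_eq)
qed

end

text \<open>The analytic input about the displacement: its increments are bounded by \<open>\<kappa>\<close>, and near \<open>x\<close>
  they are approximated by the gradient \<open>F\<close> and the Hessian form \<open>B\<close>, with errors controlled by
  local norms \<open>L2\<close> and \<open>L3\<close> of the second and third derivatives.\<close>
locale cauchy_born = potential k \<kappa> V + bond_weights \<zeta> R
  for k \<kappa> and V :: "'n::finite dfam \<Rightarrow> ereal" and \<zeta> :: "real ^ 'n \<Rightarrow> real" and R +
  fixes u :: "real ^ 'n \<Rightarrow> real ^ 'n" and x :: "real ^ 'n" and F :: "real ^ 'n ^ 'n"
    and B :: "real ^ 'n \<Rightarrow> real ^ 'n \<Rightarrow> real ^ 'n" and c :: real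
    and L2 L3 :: "real ^ 'n \<Rightarrow> real ^ 'n \<Rightarrow> ennreal"
  assumes lipschitz: "norm (u (b + v) - u b) \<le> \<kappa> * norm v"
    and gradient_bound: "norm (F *v v) \<le> \<kappa> * norm v"
    and jacobian: "jacobian u (at x) = F"
    and bilinear: "bilinear B" and c: "c \<ge> 0"
    and taylor1: "bond_weight \<zeta> \<xi> \<rho> x \<noteq> 0 \<Longrightarrow> \<rho> \<in> lattice_nz \<Longrightarrow> \<sigma> \<in> lattice_nz \<Longrightarrow>
      ennreal (norm (u (\<xi> + \<sigma>) - u \<xi> - F *v \<sigma>)) \<le> ennreal (c * (norm \<sigma> * (norm \<rho> + norm \<sigma>))) * L2 \<rho> \<sigma>"
    and taylor2: "bond_weight \<zeta> \<xi> \<rho> x \<noteq> 0 \<Longrightarrow> \<rho> \<in> lattice_nz \<Longrightarrow> \<sigma> \<in> lattice_nz \<Longrightarrow>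
      ennreal (norm (u (\<xi> + \<sigma>) - u \<xi> - F *v \<sigma> - B \<sigma> (\<xi> - x + \<sigma> /\<^sub>R 2)))
        \<le> ennreal (c * (norm \<sigma> * (norm \<rho> + norm \<sigma>)\<^sup>2)) * L3 \<rho> \<sigma>"
    and L3_symmetric: "L3 \<sigma> \<rho> = L3 \<rho> \<sigma>" "L3 (- \<rho>) (- \<sigma>) = L3 \<rho> \<sigma>"
begin

abbreviation "bw \<xi> \<rho> \<equiv> bond_weight \<zeta> \<xi> \<rho> x"
abbreviation "g0 \<equiv> linear_family F"
abbreviation "g \<xi> \<equiv> diff_family u \<xi>"

definition w :: "real ^ 'n \<Rightarrow> 'n dfam" where "w \<xi> = g \<xi> - g0"

definition wbar :: "real ^ 'n \<Rightarrow> 'n dfam" where "wbar \<rho> = (\<Sum>\<xi>\<in>sites x \<rho>. bw \<xi> \<rho> *\<^sub>R w \<xi>)"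

lemma g_in_S: "g \<xi> \<in> S"
  using norm_diff_family_le[OF lipschitz] by simp

lemma g0_in_S: "g0 \<in> S"
  unfolding linear_family_def using norm_dfam_of_le[of "\<lambda>\<rho>. F *v \<rho>" \<kappa>] gradient_bound by simp

lemma fam_w: "\<sigma> \<in> lattice_nz \<Longrightarrow> fam (w \<xi>) \<sigma> = u (\<xi> + \<sigma>) - u \<xi> - F *v \<sigma>"
  unfolding w_def by (simp add: fam_minus fam_diff_family[OF lipschitz] fam_linear_family)

lemma weighted_mean_bound:
  fixes v :: "real ^ 'n \<Rightarrow> 'b::real_normed_vector"
  assumes "\<And>\<xi>. bw \<xi> \<rho> \<noteq> 0 \<Longrightarrow> ennreal (norm (v \<xi>)) \<le> K"
  shows "ennreal (norm (\<Sum>\<xi>\<in>sites x \<rho>. bw \<xi> \<rho> *\<^sub>R v \<xi>)) \<le> K"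
proof -
  have "ennreal (norm (\<Sum>\<xi>\<in>sites x \<rho>. bw \<xi> \<rho> *\<^sub>R v \<xi>)) \<le> ennreal (\<Sum>\<xi>\<in>sites x \<rho>. bw \<xi> \<rho> * norm (v \<xi>))"
    using bond_weight_nonneg by (intro ennreal_leI sum_norm_le) simp
  also have "\<dots> = (\<Sum>\<xi>\<in>sites x \<rho>. ennreal (bw \<xi> \<rho>) * ennreal (norm (v \<xi>)))"
    using bond_weight_nonneg by (simp add: ennreal_mult flip: sum_ennreal)
  also have "\<dots> \<le> (\<Sum>\<xi>\<in>sites x \<rho>. ennreal (bw \<xi> \<rho>) * K)"
  proof (rule sum_mono)
    fix \<xi>
    show "ennreal (bw \<xi> \<rho>) * ennreal (norm (v \<xi>)) \<le> ennreal (bw \<xi> \<rho>) * K"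
      using assms[of \<xi>] by (cases "bw \<xi> \<rho> = 0") (auto intro: mult_left_mono)
  qed
  also have "\<dots> = ennreal (\<Sum>\<xi>\<in>sites x \<rho>. bw \<xi> \<rho>) * K"
    using bond_weight_nonneg by (simp add: sum_distrib_right[symmetric])
  finally show ?thesis by (simp add: bond_weight_sum)
qed

lemma norm_wbar: "norm (wbar \<rho>) \<le> 2 * \<kappa>"
proof -
  have "norm (w \<xi>) \<le> 2 * \<kappa>" for \<xi>
    unfolding w_def using norm_triangle_ineq4[of "g \<xi>" g0] g_in_S[of \<xi>] g0_in_S by simp
  then have "ennreal (norm (wbar \<rho>)) \<le> ennreal (2 * \<kappa>)"
    unfolding wbar_def by (intro weighted_mean_bound ennreal_leI)
  then show ?thesis using \<kappa> by simp
qed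

lemma fam_wbar: "fam (wbar \<rho>) \<sigma> = (\<Sum>\<xi>\<in>sites x \<rho>. bw \<xi> \<rho> *\<^sub>R fam (w \<xi>) \<sigma>)"
  by (simp add: wbar_def fam_sum fam_scaleR)

text \<open>After averaging over the sites the Hessian term depends on the two bonds only, because the
  barycentre of the sites is known.\<close>
lemma wbar_taylor:
  assumes \<rho>: "\<rho> \<in> lattice_nz" and \<sigma>: "\<sigma> \<in> lattice_nz"
  shows "ennreal (norm (fam (wbar \<rho>) \<sigma> - B \<sigma> ((\<sigma> - \<rho>) /\<^sub>R 2))) \<le> ennreal (c * (norm \<sigma> * (norm \<rho> + norm \<sigma>)\<^sup>2)) * L3 \<rho> \<sigma>"
proof -
  have lin: "linear (B \<sigma>)" using bilinear by (simp add: bilinear_def)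
  have "(\<Sum>\<xi>\<in>sites x \<rho>. bw \<xi> \<rho> *\<^sub>R B \<sigma> (\<xi> - x + \<sigma> /\<^sub>R 2)) = B \<sigma> (\<Sum>\<xi>\<in>sites x \<rho>. bw \<xi> \<rho> *\<^sub>R (\<xi> - x + \<sigma> /\<^sub>R 2))"
    by (simp add: linear_sum[OF lin] linear_cmul[OF lin])
  also have "(\<Sum>\<xi>\<in>sites x \<rho>. bw \<xi> \<rho> *\<^sub>R (\<xi> - x + \<sigma> /\<^sub>R 2))
      = (\<Sum>\<xi>\<in>sites x \<rho>. bw \<xi> \<rho> *\<^sub>R \<xi>) - (\<Sum>\<xi>\<in>sites x \<rho>. bw \<xi> \<rho>) *\<^sub>R (x - \<sigma> /\<^sub>R 2)"
  proof -
    have "bw \<xi> \<rho> *\<^sub>R (\<xi> - x + \<sigma> /\<^sub>R 2) = bw \<xi> \<rho> *\<^sub>R \<xi> - bw \<xi> \<rho> *\<^sub>R (x - \<sigma> /\<^sub>R 2)" for \<xi>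
      by (simp add: scaleR_diff_right scaleR_add_right)
    then show ?thesis by (simp only: sum_subtractf scaleR_sum_left)
  qed
  also have "\<dots> = (\<sigma> - \<rho>) /\<^sub>R 2"
    by (simp add: bond_weight_mean bond_weight_sum algebra_simps)
  finally have eq: "fam (wbar \<rho>) \<sigma> - B \<sigma> ((\<sigma> - \<rho>) /\<^sub>R 2)
      = (\<Sum>\<xi>\<in>sites x \<rho>. bw \<xi> \<rho> *\<^sub>R (u (\<xi> + \<sigma>) - u \<xi> - F *v \<sigma> - B \<sigma> (\<xi> - x + \<sigma> /\<^sub>R 2)))"
    by (simp add: fam_wbar fam_w[OF \<sigma>] sum_subtractf scaleR_diff_right)
  show ?thesis unfolding eq by (rule weighted_mean_bound) (rule taylor2[OF _ \<rho> \<sigma>])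
qed

definition pair_error :: ennreal where
  "pair_error = (\<Sum>\<^sub>\<infinity>\<rho>s\<in>lattice_tuples 2. m_weight \<kappa> V \<rho>s * ennreal ((tuple_length \<rho>s)\<^sup>2) * L3 (\<rho>s ! 0) (\<rho>s ! 1))"

definition triple_error :: ennreal where
  "triple_error = (\<Sum>\<^sub>\<infinity>\<rho>s\<in>lattice_tuples 3. m_weight \<kappa> V \<rho>s * ennreal ((tuple_length \<rho>s)\<^sup>2) *
    L2 (\<rho>s ! 0) (\<rho>s ! 1) * L2 (\<rho>s ! 0) (\<rho>s ! 2))"

text \<open>The pair terms for \<open>(\<rho>, \<sigma>)\<close> and \<open>(- \<rho>, - \<sigma>)\<close> are added before they are estimated: the Hessian
  contributions cancel exactly, although their sum over all pairs need not converge absolutely with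
  the available moments of the potential.\<close>
lemma linear_part:
  assumes e: "norm e = 1"
  obtains T where "((\<lambda>\<rho>. \<rho> $ \<alpha> * D [wbar \<rho>, single_family \<rho> e] g0) has_sum T) lattice_nz"
    "ennreal \<bar>T\<bar> \<le> ennreal c * pair_error"
proof -
  let ?N = "lattice_nz :: (real ^ 'n) set"
  define b where "b = (\<lambda>(\<rho>, \<sigma>). \<rho> $ \<alpha> * V_partial \<kappa> V [\<sigma>, \<rho>] g0 [fam (wbar \<rho>) \<sigma>, e])"
  have "ennreal \<bar>b (\<rho>, \<sigma>)\<bar> \<le> ennreal (2 * \<kappa>) * m_weight \<kappa> V [\<sigma>, \<rho>]" if "\<rho> \<in> ?N" "\<sigma> \<in> ?N" for \<rho> \<sigma>
  proof -
    have "norm (fam (wbar \<rho>) \<sigma>) \<le> 2 * \<kappa> * norm \<sigma>"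
      using norm_fam_le[of "wbar \<rho>" \<sigma>] mult_right_mono[OF norm_wbar[of \<rho>], of "norm \<sigma>"] by simp
    then have "norm (fam (wbar \<rho>) \<sigma>) / norm \<sigma> \<le> 2 * \<kappa>"
      using lattice_nz_pos[OF that(2)] by (simp add: divide_le_eq)
    then have "m_weight \<kappa> V [\<sigma>, \<rho>] * ennreal (norm (fam (wbar \<rho>) \<sigma>) / norm \<sigma>) \<le> m_weight \<kappa> V [\<sigma>, \<rho>] * ennreal (2 * \<kappa>)"
      by (intro mult_left_mono ennreal_leI) auto
    from order_trans[OF force_derivative_bound[OF that g0_in_S e] this]
    show ?thesis by (simp add: b_def mult.commute)
  qed
  then have "(\<Sum>\<^sub>\<infinity>p\<in>?N \<times> ?N. ennreal \<bar>b p\<bar>) \<le> (\<Sum>\<^sub>\<infinity>p\<in>?N \<times> ?N. ennreal (2 * \<kappa>) * (case p of (\<rho>, \<sigma>) \<Rightarrow> m_weight \<kappa> V [\<sigma>, \<rho>]))"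
    by (intro infsum_ennreal_mono) auto
  also have "\<dots> \<le> ennreal (2 * \<kappa>) * infsum (m_weight \<kappa> V) (lattice_tuples 2)"
    unfolding infsum_tuples_2 by (rule infsum_ennreal_cmult_le)
  also have "\<dots> < \<infinity>" using m_weight_summable[of 2] by (auto simp: ennreal_mult_less_top)
  finally have "b summable_on ?N \<times> ?N" by (rule summable_on_if_ennreal_finite)
  then obtain T where T: "(b has_sum T) (?N \<times> ?N)" unfolding summable_on_def by blast
  have fibre: "((\<lambda>\<sigma>. b (\<rho>, \<sigma>)) has_sum \<rho> $ \<alpha> * D [wbar \<rho>, single_family \<rho> e] g0) ?N" if "\<rho> \<in> ?N" for \<rho>
    unfolding b_def using deriv2_has_sum[OF g0_in_S that, of "wbar \<rho>" e] by (auto intro: has_sum_cmult_right)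
  have sum1: "((\<lambda>\<rho>. \<rho> $ \<alpha> * D [wbar \<rho>, single_family \<rho> e] g0) has_sum T) ?N"
    by (rule has_sum_SigmaD[OF T fibre])
  have "bij_betw (\<lambda>(\<rho>, \<sigma>). (- \<rho>, - \<sigma>)) (?N \<times> ?N) (?N \<times> ?N)"
    by (rule bij_betwI[where g = "\<lambda>(\<rho>, \<sigma>). (- \<rho>, - \<sigma>)"]) (auto simp: lattice_nz_uminus)
  from has_sum_reindex_bij_betw[OF this, of b T]
  have "((\<lambda>p. b (case p of (\<rho>, \<sigma>) \<Rightarrow> (- \<rho>, - \<sigma>))) has_sum T) (?N \<times> ?N)" using T by simp
  from has_sum_add[OF T this]
  have "((\<lambda>p. b p + b (case p of (\<rho>, \<sigma>) \<Rightarrow> (- \<rho>, - \<sigma>))) has_sum 2 * T) (?N \<times> ?N)" by simp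
  from ennreal_abs_has_sum_le[OF this]
  have "ennreal \<bar>2 * T\<bar> \<le> (\<Sum>\<^sub>\<infinity>p\<in>?N \<times> ?N. ennreal \<bar>b p + b (case p of (\<rho>, \<sigma>) \<Rightarrow> (- \<rho>, - \<sigma>))\<bar>)" .
  also have "\<dots> \<le> (\<Sum>\<^sub>\<infinity>p\<in>?N \<times> ?N. ennreal (2 * c) *
      (case p of (\<rho>, \<sigma>) \<Rightarrow> m_weight \<kappa> V [\<sigma>, \<rho>] * ennreal ((tuple_length [\<sigma>, \<rho>])\<^sup>2) * L3 ([\<sigma>, \<rho>] ! 0) ([\<sigma>, \<rho>] ! 1)))"
  proof (rule infsum_ennreal_mono, clarsimp)
    fix \<rho> \<sigma> :: "real ^ 'n" assume \<rho>: "\<rho> \<in> ?N" and \<sigma>: "\<sigma> \<in> ?N"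
    have m: "- \<rho> \<in> ?N" "- \<sigma> \<in> ?N" using \<rho> \<sigma> by (auto simp: lattice_nz_uminus)
    let ?v = "fam (wbar \<rho>) \<sigma>" and ?v' = "fam (wbar (- \<rho>)) (- \<sigma>)"
    let ?B = "B \<sigma> ((\<sigma> - \<rho>) /\<^sub>R 2)"
    let ?K = "c * (norm \<sigma> * (norm \<rho> + norm \<sigma>)\<^sup>2)"
    have K: "?K \<ge> 0" using c by simp
    have "B (- \<sigma>) ((- \<sigma> - - \<rho>) /\<^sub>R 2) = ?B"
    proof -
      have "B (- \<sigma>) (- ((\<sigma> - \<rho>) /\<^sub>R 2)) = ?B"
        using bilinear by (simp add: bilinear_lneg bilinear_rneg del: scaleR_minus_right)
      then show ?thesis by (simp add: algebra_simps)
    qed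
    then have v': "ennreal (norm (?v' - ?B)) \<le> ennreal ?K * L3 \<rho> \<sigma>"
      using wbar_taylor[OF m] by (simp add: L3_symmetric)
    have v: "ennreal (norm (?v - ?B)) \<le> ennreal ?K * L3 \<rho> \<sigma>" by (rule wbar_taylor[OF \<rho> \<sigma>])
    have "norm (?v - ?v') \<le> norm (?v - ?B) + norm (?v' - ?B)"
      using norm_triangle_ineq4[of "?v - ?B" "?v' - ?B"] by simp
    then have "ennreal (norm (?v - ?v')) \<le> ennreal (norm (?v - ?B)) + ennreal (norm (?v' - ?B))"
      by (simp add: ennreal_leI flip: ennreal_plus)
    also have "\<dots> \<le> ennreal ?K * L3 \<rho> \<sigma> + ennreal ?K * L3 \<rho> \<sigma>" by (intro add_mono v v')
    also have "\<dots> = ennreal (norm \<sigma>) * (ennreal (2 * c) * (ennreal ((norm \<sigma> + norm \<rho>)\<^sup>2) * L3 \<rho> \<sigma>))"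
    proof -
      have "ennreal ?K + ennreal ?K = ennreal (norm \<sigma> * (2 * c * (norm \<sigma> + norm \<rho>)\<^sup>2))"
        unfolding ennreal_plus[OF K K, symmetric] by (simp add: add.commute mult_ac)
      also have "\<dots> = ennreal (norm \<sigma>) * (ennreal (2 * c) * ennreal ((norm \<sigma> + norm \<rho>)\<^sup>2))"
        using c by (simp add: ennreal_mult)
      finally show ?thesis by (simp only: distrib_right[symmetric] mult.assoc)
    qed
    finally have diff: "ennreal (norm (?v - ?v')) \<le> \<dots>" .
    have \<sigma>0: "norm \<sigma> > 0" by (rule lattice_nz_pos[OF \<sigma>])
    have "ennreal (norm (?v - ?v') / norm \<sigma>) = ennreal (1 / norm \<sigma>) * ennreal (norm (?v - ?v'))"
      by (simp flip: ennreal_mult)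
    also have "\<dots> \<le> ennreal (1 / norm \<sigma>) * (ennreal (norm \<sigma>) * (ennreal (2 * c) * (ennreal ((norm \<sigma> + norm \<rho>)\<^sup>2) * L3 \<rho> \<sigma>)))"
      by (intro mult_left_mono diff) simp
    also have "\<dots> = ennreal (1 / norm \<sigma>) * ennreal (norm \<sigma>) * (ennreal (2 * c) * (ennreal ((norm \<sigma> + norm \<rho>)\<^sup>2) * L3 \<rho> \<sigma>))"
      by (simp only: mult.assoc)
    also have "ennreal (1 / norm \<sigma>) * ennreal (norm \<sigma>) = 1" using \<sigma>0 by (simp flip: ennreal_mult)
    finally have quot: "ennreal (norm (?v - ?v') / norm \<sigma>) \<le> ennreal (2 * c) * (ennreal ((norm \<sigma> + norm \<rho>)\<^sup>2) * L3 \<rho> \<sigma>)"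
      by simp
    have "b (\<rho>, \<sigma>) + b (- \<rho>, - \<sigma>) = \<rho> $ \<alpha> * V_partial \<kappa> V [\<sigma>, \<rho>] g0 [?v - ?v', e]"
      unfolding b_def prod.case
      by (simp add: V_partial_reflect[OF \<sigma> \<rho> g0_in_S] V_partial_first_diff[OF \<rho> \<sigma> g0_in_S] algebra_simps)
    then have "ennreal \<bar>b (\<rho>, \<sigma>) + b (- \<rho>, - \<sigma>)\<bar> \<le> m_weight \<kappa> V [\<sigma>, \<rho>] * ennreal (norm (?v - ?v') / norm \<sigma>)"
      using force_derivative_bound[OF \<rho> \<sigma> g0_in_S e] by simp
    also have "\<dots> \<le> m_weight \<kappa> V [\<sigma>, \<rho>] * (ennreal (2 * c) * (ennreal ((norm \<sigma> + norm \<rho>)\<^sup>2) * L3 \<rho> \<sigma>))"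
      by (intro mult_left_mono quot) simp
    finally show "ennreal \<bar>b (\<rho>, \<sigma>) + b (- \<rho>, - \<sigma>)\<bar> \<le> ennreal (2 * c) *
        (m_weight \<kappa> V [\<sigma>, \<rho>] * ennreal ((tuple_length [\<sigma>, \<rho>])\<^sup>2) * L3 \<sigma> \<rho>)"
      by (simp add: tuple_length_def L3_symmetric(1) mult_ac)
  qed
  also have "\<dots> \<le> ennreal (2 * c) * pair_error"
    unfolding pair_error_def infsum_tuples_2 by (rule infsum_ennreal_cmult_le)
  finally have twice: "ennreal \<bar>2 * T\<bar> \<le> ennreal (2 * c) * pair_error" .
  have "ennreal \<bar>T\<bar> = ennreal (1 / 2) * ennreal \<bar>2 * T\<bar>"
    by (subst ennreal_mult[symmetric]) (auto simp: abs_mult)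
  also have "\<dots> \<le> ennreal (1 / 2) * (ennreal (2 * c) * pair_error)" by (intro mult_left_mono twice) simp
  also have "\<dots> = ennreal c * pair_error" by (subst mult.assoc[symmetric], subst ennreal_mult[symmetric]) (use c in auto)
  finally show thesis using that sum1 by blast
qed

end

lemma norm_matrix_le_sum:
  fixes M :: "real ^ 'n ^ 'm"
  shows "norm M \<le> (\<Sum>i\<in>UNIV. \<Sum>\<alpha>\<in>UNIV. \<bar>M $ i $ \<alpha>\<bar>)"
proof -
  have "norm M \<le> (\<Sum>i\<in>UNIV. norm (M $ i))" unfolding norm_vec_def[of M] by (rule L2_set_le_sum) auto
  also have "\<dots> \<le> (\<Sum>i\<in>UNIV. \<Sum>\<alpha>\<in>UNIV. \<bar>M $ i $ \<alpha>\<bar>)" by (intro sum_mono norm_le_l1_cart)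
  finally show ?thesis .
qed

lemma ennreal_norm_matrix_le:
  fixes M :: "real ^ 'n ^ 'm"
  assumes "\<And>i \<alpha>. ennreal \<bar>M $ i $ \<alpha>\<bar> \<le> b"
  shows "ennreal (norm M) \<le> ennreal (real (CARD('m) * CARD('n))) * b"
proof -
  have "ennreal (norm M) \<le> ennreal (\<Sum>i\<in>UNIV. \<Sum>\<alpha>\<in>UNIV. \<bar>M $ i $ \<alpha>\<bar>)"
    by (rule ennreal_leI[OF norm_matrix_le_sum])
  also have "\<dots> = (\<Sum>i\<in>UNIV. \<Sum>\<alpha>\<in>UNIV. ennreal \<bar>M $ i $ \<alpha>\<bar>)"
    by (simp add: sum_nonneg flip: sum_ennreal)
  also have "\<dots> \<le> (\<Sum>i\<in>(UNIV :: 'm set). \<Sum>\<alpha>\<in>(UNIV :: 'n set). b)" by (intro sum_mono assms)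
  also have "\<dots> = of_nat (CARD('m) * CARD('n)) * b" by (simp add: mult.assoc)
  also have "\<dots> = ennreal (real (CARD('m) * CARD('n))) * b" by (simp only: ennreal_of_nat_eq_real_of_nat)
  finally show ?thesis .
qed

context cauchy_born
begin

lemma difference_quotient_bound:
  assumes "bw \<xi> \<rho> \<noteq> 0" and \<rho>: "\<rho> \<in> lattice_nz" and \<sigma>: "\<sigma> \<in> lattice_nz"
  shows "ennreal (norm (fam (w \<xi>) \<sigma>) / norm \<sigma>) \<le> ennreal (c * (norm \<rho> + norm \<sigma>)) * L2 \<rho> \<sigma>"
proof -
  have \<sigma>0: "norm \<sigma> > 0" by (rule lattice_nz_pos[OF \<sigma>])
  have "ennreal (norm (fam (w \<xi>) \<sigma>) / norm \<sigma>) = ennreal (1 / norm \<sigma>) * ennreal (norm (fam (w \<xi>) \<sigma>))"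
    by (simp flip: ennreal_mult)
  also have "\<dots> \<le> ennreal (1 / norm \<sigma>) * (ennreal (c * (norm \<sigma> * (norm \<rho> + norm \<sigma>))) * L2 \<rho> \<sigma>)"
    using taylor1[OF assms] by (intro mult_left_mono) (auto simp: fam_w[OF \<sigma>])
  also have "\<dots> = ennreal (1 / norm \<sigma> * (c * (norm \<sigma> * (norm \<rho> + norm \<sigma>)))) * L2 \<rho> \<sigma>"
    by (subst mult.assoc[symmetric], subst ennreal_mult[symmetric]) (use c in auto)
  also have "1 / norm \<sigma> * (c * (norm \<sigma> * (norm \<rho> + norm \<sigma>))) = c * (norm \<rho> + norm \<sigma>)"
    using \<sigma>0 by simp
  finally show ?thesis .
qed

definition triple_term :: "(real ^ 'n) list \<Rightarrow> ennreal" where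
  "triple_term \<rho>s = m_weight \<kappa> V \<rho>s * ennreal ((tuple_length \<rho>s)\<^sup>2) * L2 (\<rho>s ! 0) (\<rho>s ! 1) * L2 (\<rho>s ! 0) (\<rho>s ! 2)"

definition triple_sum :: "real ^ 'n \<Rightarrow> ennreal" where
  "triple_sum \<rho> = (\<Sum>\<^sub>\<infinity>\<rho>s\<in>lattice_tuples 3. if \<rho>s ! 0 = \<rho> then triple_term \<rho>s else 0)"

text \<open>The second derivative of the force is evaluated with the force direction outermost, so that the
  bond \<open>\<rho>\<close> of the stress is the first entry of each triple.\<close>
lemma third_derivative_bound:
  assumes nz: "bw \<xi> \<rho> \<noteq> 0" and \<rho>: "\<rho> \<in> lattice_nz" and p: "p \<in> S" and e: "norm e = 1"
  shows "ennreal \<bar>\<rho> $ \<alpha> * D [single_family \<rho> e, w \<xi>, w \<xi>] p\<bar> \<le> ennreal (c\<^sup>2) * triple_sum \<rho>"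
proof -
  let ?h = "[single_family \<rho> e, w \<xi>, w \<xi>]"
  have "((\<lambda>\<rho>s. V_partial \<kappa> V \<rho>s p (map2 fam ?h \<rho>s)) has_sum D ?h p) (lattice_tuples 3)"
    by (rule deriv_has_sum) (use p in auto)
  then have "((\<lambda>\<rho>s. \<rho> $ \<alpha> * V_partial \<kappa> V \<rho>s p (map2 fam ?h \<rho>s)) has_sum \<rho> $ \<alpha> * D ?h p) (lattice_tuples 3)"
    by (rule has_sum_cmult_right)
  then have "ennreal \<bar>\<rho> $ \<alpha> * D ?h p\<bar> \<le> (\<Sum>\<^sub>\<infinity>\<rho>s\<in>lattice_tuples 3. ennreal \<bar>\<rho> $ \<alpha> * V_partial \<kappa> V \<rho>s p (map2 fam ?h \<rho>s)\<bar>)"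
    by (rule ennreal_abs_has_sum_le)
  also have "\<dots> \<le> (\<Sum>\<^sub>\<infinity>\<rho>s\<in>lattice_tuples 3. ennreal (c\<^sup>2) * (if \<rho>s ! 0 = \<rho> then triple_term \<rho>s else 0))"
  proof (rule infsum_ennreal_mono)
    fix \<rho>s :: "(real ^ 'n) list" assume mem: "\<rho>s \<in> lattice_tuples 3"
    obtain a \<sigma> \<tau> where \<rho>s: "\<rho>s = [a, \<sigma>, \<tau>]" "a \<in> lattice_nz" and \<sigma>: "\<sigma> \<in> lattice_nz" and \<tau>: "\<tau> \<in> lattice_nz"
      using lattice_tuples_3E[OF mem] .
    let ?v = "fam (w \<xi>) \<sigma>" and ?v' = "fam (w \<xi>) \<tau>"
    show "ennreal \<bar>\<rho> $ \<alpha> * V_partial \<kappa> V \<rho>s p (map2 fam ?h \<rho>s)\<bar> \<le> ennreal (c\<^sup>2) * (if \<rho>s ! 0 = \<rho> then triple_term \<rho>s else 0)"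
    proof (cases "a = \<rho>")
      case False
      have "V_partial \<kappa> V \<rho>s p [0, ?v, ?v'] = 0"
        by (rule V_partial_zero[where j = 3]) (use mem p k in auto)
      then show ?thesis using False \<rho>s by (simp add: fam_single_family[OF \<rho>])
    next
      case True
      have len: "c * (norm \<rho> + norm \<sigma>) * (c * (norm \<rho> + norm \<tau>)) \<le> c\<^sup>2 * (tuple_length \<rho>s)\<^sup>2"
      proof -
        have "(norm \<rho> + norm \<sigma>) * (norm \<rho> + norm \<tau>) \<le> tuple_length \<rho>s * tuple_length \<rho>s"
          unfolding \<rho>s True tuple_length_def by (intro mult_mono) auto
        then have "c\<^sup>2 * ((norm \<rho> + norm \<sigma>) * (norm \<rho> + norm \<tau>)) \<le> c\<^sup>2 * (tuple_length \<rho>s * tuple_length \<rho>s)"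
          by (intro mult_left_mono) auto
        then show ?thesis by (simp add: power2_eq_square mult_ac)
      qed
      have "ennreal \<bar>\<rho> $ \<alpha> * V_partial \<kappa> V \<rho>s p [e, ?v, ?v']\<bar>
          \<le> m_weight \<kappa> V \<rho>s * (ennreal (norm ?v / norm \<sigma>) * ennreal (norm ?v' / norm \<tau>))"
        unfolding \<rho>s True by (rule force_second_derivative_bound[OF \<rho> \<sigma> \<tau> p e])
      also have "\<dots> \<le> m_weight \<kappa> V \<rho>s * ((ennreal (c * (norm \<rho> + norm \<sigma>)) * L2 \<rho> \<sigma>) * (ennreal (c * (norm \<rho> + norm \<tau>)) * L2 \<rho> \<tau>))"
        by (intro mult_left_mono mult_mono difference_quotient_bound nz \<rho> \<sigma> \<tau>) auto
      also have "\<dots> = ennreal (c * (norm \<rho> + norm \<sigma>) * (c * (norm \<rho> + norm \<tau>))) * (m_weight \<kappa> V \<rho>s * (L2 \<rho> \<sigma> * L2 \<rho> \<tau>))"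
        using c by (simp add: ennreal_mult mult_ac)
      also have "\<dots> \<le> ennreal (c\<^sup>2 * (tuple_length \<rho>s)\<^sup>2) * (m_weight \<kappa> V \<rho>s * (L2 \<rho> \<sigma> * L2 \<rho> \<tau>))"
        by (intro mult_right_mono ennreal_leI len) simp
      also have "\<dots> = ennreal (c\<^sup>2) * triple_term \<rho>s"
        using c by (simp add: triple_term_def \<rho>s True ennreal_mult mult_ac)
      finally show ?thesis using True \<rho>s by (simp add: fam_single_family[OF \<rho>])
    qed
  qed
  also have "\<dots> \<le> ennreal (c\<^sup>2) * triple_sum \<rho>" unfolding triple_sum_def by (rule infsum_ennreal_cmult_le)
  finally show ?thesis .
qed

text \<open>Since the weights sum to one, subtracting the force at the homogeneous deformation and its
  derivative in the mean increment leaves the weighted mean of the quadratic remainders.\<close>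
lemma force_taylor:
  assumes \<rho>: "\<rho> \<in> lattice_nz" and e: "norm e = 1"
  shows "ennreal \<bar>\<rho> $ \<alpha> * ((\<Sum>\<xi>\<in>sites x \<rho>. bw \<xi> \<rho> * V_partial \<kappa> V [\<rho>] (g \<xi>) [e]) - V_partial \<kappa> V [\<rho>] g0 [e]
      - D [wbar \<rho>, single_family \<rho> e] g0)\<bar> \<le> ennreal (c\<^sup>2) * triple_sum \<rho>"
proof -
  let ?s = "single_family \<rho> e"
  define rem where "rem = (\<lambda>\<xi>. D [?s] (g \<xi>) - D [?s] g0 - D [w \<xi>, ?s] g0)"
  have lin: "linear (\<lambda>h. D [h, ?s] g0)" by (rule linear_deriv) (use k g0_in_S in auto)
  have A1: "D [wbar \<rho>, ?s] g0 = (\<Sum>\<xi>\<in>sites x \<rho>. bw \<xi> \<rho> * D [w \<xi>, ?s] g0)"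
    unfolding wbar_def using linear_sum[OF lin, of "\<lambda>\<xi>. bw \<xi> \<rho> *\<^sub>R w \<xi>" "sites x \<rho>"] linear_cmul[OF lin] by simp
  have A2: "V_partial \<kappa> V [\<rho>] g0 [e] = (\<Sum>\<xi>\<in>sites x \<rho>. bw \<xi> \<rho> * D [?s] g0)"
    by (simp add: V_partial_eq sum_distrib_right[symmetric] bond_weight_sum)
  have A3: "V_partial \<kappa> V [\<rho>] (g \<xi>) [e] = D [?s] (g \<xi>)" for \<xi> by (simp add: V_partial_eq)
  have A4: "(\<Sum>\<xi>\<in>sites x \<rho>. bw \<xi> \<rho> *\<^sub>R (\<rho> $ \<alpha> * rem \<xi>)) = \<rho> $ \<alpha> * (\<Sum>\<xi>\<in>sites x \<rho>. bw \<xi> \<rho> * rem \<xi>)"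
    by (simp add: sum_distrib_left mult.left_commute)
  have eq: "\<rho> $ \<alpha> * ((\<Sum>\<xi>\<in>sites x \<rho>. bw \<xi> \<rho> * V_partial \<kappa> V [\<rho>] (g \<xi>) [e]) - V_partial \<kappa> V [\<rho>] g0 [e]
      - D [wbar \<rho>, ?s] g0) = (\<Sum>\<xi>\<in>sites x \<rho>. bw \<xi> \<rho> *\<^sub>R (\<rho> $ \<alpha> * rem \<xi>))"
    unfolding A1 A2 A3 A4 by (simp only: rem_def right_diff_distrib sum_subtractf)
  have "ennreal (norm (\<rho> $ \<alpha> * rem \<xi>)) \<le> ennreal (c\<^sup>2) * triple_sum \<rho>" if nz: "bw \<xi> \<rho> \<noteq> 0" for \<xi>
  proof -
    have "g0 + w \<xi> = g \<xi>" by (simp add: w_def)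
    then have mem: "g0 + w \<xi> \<in> S" using g_in_S by simp
    have len: "length [?s] + 2 \<le> k" using k by simp
    obtain p where p: "p \<in> S" "\<bar>D [?s] (g0 + w \<xi>) - D [?s] g0 - D [w \<xi>, ?s] g0\<bar> \<le> \<bar>D [w \<xi>, w \<xi>, ?s] p\<bar>"
      using deriv_taylor2[OF len g0_in_S mem] by blast
    have "\<bar>rem \<xi>\<bar> \<le> \<bar>D [?s, w \<xi>, w \<xi>] p\<bar>"
      using p(2) deriv_rotate[OF k p(1)] by (simp add: rem_def \<open>g0 + w \<xi> = g \<xi>\<close>)
    then have "ennreal (norm (\<rho> $ \<alpha> * rem \<xi>)) \<le> ennreal \<bar>\<rho> $ \<alpha> * D [?s, w \<xi>, w \<xi>] p\<bar>"
      by (intro ennreal_leI) (simp add: abs_mult mult_left_mono)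
    also have "\<dots> \<le> ennreal (c\<^sup>2) * triple_sum \<rho>" by (rule third_derivative_bound[OF nz \<rho> p(1) e])
    finally show ?thesis .
  qed
  from weighted_mean_bound[OF this] show ?thesis unfolding eq by simp
qed

text \<open>The chain rule is applied within the matrices whose linear families lie in the ball. They form a
  convex set with interior points, so the derivative found is the one that defines the stress.\<close>
lemma CB_stress_component:
  "((\<lambda>\<rho>. \<rho> $ \<alpha> * V_partial \<kappa> V [\<rho>] g0 [axis i 1]) has_sum CB_stress \<kappa> V u x $ i $ \<alpha>) lattice_nz"
proof -
  let ?T = "{G. linear_family G \<in> S}"
  let ?E = "axis i (axis \<alpha> 1) :: real ^ 'n ^ 'n"
  have lin: "linear linear_family" using bounded_linear_linear_family by (rule bounded_linear.linear)
  have "convex ?T"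
    using convex_linear_vimage[OF lin ball_body(1)] by (simp add: vimage_def)
  moreover have "interior ?T \<noteq> {}"
  proof -
    have "norm (linear_family G) \<le> norm G" for G :: "real ^ 'n ^ 'n"
      unfolding linear_family_def by (rule norm_dfam_of_le) (rule norm_matrix_vector_mult_le)
    then have "linear_family G \<in> S" if "G \<in> ball 0 \<kappa>" for G
      using that order_trans[of "norm (linear_family G)" "norm G" \<kappa>] by simp
    then have "ball 0 \<kappa> \<subseteq> ?T" by blast
    then have "ball 0 \<kappa> \<subseteq> interior ?T" by (intro interior_maximal) auto
    then show ?thesis using \<kappa> by fastforce
  qed
  moreover have "F \<in> ?T" using g0_in_S by simp
  moreover have "((\<lambda>G. real_of_ereal (CB_energy V G)) has_derivative (\<lambda>H. D [linear_family H] g0)) (at F within ?T)"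
  proof -
    have 1: "(linear_family has_derivative linear_family) (at F within ?T)"
      by (rule bounded_linear_imp_has_derivative[OF bounded_linear_linear_family])
    have "(D [] has_derivative (\<lambda>h. D [h] g0)) (at g0 within S)" by (rule has_deriv) (use k g0_in_S in auto)
    then have "(D [] has_derivative (\<lambda>h. D [h] g0)) (at g0 within linear_family ` ?T)"
      by (rule has_derivative_subset) auto
    from diff_chain_within[OF 1 this] show ?thesis by (simp add: o_def CB_energy_def)
  qed
  ultimately have "frechet_derivative (\<lambda>G. real_of_ereal (CB_energy V G)) (at F within ?T) = (\<lambda>H. D [linear_family H] g0)"
    by (rule frechet_derivative_eqI)
  then have eq: "CB_stress \<kappa> V u x $ i $ \<alpha> = D [linear_family ?E] g0" by (simp add: CB_stress_def jacobian)
  have "?E *v \<rho> = \<rho> $ \<alpha> *\<^sub>R axis i 1" for \<rho>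
    by (auto simp: vec_eq_iff matrix_vector_mul_component axis_def inner_axis' inner_vec_def if_distrib[of "\<lambda>x. x * _"] cong: if_cong)
  then have "V_partial \<kappa> V [\<rho>] g0 [fam (linear_family ?E) \<rho>] = \<rho> $ \<alpha> * V_partial \<kappa> V [\<rho>] g0 [axis i 1]" if "\<rho> \<in> lattice_nz" for \<rho>
    using V_partial_scale[of "[\<rho>]" 1 "[\<rho> $ \<alpha>]" "[axis i 1]" g0] that k g0_in_S
    by (simp add: fam_linear_family lattice_tuples_def)
  then show ?thesis
    unfolding eq using deriv1_has_sum[OF g0_in_S, of "linear_family ?E"] by (simp cong: has_sum_cong)
qed

text \<open>Absolute convergence over pairs of a site and a bond allows summing over the sites first; for
  each bond only finitely many sites contribute.\<close>
lemma atomistic_stress_component: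
  "((\<lambda>\<rho>. \<rho> $ \<alpha> * (\<Sum>\<xi>\<in>sites x \<rho>. bw \<xi> \<rho> * V_partial \<kappa> V [\<rho>] (g \<xi>) [axis i 1]))
    has_sum atomistic_stress \<kappa> V \<zeta> u x $ i $ \<alpha>) lattice_nz"
proof -
  let ?N = "lattice_nz :: (real ^ 'n) set" and ?L = "lattice :: (real ^ 'n) set"
  define Z where "Z = (\<lambda>\<rho> \<xi>. bw \<xi> \<rho> *\<^sub>R outer (V_force \<kappa> V \<rho> (g \<xi>)) \<rho>)"
  define \<mu> where "\<mu> = (\<lambda>\<rho>. enn2real (m_weight \<kappa> V [\<rho>]))"
  have sum1: "infsum (m_weight \<kappa> V) (lattice_tuples 1) = (\<Sum>\<^sub>\<infinity>\<rho>\<in>?N. m_weight \<kappa> V [\<rho>])"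
    unfolding lattice_tuples_1 by (rule infsum_ennreal_reindex) (auto simp: inj_on_def)
  have fin: "(\<Sum>\<^sub>\<infinity>\<rho>\<in>?N. m_weight \<kappa> V [\<rho>]) < \<infinity>" using m_weight_summable[of 1] sum1 by simp
  have m_fin: "ennreal (\<mu> \<rho>) = m_weight \<kappa> V [\<rho>]" if "\<rho> \<in> ?N" for \<rho>
  proof -
    have "m_weight \<kappa> V [\<rho>] \<le> (\<Sum>\<^sub>\<infinity>\<rho>\<in>?N. m_weight \<kappa> V [\<rho>])"
      using sum_le_infsum_ennreal[of "{\<rho>}" ?N "\<lambda>\<rho>. m_weight \<kappa> V [\<rho>]"] that by simp
    then have "m_weight \<kappa> V [\<rho>] < top" using fin order_le_less_trans by fastforce
    then show ?thesis by (simp add: \<mu>_def)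
  qed
  have \<mu>0: "\<mu> \<rho> \<ge> 0" for \<rho> by (simp add: \<mu>_def)
  have "(\<Sum>\<^sub>\<infinity>\<rho>\<in>?N. ennreal \<bar>\<mu> \<rho>\<bar>) < \<infinity>" using fin m_fin \<mu>0 by (simp cong: infsum_cong)
  then have \<mu>_sum: "\<mu> summable_on ?N" by (rule summable_on_if_ennreal_finite)
  let ?d = "real CARD('n) * real CARD('n)"
  have outer_le: "norm (outer (V_force \<kappa> V \<rho> (g \<xi>)) \<rho>) \<le> ?d * \<mu> \<rho>" if "\<rho> \<in> ?N" for \<rho> \<xi>
  proof -
    have "\<bar>outer (V_force \<kappa> V \<rho> (g \<xi>)) \<rho> $ j $ \<beta>\<bar> \<le> \<mu> \<rho>" for j \<beta>
    proof -
      have "ennreal \<bar>\<rho> $ \<beta> * V_partial \<kappa> V [\<rho>] (g \<xi>) [axis j 1]\<bar> \<le> ennreal (\<mu> \<rho>)"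
        unfolding m_fin[OF that] by (rule force_bound[OF that g_in_S]) simp
      then show ?thesis using \<mu>0 by (simp add: outer_def V_force_def mult.commute)
    qed
    then have "(\<Sum>j\<in>UNIV. \<Sum>\<beta>\<in>UNIV. \<bar>outer (V_force \<kappa> V \<rho> (g \<xi>)) \<rho> $ j $ \<beta>\<bar>) \<le> (\<Sum>j\<in>(UNIV :: 'n set). \<Sum>\<beta>\<in>(UNIV :: 'n set). \<mu> \<rho>)"
      by (intro sum_mono)
    then show ?thesis using norm_matrix_le_sum[of "outer (V_force \<kappa> V \<rho> (g \<xi>)) \<rho>"] by (simp add: mult.assoc)
  qed
  have inner: "(Z \<rho> has_sum sum (Z \<rho>) (sites x \<rho>)) ?L" for \<rho>
    by (rule has_sum_finite_neutralI[OF finite_sites sites_lattice]) (auto simp: Z_def bond_weight_off_sites)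
  have inner_norm: "((\<lambda>\<xi>. norm (Z \<rho> \<xi>)) has_sum (\<Sum>\<xi>\<in>sites x \<rho>. norm (Z \<rho> \<xi>))) ?L" for \<rho>
    by (rule has_sum_finite_neutralI[OF finite_sites sites_lattice]) (auto simp: Z_def bond_weight_off_sites)
  have bound: "(\<Sum>\<xi>\<in>sites x \<rho>. norm (Z \<rho> \<xi>)) \<le> ?d * \<mu> \<rho>" if "\<rho> \<in> ?N" for \<rho>
  proof -
    have "(\<Sum>\<xi>\<in>sites x \<rho>. norm (Z \<rho> \<xi>)) \<le> (\<Sum>\<xi>\<in>sites x \<rho>. bw \<xi> \<rho> * (?d * \<mu> \<rho>))"
      unfolding Z_def norm_scaleR using outer_le[OF that] bond_weight_nonneg
      by (intro sum_mono mult_mono) auto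
    then show ?thesis by (simp add: sum_distrib_right[symmetric] bond_weight_sum)
  qed
  have "(\<lambda>\<rho>. \<Sum>\<^sub>\<infinity>\<xi>\<in>?L. norm (Z \<rho> \<xi>)) summable_on ?N"
    unfolding infsumI[OF inner_norm]
  proof (rule summable_on_comparison_test)
    show "(\<lambda>\<rho>. ?d * \<mu> \<rho>) summable_on ?N" by (rule summable_on_cmult_right[OF \<mu>_sum])
  qed (auto intro: sum_nonneg bound)
  moreover have "(\<lambda>\<rho>. norm (\<Sum>\<^sub>\<infinity>\<xi>\<in>?L. norm (Z \<rho> \<xi>))) = (\<lambda>\<rho>. \<Sum>\<^sub>\<infinity>\<xi>\<in>?L. norm (Z \<rho> \<xi>))"
    unfolding infsumI[OF inner_norm] by (auto simp: sum_nonneg)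
  ultimately have "(\<lambda>p. norm ((\<lambda>(\<rho>, \<xi>). Z \<rho> \<xi>) p)) summable_on ?N \<times> ?L"
    using Infinite_Sum.abs_summable_on_Sigma_iff[of "\<lambda>(\<rho>, \<xi>). Z \<rho> \<xi>" ?N "\<lambda>_. ?L"] has_sum_imp_summable[OF inner_norm]
    by simp
  then have summable: "(\<lambda>(\<rho>, \<xi>). Z \<rho> \<xi>) summable_on ?N \<times> ?L" by (rule Infinite_Sum.abs_summable_summable)
  then obtain T where T: "((\<lambda>(\<rho>, \<xi>). Z \<rho> \<xi>) has_sum T) (?N \<times> ?L)" unfolding summable_on_def by blast
  have outer_sum: "((\<lambda>\<rho>. sum (Z \<rho>) (sites x \<rho>)) has_sum T) ?N"
    by (rule has_sum_SigmaD[OF T]) (simp add: inner)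
  have "atomistic_stress \<kappa> V \<zeta> u x = (\<Sum>\<^sub>\<infinity>\<xi>\<in>?L. \<Sum>\<^sub>\<infinity>\<rho>\<in>?N. Z \<rho> \<xi>)" by (simp add: atomistic_stress_def Z_def)
  also have "\<dots> = (\<Sum>\<^sub>\<infinity>\<rho>\<in>?N. \<Sum>\<^sub>\<infinity>\<xi>\<in>?L. Z \<rho> \<xi>)" by (rule infsum_swap_banach[OF summable, symmetric])
  also have "\<dots> = T" unfolding infsumI[OF inner] by (rule infsumI[OF outer_sum])
  finally have "((\<lambda>\<rho>. sum (Z \<rho>) (sites x \<rho>)) has_sum atomistic_stress \<kappa> V \<zeta> u x) ?N" using outer_sum by simp
  from has_sum_bounded_linear[OF bounded_linear_vec_nth has_sum_bounded_linear[OF bounded_linear_vec_nth this]]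
  have "((\<lambda>\<rho>. sum (Z \<rho>) (sites x \<rho>) $ i $ \<alpha>) has_sum atomistic_stress \<kappa> V \<zeta> u x $ i $ \<alpha>) ?N" .
  moreover have "sum (Z \<rho>) (sites x \<rho>) $ i $ \<alpha> = \<rho> $ \<alpha> * (\<Sum>\<xi>\<in>sites x \<rho>. bw \<xi> \<rho> * V_partial \<kappa> V [\<rho>] (g \<xi>) [axis i 1])" for \<rho>
    by (simp add: Z_def outer_def V_force_def sum_distrib_left mult_ac)
  ultimately show ?thesis by simp
qed

lemma stress_error_component:
  "ennreal \<bar>(atomistic_stress \<kappa> V \<zeta> u x - CB_stress \<kappa> V u x) $ i $ \<alpha>\<bar> \<le> ennreal (c + c\<^sup>2) * (pair_error + triple_error)"
proof -
  let ?E = "(atomistic_stress \<kappa> V \<zeta> u x - CB_stress \<kappa> V u x) $ i $ \<alpha>"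
  have e: "norm (axis i 1 :: real ^ 'n) = 1" by simp
  obtain T where T: "((\<lambda>\<rho>. \<rho> $ \<alpha> * D [wbar \<rho>, single_family \<rho> (axis i 1)] g0) has_sum T) lattice_nz"
    "ennreal \<bar>T\<bar> \<le> ennreal c * pair_error" using linear_part[OF e] .
  have "((\<lambda>\<rho>. \<rho> $ \<alpha> * (\<Sum>\<xi>\<in>sites x \<rho>. bw \<xi> \<rho> * V_partial \<kappa> V [\<rho>] (g \<xi>) [axis i 1])
      + - (\<rho> $ \<alpha> * V_partial \<kappa> V [\<rho>] g0 [axis i 1]) + - (\<rho> $ \<alpha> * D [wbar \<rho>, single_family \<rho> (axis i 1)] g0))
      has_sum (atomistic_stress \<kappa> V \<zeta> u x $ i $ \<alpha> + - CB_stress \<kappa> V u x $ i $ \<alpha> + - T)) lattice_nz"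
    by (intro has_sum_add atomistic_stress_component has_sum_uminusI CB_stress_component T(1))
  then have "((\<lambda>\<rho>. \<rho> $ \<alpha> * ((\<Sum>\<xi>\<in>sites x \<rho>. bw \<xi> \<rho> * V_partial \<kappa> V [\<rho>] (g \<xi>) [axis i 1])
      - V_partial \<kappa> V [\<rho>] g0 [axis i 1] - D [wbar \<rho>, single_family \<rho> (axis i 1)] g0)) has_sum (?E - T)) lattice_nz"
    by (simp add: algebra_simps)
  from ennreal_abs_has_sum_le[OF this]
  have "ennreal \<bar>?E - T\<bar> \<le> (\<Sum>\<^sub>\<infinity>\<rho>\<in>lattice_nz. ennreal \<bar>\<rho> $ \<alpha> * ((\<Sum>\<xi>\<in>sites x \<rho>. bw \<xi> \<rho> * V_partial \<kappa> V [\<rho>] (g \<xi>) [axis i 1])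
      - V_partial \<kappa> V [\<rho>] g0 [axis i 1] - D [wbar \<rho>, single_family \<rho> (axis i 1)] g0)\<bar>)" .
  also have "\<dots> \<le> (\<Sum>\<^sub>\<infinity>\<rho>\<in>lattice_nz. ennreal (c\<^sup>2) * triple_sum \<rho>)"
    by (intro infsum_ennreal_mono force_taylor e)
  also have "\<dots> \<le> ennreal (c\<^sup>2) * infsum triple_sum lattice_nz" by (rule infsum_ennreal_cmult_le)
  also have "\<dots> \<le> ennreal (c\<^sup>2) * triple_error"
    unfolding triple_sum_def triple_error_def triple_term_def[symmetric] by (intro mult_left_mono infsum_ennreal_fibres) simp
  finally have rest: "ennreal \<bar>?E - T\<bar> \<le> ennreal (c\<^sup>2) * triple_error" .
  have "ennreal \<bar>?E\<bar> \<le> ennreal (\<bar>T\<bar> + \<bar>?E - T\<bar>)" by (rule ennreal_leI) linarith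
  also have "\<dots> = ennreal \<bar>T\<bar> + ennreal \<bar>?E - T\<bar>" by simp
  also have "\<dots> \<le> ennreal c * pair_error + ennreal (c\<^sup>2) * triple_error" by (intro add_mono T rest)
  also have "\<dots> \<le> ennreal (c + c\<^sup>2) * pair_error + ennreal (c + c\<^sup>2) * triple_error"
    using c by (intro add_mono mult_right_mono ennreal_leI) auto
  finally show ?thesis by (simp add: distrib_left)
qed

lemma stress_error:
  "ennreal (norm (atomistic_stress \<kappa> V \<zeta> u x - CB_stress \<kappa> V u x))
    \<le> ennreal (real (CARD('n) * CARD('n)) * (c + c\<^sup>2)) * (pair_error + triple_error)"
proof -
  have "ennreal (norm (atomistic_stress \<kappa> V \<zeta> u x - CB_stress \<kappa> V u x))
      \<le> ennreal (real (CARD('n) * CARD('n))) * (ennreal (c + c\<^sup>2) * (pair_error + triple_error))"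
    by (rule ennreal_norm_matrix_le) (rule stress_error_component)
  also have "\<dots> = ennreal (real (CARD('n) * CARD('n)) * (c + c\<^sup>2)) * (pair_error + triple_error)"
    using c by (simp add: ennreal_mult mult.assoc)
  finally show ?thesis .
qed

end

section \<open>The stress estimate\<close>

theorem theorem4p3:
  fixes \<zeta> :: "real ^ 'n \<Rightarrow> real"
  assumes "\<zeta> \<in> W_inf 1" and "continuous_on UNIV \<zeta>"
    and "\<zeta> 0 = 1" and "\<And>\<xi>. \<xi> \<in> lattice_nz \<Longrightarrow> \<zeta> \<xi> = 0"
    and "\<And>x. \<zeta> x \<ge> 0"
    and "compact (closure {x. \<zeta> x \<noteq> 0})"
    and "\<And>x. \<zeta> (- x) = \<zeta> x"
    and "\<And>a b x. ((\<lambda>\<xi>. (a + b \<bullet> \<xi>) * \<zeta> (x - \<xi>)) has_sum (a + b \<bullet> x)) lattice"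
  shows "\<exists>c>0. \<exists>C>0. \<exists>\<nu> :: real ^ 'n \<Rightarrow> real ^ 'n \<Rightarrow> (real ^ 'n) set.
    (\<forall>\<rho>\<in>lattice_nz. \<forall>\<sigma>\<in>lattice_nz.
       \<nu> \<rho> \<sigma> \<in> sets lborel \<and>
       \<nu> \<rho> \<sigma> \<subseteq> ball 0 (c * (norm \<rho> + norm \<sigma>)) \<and>
       uminus ` \<nu> \<rho> \<sigma> = \<nu> \<rho> \<sigma> \<and>
       emeasure lborel (\<nu> \<rho> \<sigma>) \<le> ennreal (C * (parallelogram_area \<rho> \<sigma> + norm \<rho> + norm \<sigma>))) \<and>
    (\<forall>(k::nat) (\<kappa>::real) (A :: real ^ 'n ^ 'n) (V :: 'n dfam \<Rightarrow> ereal) (u :: real ^ 'n \<Rightarrow> real ^ 'n) (x :: real ^ 'n).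
       k \<ge> 3 \<longrightarrow> \<kappa> > 0 \<longrightarrow> det A > 0 \<longrightarrow> admissible_potential k \<kappa> V \<longrightarrow>
       u \<in> W3_inf_dot \<inter> K_set \<kappa> \<longrightarrow> continuous_on UNIV u \<longrightarrow>
       (let y = (\<lambda>z. A *v z + u z) in
          ennreal (norm (atomistic_stress \<kappa> V \<zeta> u x - CB_stress \<kappa> V u x)) \<le> ennreal C *
            ((\<Sum>\<^sub>\<infinity>\<rho>s\<in>lattice_tuples 2.
                m_weight \<kappa> V \<rho>s * ennreal ((tuple_length \<rho>s)\<^sup>2) *
                Linf_norm ((+) x ` \<nu> (\<rho>s ! 0) (\<rho>s ! 1)) (weak_grad3 y)) +
             (\<Sum>\<^sub>\<infinity>\<rho>s\<in>lattice_tuples 3.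
                m_weight \<kappa> V \<rho>s * ennreal ((tuple_length \<rho>s)\<^sup>2) *
                Linf_norm ((+) x ` \<nu> (\<rho>s ! 0) (\<rho>s ! 1)) (weak_grad2 y) *
                Linf_norm ((+) x ` \<nu> (\<rho>s ! 0) (\<rho>s ! 2)) (weak_grad2 y)))))"
proof -
  obtain R where R: "R > 0" "\<And>z. norm z > R \<Longrightarrow> \<zeta> z = 0"
  proof -
    have "bounded (closure {x. \<zeta> x \<noteq> 0})" using assms(6) by (rule compact_imp_bounded)
    then obtain R where "R > 0" "\<forall>z\<in>closure {x. \<zeta> x \<noteq> 0}. norm z \<le> R" by (auto simp: bounded_pos)
    then show thesis using that closure_subset[of "{x. \<zeta> x \<noteq> 0}"] by (metis (mono_tags, lifting) linorder_not_le mem_Collect_eq subsetD)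
  qed
  interpret bond_weights \<zeta> R
    by unfold_locales (use assms R in auto)
  \<comment> \<open>The factor \<open>1 + R\<close> bounds the distance from \<open>x\<close> to a contributing site by the length of the
    bond; the powers are those of the third-order estimate and dominate the second-order one.\<close>
  define c where "c = real CARD('n) ^ 4 * (1 + R)\<^sup>2"
  define volume_const where "volume_const = 45 * measure lborel (cball (0 :: real ^ 'n) (R + 1 + 2))"
  define stress_const where "stress_const = real (CARD('n) * CARD('n)) * (c + c\<^sup>2)"
  define C where "C = volume_const + stress_const + 1"
  have c0: "c \<ge> 0" by (simp add: c_def)
  have pos: "volume_const \<ge> 0" "stress_const \<ge> 0" using c0 by (auto simp: volume_const_def stress_const_def)
  have C: "C > 0" "volume_const \<le> C" "stress_const \<le> C" using pos by (auto simp: C_def)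
  let ?\<nu> = "region (R + 1) :: real ^ 'n \<Rightarrow> real ^ 'n \<Rightarrow> (real ^ 'n) set"
  have geometry: "?\<nu> \<rho> \<sigma> \<in> sets lborel \<and> ?\<nu> \<rho> \<sigma> \<subseteq> ball 0 ((R + 2) * (norm \<rho> + norm \<sigma>)) \<and>
      uminus ` ?\<nu> \<rho> \<sigma> = ?\<nu> \<rho> \<sigma> \<and>
      emeasure lborel (?\<nu> \<rho> \<sigma>) \<le> ennreal (C * (parallelogram_area \<rho> \<sigma> + norm \<rho> + norm \<sigma>))"
    if \<rho>: "\<rho> \<in> lattice_nz" and \<sigma>: "\<sigma> \<in> lattice_nz" for \<rho> \<sigma>
  proof (intro conjI)
    have n: "norm \<rho> \<ge> 1" "norm \<sigma> \<ge> 1" using lattice_nz_norm_ge_1 \<rho> \<sigma> by auto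
    show "?\<nu> \<rho> \<sigma> \<in> sets lborel" using borel_compact[OF compact_region] by simp
    \<comment> \<open>Nonzero lattice vectors have length at least one, so their lengths absorb the collar.\<close>
    have "(R + 1) * 2 \<le> (R + 1) * (norm \<rho> + norm \<sigma>)" using n R by (intro mult_left_mono) auto
    then have "norm \<rho> + norm \<sigma> + (R + 1) < (R + 2) * (norm \<rho> + norm \<sigma>)" using R by (simp add: algebra_simps)
    then show "?\<nu> \<rho> \<sigma> \<subseteq> ball 0 ((R + 2) * (norm \<rho> + norm \<sigma>))"
      using region_norm_le[of _ "R + 1" \<rho> \<sigma>] by force
    show "uminus ` ?\<nu> \<rho> \<sigma> = ?\<nu> \<rho> \<sigma>" by (rule uminus_region)
    have area: "parallelogram_area \<rho> \<sigma> \<ge> 0"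
    proof -
      have "(\<rho> \<bullet> \<sigma>)\<^sup>2 \<le> (norm \<rho>)\<^sup>2 * (norm \<sigma>)\<^sup>2"
        using power_mono[OF Cauchy_Schwarz_ineq2[of \<rho> \<sigma>], of 2] by (simp add: power_mult_distrib)
      then show ?thesis by (simp add: parallelogram_area_def)
    qed
    have "emeasure lborel (?\<nu> \<rho> \<sigma>) \<le> ennreal (volume_const * (parallelogram_area \<rho> \<sigma> + norm \<rho> + norm \<sigma>))"
      unfolding volume_const_def by (rule region_volume[OF n]) (use R in simp)
    also have "\<dots> \<le> ennreal (C * (parallelogram_area \<rho> \<sigma> + norm \<rho> + norm \<sigma>))"
      using C(2) area by (intro ennreal_leI mult_right_mono) auto
    finally show "emeasure lborel (?\<nu> \<rho> \<sigma>) \<le> ennreal (C * (parallelogram_area \<rho> \<sigma> + norm \<rho> + norm \<sigma>))" .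
  qed
  have estimate: "ennreal (norm (atomistic_stress \<kappa> V \<zeta> u x - CB_stress \<kappa> V u x)) \<le> ennreal C *
            ((\<Sum>\<^sub>\<infinity>\<rho>s\<in>lattice_tuples 2.
                m_weight \<kappa> V \<rho>s * ennreal ((tuple_length \<rho>s)\<^sup>2) *
                Linf_norm ((+) x ` ?\<nu> (\<rho>s ! 0) (\<rho>s ! 1)) (weak_grad3 y)) +
             (\<Sum>\<^sub>\<infinity>\<rho>s\<in>lattice_tuples 3.
                m_weight \<kappa> V \<rho>s * ennreal ((tuple_length \<rho>s)\<^sup>2) *
                Linf_norm ((+) x ` ?\<nu> (\<rho>s ! 0) (\<rho>s ! 1)) (weak_grad2 y) *
                Linf_norm ((+) x ` ?\<nu> (\<rho>s ! 0) (\<rho>s ! 2)) (weak_grad2 y)))"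
    if k: "k \<ge> 3" and \<kappa>: "\<kappa> > 0" and adm: "admissible_potential k \<kappa> V"
      and u: "u \<in> W3_inf_dot \<inter> K_set \<kappa>" "continuous_on UNIV u" and y: "y = (\<lambda>z. A *v z + u z)"
    for k :: nat and \<kappa> :: real and A :: "real ^ 'n ^ 'n" and V :: "'n dfam \<Rightarrow> ereal"
      and u y :: "real ^ 'n \<Rightarrow> real ^ 'n" and x :: "real ^ 'n"
  proof -
    have uW: "u \<in> W3_inf_dot" and uK: "u \<in> K_set \<kappa>" using u by auto
    obtain F B where F: "(u has_derivative (*v) F) (at x)" and B: "bilinear B"
      and t1: "\<And>\<xi> s S. S \<in> sets lborel \<Longrightarrow> (\<And>c. c \<in> bond_triangle x \<xi> s \<Longrightarrow> cball c 1 \<subseteq> S) \<Longrightarrow>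
        ennreal (norm (u (\<xi> + s) - u \<xi> - F *v s))
          \<le> ennreal (CARD('n) ^ 3 * (norm s * (norm (\<xi> - x) + norm s))) * Linf_norm S (weak_grad2 y)"
      and t2: "\<And>\<xi> s S. S \<in> sets lborel \<Longrightarrow> (\<And>c. c \<in> bond_triangle x \<xi> s \<Longrightarrow> cball c 1 \<subseteq> S) \<Longrightarrow>
        ennreal (norm (u (\<xi> + s) - u \<xi> - F *v s - B s (\<xi> - x + s /\<^sub>R 2)))
          \<le> ennreal (CARD('n) ^ 4 * (norm s * (norm (\<xi> - x) + norm s)\<^sup>2)) * Linf_norm S (weak_grad3 y)"
      by (rule displacement_taylor[OF uW u(2) y, of x]) blast
    define L2 where "L2 = (\<lambda>\<rho> \<sigma>. Linf_norm ((+) x ` ?\<nu> \<rho> \<sigma>) (weak_grad2 y))"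
    define L3 where "L3 = (\<lambda>\<rho> \<sigma>. Linf_norm ((+) x ` ?\<nu> \<rho> \<sigma>) (weak_grad3 y))"
    have lip: "norm (u (b + v) - u b) \<le> \<kappa> * norm v" for b v
      by (rule K_set_lipschitz[OF uK u(2)]) (use \<kappa> in simp)
    have reach: "norm (\<xi> - x) + norm \<sigma> \<le> (1 + R) * (norm \<rho> + norm \<sigma>)"
      if "bond_weight \<zeta> \<xi> \<rho> x \<noteq> 0" "\<rho> \<in> lattice_nz" for \<xi> \<rho> \<sigma>
    proof -
      have "norm (\<xi> - x) \<le> norm \<rho> + R" by (rule bond_weight_dist[OF that(1)])
      moreover have "R * 1 \<le> R * (norm \<rho> + norm \<sigma>)"
        using lattice_nz_norm_ge_1[OF that(2)] norm_ge_zero[of \<sigma>] R by (intro mult_left_mono) linarith+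
      ultimately show ?thesis by (simp add: algebra_simps)
    qed
    have card: "real CARD('n) \<ge> 1" using zero_less_card_finite[where 'a = 'n] by linarith
    interpret cauchy_born k \<kappa> V \<zeta> R u x F B c L2 L3
    proof unfold_locales
      show "norm (F *v v) \<le> \<kappa> * norm v" for v by (rule derivative_norm_le_lipschitz[OF F lip])
      show "jacobian u (at x) = F"
        unfolding jacobian_def by (simp add: frechet_derivative_at[OF F, symmetric])
    next
      fix \<xi> \<rho> \<sigma> :: "real ^ 'n"
      assume nz: "bond_weight \<zeta> \<xi> \<rho> x \<noteq> 0" and \<rho>: "\<rho> \<in> lattice_nz"
      have sub: "cball p 1 \<subseteq> (+) x ` ?\<nu> \<rho> \<sigma>" if "p \<in> bond_triangle x \<xi> \<sigma>" for p
        by (rule triangle_in_region[OF nz that])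
      note reach = reach[OF nz \<rho>, of \<sigma>]
      have "CARD('n) ^ 3 * (norm \<sigma> * (norm (\<xi> - x) + norm \<sigma>)) \<le> c * (norm \<sigma> * (norm \<rho> + norm \<sigma>))"
      proof -
        have "CARD('n) ^ 3 * (norm \<sigma> * (norm (\<xi> - x) + norm \<sigma>)) \<le> CARD('n) ^ 4 * (norm \<sigma> * ((1 + R) * (norm \<rho> + norm \<sigma>)))"
          using reach power_increasing[OF _ card, of 3 4] by (intro mult_mono mult_left_mono) auto
        also have "\<dots> = real CARD('n) ^ 4 * (1 + R) ^ 1 * (norm \<sigma> * (norm \<rho> + norm \<sigma>))" by simp
        also have "\<dots> \<le> c * (norm \<sigma> * (norm \<rho> + norm \<sigma>))"
          unfolding c_def using R by (intro mult_right_mono mult_left_mono power_increasing) auto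
        finally show ?thesis .
      qed
      then have "ennreal (CARD('n) ^ 3 * (norm \<sigma> * (norm (\<xi> - x) + norm \<sigma>))) * L2 \<rho> \<sigma> \<le> ennreal (c * (norm \<sigma> * (norm \<rho> + norm \<sigma>))) * L2 \<rho> \<sigma>"
        by (intro mult_right_mono ennreal_leI) auto
      with t1[OF region_shift_measurable sub]
      show "ennreal (norm (u (\<xi> + \<sigma>) - u \<xi> - F *v \<sigma>)) \<le> ennreal (c * (norm \<sigma> * (norm \<rho> + norm \<sigma>))) * L2 \<rho> \<sigma>"
        unfolding L2_def by (rule order_trans)
      have "CARD('n) ^ 4 * (norm \<sigma> * (norm (\<xi> - x) + norm \<sigma>)\<^sup>2) \<le> c * (norm \<sigma> * (norm \<rho> + norm \<sigma>)\<^sup>2)"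
      proof -
        have "CARD('n) ^ 4 * (norm \<sigma> * (norm (\<xi> - x) + norm \<sigma>)\<^sup>2) \<le> CARD('n) ^ 4 * (norm \<sigma> * ((1 + R) * (norm \<rho> + norm \<sigma>))\<^sup>2)"
          using reach by (intro mult_left_mono power_mono) auto
        then show ?thesis by (simp add: c_def power_mult_distrib mult_ac)
      qed
      then have "ennreal (CARD('n) ^ 4 * (norm \<sigma> * (norm (\<xi> - x) + norm \<sigma>)\<^sup>2)) * L3 \<rho> \<sigma> \<le> ennreal (c * (norm \<sigma> * (norm \<rho> + norm \<sigma>)\<^sup>2)) * L3 \<rho> \<sigma>"
        by (intro mult_right_mono ennreal_leI) auto
      with t2[OF region_shift_measurable sub]
      show "ennreal (norm (u (\<xi> + \<sigma>) - u \<xi> - F *v \<sigma> - B \<sigma> (\<xi> - x + \<sigma> /\<^sub>R 2)))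
          \<le> ennreal (c * (norm \<sigma> * (norm \<rho> + norm \<sigma>)\<^sup>2)) * L3 \<rho> \<sigma>"
        unfolding L3_def by (rule order_trans)
    qed (use k \<kappa> adm lip B c0 in \<open>auto simp: L3_def region_commute region_uminus_left region_uminus_right\<close>)
    have "ennreal (norm (atomistic_stress \<kappa> V \<zeta> u x - CB_stress \<kappa> V u x)) \<le> ennreal stress_const * (pair_error + triple_error)"
      unfolding stress_const_def by (rule stress_error)
    also have "\<dots> \<le> ennreal C * (pair_error + triple_error)" using C(3) by (intro mult_right_mono ennreal_leI) auto
    finally show ?thesis unfolding pair_error_def triple_error_def by (simp only: L2_def L3_def)
  qed
  show ?thesis
  proof (rule exI[of _ "R + 2"], intro conjI exI[of _ C] exI[of _ ?\<nu>] ballI allI impI)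
    show "R + 2 > 0" using R by simp
    show "C > 0" by (rule C)
  qed (use geometry estimate in \<open>auto simp: Let_def\<close>)
qed

end
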